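(* Let $C$ be a convex subset of $\mathbb{R}^n$. Let $f:C\to\mathbb{R}$ be a function, $m\in\mathbb{N}$ with $m\geq 3$, and let $\{P^{m}_{y}\}_{y\in C}$ be a family of polynomials on $\mathbb{R}^n$ of degree less than or equal to $m$ such that $P^{m}_y(y)=f(y)$ for every $y\in C$. Assume that $\{P^{m}_{y}\}_{y\in C}$ satisfies $(W^{m})$ and $(CW^{m})$ on $C$, and that $C$ is $(FIO^{m-1})$. Then $f$ has a convex extension $F\in C^{m-1}(\mathbb{R}^n)$ such that $J^{m-1}_{y}F=P^{m-1}_{y}$ for every $y\in C$.
   Context: $\mathbb{S}^{n-1}$ is the Euclidean unit sphere of $\mathbb{R}^n$. $D^jP(y)$ denotes the $j$-th derivative of $P$ at $y$ as a symmetric $j$-linear form, with $\|A\|=\sup_{u_i\in\mathbb{S}^{n-1}}|A(u_1,\ldots,u_j)|$; $D^{k}P(y)(w^{k-2},v^2)$ means this form evaluated with $w$ repeated $k-2$ times and $v$ repeated twice. $J^k_yF$ is the Taylor polynomial of order $k$ of $F$ at $y$. $P^{m-1}_y:=J^{m-1}_yP^m_y$ is the Taylor polynomial of order $m-1$ at $y$ of $P^m_y$. Ovaloids and FIO bodies: for an integer $k\ge2$, a subset $C$ of $\mathbb{R}^n$ is an ovaloid of class $C^k$ if there exist $M>0$ and a function $\psi:\mathbb{R}^n\to\mathbb{R}$ of class $C^k(\mathbb{R}^n)$ such that $D^2\psi(x)(v^2)\ge M$ for all $x\in\mathbb{R}^n$ and $v\in\mathbb{S}^{n-1}$, and $C=\psi^{-1}((-\infty,1])$.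 A set $C$ is $(FIO^k)$ if it is the intersection of a finite family of ovaloids of class $C^k$. Condition $(W^m)$ on $C$ (Whitney): for each compact $K\subset C$, $\lim_{\delta\to0^+}\rho_m(K,\delta)=0$, where $$\rho_m(K,\delta)=\sup\left\{\frac{\|D^jP^m_y(z)-D^jP^m_z(z)\|}{|y-z|^{m-j}}: j=0,\ldots,m,\ y,z\in K,\ 0<|y-z|\le\delta\right\}$$ (supremum over the empty set being $0$). Condition $(CW^m)$ on $C$ ($m\ge2$): for every $\varepsilon>0$ there exists $t_\varepsilon>0$ such that $$D^2P^{m}_{y}(y)(v^2)+ t\, D^3P^{m}_{y}(y)(w,v^2)+ \cdots + \frac{t^{m-2}}{(m-2)!} D^{m}P^{m}_{y}(y)(w^{m-2},v^2) \geq -\varepsilon t^{m-2}$$ for all $y\in C$, $v,w\in\mathbb{S}^{n-1}$, $0<t\le t_\varepsilon$. *)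

theory Defs
  imports "HOL-Analysis.Analysis"
begin

text \<open>
  \<open>nth_deriv [u\<^sub>1, \<dots>, u\<^sub>j] f x\<close> is \<open>D\<^sup>j f(x)(u\<^sub>1, \<dots>, u\<^sub>j)\<close>: the \<open>j\<close>-th derivative at \<open>x\<close> is the
  derivative of the \<open>(j-1)\<close>-st one.  The list carries the arguments of the form, so its length
  is the order.
\<close>

primrec nth_deriv :: "'a::euclidean_space list \<Rightarrow> ('a \<Rightarrow> real) \<Rightarrow> 'a \<Rightarrow> real" where
  "nth_deriv [] f x = f x"
| "nth_deriv (u # us) f x = frechet_derivative (nth_deriv us f) (at x) u"

text \<open>
  \<open>f\<close> is \<open>k\<close> times differentiable and its \<open>k\<close>-th derivative is continuous.  In finite dimension
  differentiability and continuity of a form-valued map amount to those of all its evaluations.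
\<close>

definition class_C :: "nat \<Rightarrow> ('a::euclidean_space \<Rightarrow> real) \<Rightarrow> bool" where
  "class_C k f \<longleftrightarrow>
     (\<forall>us x. length us < k \<longrightarrow> nth_deriv us f differentiable (at x)) \<and>
     (\<forall>us. length us = k \<longrightarrow> continuous_on UNIV (nth_deriv us f))"

definition form_norm :: "nat \<Rightarrow> ('a::euclidean_space list \<Rightarrow> real) \<Rightarrow> real" where
  "form_norm j A = Sup {\<bar>A us\<bar> | us. length us = j \<and> (\<forall>u\<in>set us. norm u = 1)}"

definition taylor_poly :: "nat \<Rightarrow> 'a::euclidean_space \<Rightarrow> ('a \<Rightarrow> real) \<Rightarrow> 'a \<Rightarrow> real" where
  "taylor_poly k y F x = (\<Sum>j\<le>k. nth_deriv (replicate j (x - y)) F y / fact j)"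

definition polynomial_deg_le :: "nat \<Rightarrow> (real ^ 'n::finite \<Rightarrow> real) \<Rightarrow> bool" where
  "polynomial_deg_le m P \<longleftrightarrow>
     (\<exists>c :: ('n \<Rightarrow> nat) \<Rightarrow> real. \<forall>x.
        P x = (\<Sum>\<alpha> | (\<Sum>i\<in>UNIV. \<alpha> i) \<le> m. c \<alpha> * (\<Prod>i\<in>UNIV. (x $ i) ^ \<alpha> i)))"

definition ovaloid :: "nat \<Rightarrow> 'a::euclidean_space set \<Rightarrow> bool" where
  "ovaloid k C \<longleftrightarrow>
     2 \<le> k \<and>
     (\<exists>M \<psi>. M > 0 \<and> class_C k \<psi> \<and>
        (\<forall>x v. norm v = 1 \<longrightarrow> nth_deriv [v, v] \<psi> x \<ge> M) \<and>
        C = \<psi> -` {..1})"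

text \<open>The empty family is not excluded; its intersection is the whole space.\<close>

definition FIO :: "nat \<Rightarrow> 'a::euclidean_space set \<Rightarrow> bool" where
  "FIO k C \<longleftrightarrow> (\<exists>\<A>. finite \<A> \<and> (\<forall>A\<in>\<A>. ovaloid k A) \<and> C = \<Inter>\<A>)"

text \<open>
  The supremum may be infinite, hence \<^typ>\<open>ennreal\<close>, in which the supremum of the empty set
  is \<open>0\<close>.
\<close>

definition whitney_rho ::
  "nat \<Rightarrow> ('a::euclidean_space \<Rightarrow> 'a \<Rightarrow> real) \<Rightarrow> 'a set \<Rightarrow> real \<Rightarrow> ennreal" where
  "whitney_rho m P K \<delta> =
     Sup {ennreal (form_norm j (\<lambda>us. nth_deriv us (P y) z - nth_deriv us (P z) z)
                     / norm (y - z) ^ (m - j))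
          | j y z. j \<le> m \<and> y \<in> K \<and> z \<in> K \<and> 0 < norm (y - z) \<and> norm (y - z) \<le> \<delta>}"

definition cond_W :: "nat \<Rightarrow> ('a::euclidean_space \<Rightarrow> 'a \<Rightarrow> real) \<Rightarrow> 'a set \<Rightarrow> bool" where
  "cond_W m P C \<longleftrightarrow>
     (\<forall>K. compact K \<and> K \<subseteq> C \<longrightarrow> (whitney_rho m P K \<longlongrightarrow> 0) (at_right 0))"

definition cond_CW :: "nat \<Rightarrow> ('a::euclidean_space \<Rightarrow> 'a \<Rightarrow> real) \<Rightarrow> 'a set \<Rightarrow> bool" where
  "cond_CW m P C \<longleftrightarrow>
     (\<forall>\<epsilon>>0. \<exists>t\<^sub>\<epsilon>>0. \<forall>y\<in>C. \<forall>v w t. norm v = 1 \<and> norm w = 1 \<and> 0 < t \<and> t \<le> t\<^sub>\<epsilon> \<longrightarrow>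
        (\<Sum>j=2..m. t ^ (j - 2) / fact (j - 2) *
             nth_deriv (replicate (j - 2) w @ [v, v]) (P y) y)
          \<ge> - \<epsilon> * t ^ (m - 2))"

end

theory Submission
  imports Defs
begin

text \<open>
  The extension is \<open>F + H\<close>, where \<open>F\<close> is a smooth extension of the jets that is almost convex
  near \<open>C\<close> and \<open>H\<close> is a convex function that vanishes on \<open>C\<close> together with its derivatives up to
  order \<open>m - 1\<close> and makes up for the defect of convexity of \<open>F\<close>.

  Whitney's condition yields \<open>F\<close> of class \<open>C\<^sup>m\<^sup>-\<^sup>1\<close> with compact support whose \<open>j\<close>-th derivative
  at \<open>x\<close> differs from that of \<open>P y\<close> by \<open>o(\<bar>x - y\<bar>\<^sup>m\<^sup>-\<^sup>j)\<close>, uniformly in \<open>y \<in> C\<close> for \<open>j \<le> m - 1\<close>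
  (\<open>whitney_extension\<close>).  Let \<open>x\<close> have distance \<open>d > 0\<close> from \<open>C\<close> and let \<open>y \<in> C\<close> be nearest to \<open>x\<close>.
  The sum in condition \<open>(CW)\<close>, with \<open>w\<close> the direction from \<open>y\<close> to \<open>x\<close> and \<open>t = d\<close>, is the Taylor
  expansion of the second derivative of \<open>P y\<close> at \<open>x\<close>.  Hence \<open>D\<^sup>2F(x)(v\<^sup>2) \<ge> - d\<^sup>m\<^sup>-\<^sup>2 \<omega>(d)\<close> for unit
  vectors \<open>v\<close>, with a modulus \<open>\<omega>\<close> tending to \<open>0\<close> at \<open>0\<close> (\<open>flat_modulus_majorant\<close>), and on \<open>C\<close> itself
  \<open>D\<^sup>2F \<ge> 0\<close>.

  It remains to find \<open>H\<close> with \<open>D\<^sup>2H(x)(v\<^sup>2) \<ge> d\<^sup>m\<^sup>-\<^sup>2 \<omega>(d)\<close> on the support of \<open>F\<close>.  If \<open>C\<close> has an interior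
  point, it is cut out by \<open>\<psi>\<^sub>i \<le> 1\<close> for finitely many functions with \<open>D\<^sup>2\<psi>\<^sub>i \<ge> M\<close> and
  \<open>H = (\<Sum>i. h(\<psi>\<^sub>i - 1))\<close> works (\<open>convex_barrier_ovaloids\<close>): for \<open>h\<close> convex and increasing,
  \<open>D\<^sup>2(h(\<psi>\<^sub>i - 1)) \<ge> M h'(\<psi>\<^sub>i - 1)\<close>, and by Slater's condition \<open>d\<close> is at most a constant times the largest
  \<open>\<psi>\<^sub>i - 1\<close>.  So \<open>h'(s)\<close> has to dominate \<open>s\<^sup>m\<^sup>-\<^sup>2 \<omega>(s)\<close>.  Integrating a multiple of \<open>\<omega>\<close> does this with
  \<open>h\<close> of class \<open>C\<^sup>m\<^sup>-\<^sup>1\<close>, flat at \<open>0\<close> (\<open>flat_function_above_modulus\<close>); the gap between \<open>h'\<close>, which is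
  what tangential directions see, and \<open>h''\<close> is where one order of differentiability is lost.
  By strict convexity an intersection of ovaloids without interior is empty or a point; for a point
  \<open>H\<close> is a sum of functions of finitely many linear forms (\<open>convex_barrier_singleton\<close>).
  The intersection of the empty family is the whole space, where the field itself is the function
  (\<open>convex_extension_UNIV\<close>).

  The extension \<open>F\<close> is a telescoping series over the dyadic scales \<open>\<epsilon>\<^sub>k\<close>.  A lattice partition of
  unity of mesh \<open>\<epsilon>\<^sub>k\<close> blends the polynomials at points of \<open>C\<close> near the lattice points into a function
  \<open>S\<^sub>k\<close>, which near \<open>C\<close> agrees with the field up to \<open>o(\<epsilon>\<^sub>k\<^sup>m)\<close>; cut-off functions \<open>T\<^sub>k\<close> equal to \<open>1\<close>
  near \<open>C\<close> replace \<open>S\<^sub>k\<close> by \<open>S\<^sub>k\<^sub>+\<^sub>1\<close> close to \<open>C\<close>.  The \<open>j\<close>-th derivative of the \<open>k\<close>-th correction is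
  \<open>o(\<epsilon>\<^sub>k\<^sup>m\<^sup>-\<^sup>j)\<close> everywhere, so the series converges geometrically in \<open>C\<^sup>m\<^sup>-\<^sup>1\<close>.
\<close>

section \<open>Iterated derivatives and functions of class C^k\<close>

definition dd :: "'a::euclidean_space \<Rightarrow> ('a \<Rightarrow> real) \<Rightarrow> 'a \<Rightarrow> real" where
  "dd u f x = frechet_derivative f (at x) u"

lemma nth_deriv_Nil: "nth_deriv [] f = f"
  by (rule ext) simp

lemma nth_deriv_Cons: "nth_deriv (u # us) f = dd u (nth_deriv us f)"
  by (rule ext) (simp add: dd_def)

declare nth_deriv.simps [simp del]
declare nth_deriv_Nil [simp]

lemma nth_deriv_append: "nth_deriv (us @ vs) f = nth_deriv us (nth_deriv vs f)"
  by (induction us) (simp_all add: nth_deriv_Cons)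

lemma nth_deriv_snoc: "nth_deriv (us @ [u]) f = nth_deriv us (dd u f)"
  by (simp add: nth_deriv_append nth_deriv_Cons)

lemma dd_eq: "(f has_derivative f') (at x) \<Longrightarrow> dd u f x = f' u"
  unfolding dd_def by (metis frechet_derivative_at)

lemma has_derivative_dd: "f differentiable (at x) \<Longrightarrow> (f has_derivative (\<lambda>u. dd u f x)) (at x)"
  unfolding dd_def using frechet_derivative_works by fastforce

lemma class_C_0: "class_C 0 f \<longleftrightarrow> continuous_on UNIV f"
  by (simp add: class_C_def)

text \<open>
\<open>nth_deriv\<close> adds derivatives on the outside.  Splitting off the innermost derivative instead reduces
a statement about derivatives of \<open>f\<close> up to order \<open>k + 1\<close> to the functions \<open>dd u f\<close> and order \<open>k\<close>;
all closure properties below are inductions of this kind.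
\<close>

lemma class_C_Suc:
  "class_C (Suc k) f \<longleftrightarrow> (\<forall>x. f differentiable (at x)) \<and> (\<forall>u. class_C k (dd u f))"
proof safe
  assume f: "class_C (Suc k) f"
  show "f differentiable (at x)" for x
    using f[unfolded class_C_def, THEN conjunct1, rule_format, of "[]" x] by simp
  show "class_C k (dd u f)" for u
    unfolding class_C_def
  proof (intro conjI allI impI)
    fix us :: "'a list" and x assume "length us < k"
    then show "nth_deriv us (dd u f) differentiable (at x)"
      using f[unfolded class_C_def, THEN conjunct1, rule_format, of "us @ [u]" x]
      by (simp add: nth_deriv_snoc)
  next
    fix us :: "'a list" assume "length us = k"
    then show "continuous_on UNIV (nth_deriv us (dd u f))"
      using f[unfolded class_C_def, THEN conjunct2, rule_format, of "us @ [u]"]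
      by (simp add: nth_deriv_snoc)
  qed
next
  assume d: "\<forall>x. f differentiable (at x)" and c: "\<forall>u. class_C k (dd u f)"
  show "class_C (Suc k) f"
    unfolding class_C_def
  proof (intro conjI allI impI)
    fix us :: "'a list" and x assume "length us < Suc k"
    then show "nth_deriv us f differentiable (at x)"
      using d c by (cases us rule: rev_cases) (auto simp: nth_deriv_snoc class_C_def)
  next
    fix us :: "'a list" assume "length us = Suc k"
    then show "continuous_on UNIV (nth_deriv us f)"
      using d c by (cases us rule: rev_cases) (auto simp: nth_deriv_snoc class_C_def)
  qed
qed

lemma class_C_SucD: "class_C (Suc k) f \<Longrightarrow> class_C k f"
proof (induction k arbitrary: f)
  case 0
  then have "\<And>x. f differentiable (at x)" by (simp add: class_C_Suc)
  then show ?case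
    by (auto simp: class_C_0 intro!: continuous_at_imp_continuous_on differentiable_imp_continuous_within)
next
  case (Suc k)
  then show ?case
    using class_C_Suc by blast
qed

lemma class_C_le:
  assumes "class_C k f" "j \<le> k" shows "class_C j f"
  using assms(2,1) by (induction rule: inc_induct) (auto intro: class_C_SucD)

lemma class_C_continuous: "class_C k f \<Longrightarrow> continuous_on UNIV f"
  using class_C_le[of k f 0] by (simp add: class_C_0)

lemma class_C_differentiable: "class_C k f \<Longrightarrow> 0 < k \<Longrightarrow> f differentiable (at x)"
  by (cases k) (auto simp: class_C_Suc)

lemma class_C_nth_deriv: "class_C k f \<Longrightarrow> length us + j \<le> k \<Longrightarrow> class_C j (nth_deriv us f)"
proof (induction us arbitrary: f k rule: rev_induct)
  case Nil
  then show ?case by (auto intro: class_C_le)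
next
  case (snoc u us)
  then obtain k' where "k = Suc k'" by (cases k) auto
  with snoc show ?case by (auto simp: nth_deriv_snoc class_C_Suc)
qed

lemma dd_const: "dd u (\<lambda>x. c) = (\<lambda>x. 0)"
  by (rule ext, rule dd_eq[THEN trans]) (rule has_derivative_const, simp)

lemma dd_add:
  assumes "\<And>x. f differentiable (at x)" "\<And>x. g differentiable (at x)"
  shows "dd u (\<lambda>x. f x + g x) = (\<lambda>x. dd u f x + dd u g x)"
  by (rule ext, rule dd_eq) (intro has_derivative_add has_derivative_dd assms)

lemma dd_mult:
  assumes "\<And>x. f differentiable (at x)" "\<And>x. g differentiable (at x)"
  shows "dd u (\<lambda>x. f x * g x) = (\<lambda>x. dd u f x * g x + f x * dd u g x)"
proof
  fix x
  show "dd u (\<lambda>x. f x * g x) x = dd u f x * g x + f x * dd u g x"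
    using has_derivative_mult[OF has_derivative_dd[OF assms(1)] has_derivative_dd[OF assms(2)], of x,
        THEN dd_eq, of u]
    by simp
qed

lemma dd_comp:
  assumes "\<And>t. h differentiable (at t)" "\<And>x. f differentiable (at x)"
  shows "dd u (\<lambda>x. h (f x)) = (\<lambda>x. dd (1::real) h (f x) * dd u f x)"
proof
  fix x
  have h: "(h has_derivative (\<lambda>t. t * dd 1 h (f x))) (at (f x))"
  proof -
    have "linear (\<lambda>u. dd u h (f x))"
      using has_derivative_dd[OF assms(1)] has_derivative_linear by blast
    then have "dd t h (f x) = t * dd 1 h (f x)" for t
      using linear_scale[of "\<lambda>u. dd u h (f x)" t 1] by simp
    then have "(\<lambda>t. t * dd 1 h (f x)) = (\<lambda>u. dd u h (f x))" by metis
    then show ?thesis using has_derivative_dd[OF assms(1)] by simp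
  qed
  show "dd u (\<lambda>x. h (f x)) x = dd 1 h (f x) * dd u f x"
    using dd_eq[OF has_derivative_compose[OF has_derivative_dd[OF assms(2)] h], of u]
    by (simp add: mult.commute)
qed

lemma dd_scale_arg:
  assumes "f differentiable (at x)" shows "dd (c *\<^sub>R u) f x = c * dd u f x"
proof -
  have "linear (\<lambda>u. dd u f x)"
    using has_derivative_dd[OF assms] has_derivative_linear by blast
  then show ?thesis using linear_scale[of "\<lambda>u. dd u f x" c u] by simp
qed

lemma dd_basis:
  assumes "f differentiable (at x)" shows "dd u f x = (\<Sum>b\<in>Basis. (u \<bullet> b) * dd b f x)"
proof -
  have "linear (\<lambda>u. dd u f x)"
    using has_derivative_dd[OF assms] has_derivative_linear by blast
  then have "dd (\<Sum>b\<in>Basis. (u \<bullet> b) *\<^sub>R b) f x = (\<Sum>b\<in>Basis. (u \<bullet> b) * dd b f x)"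
    using linear_sum[OF \<open>linear _\<close>, of "\<lambda>b. (u \<bullet> b) *\<^sub>R b" Basis]
    by (simp add: linear_scale[OF \<open>linear _\<close>])
  then show ?thesis by (simp add: euclidean_representation)
qed

lemma class_C_const: "class_C k (\<lambda>x. c)"
  by (induction k arbitrary: c) (auto simp: class_C_0 class_C_Suc dd_const)

lemma class_C_add: "class_C k f \<Longrightarrow> class_C k g \<Longrightarrow> class_C k (\<lambda>x. f x + g x)"
proof (induction k arbitrary: f g)
  case 0 then show ?case by (auto simp: class_C_0 intro: continuous_intros)
next
  case (Suc k) then show ?case by (auto simp: class_C_Suc dd_add)
qed

lemma class_C_mult: "class_C k f \<Longrightarrow> class_C k g \<Longrightarrow> class_C k (\<lambda>x. f x * g x)"
proof (induction k arbitrary: f g)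
  case 0 then show ?case by (auto simp: class_C_0 intro: continuous_intros)
next
  case (Suc k)
  then have "class_C k f" "class_C k g" by (auto intro: class_C_SucD)
  with Suc show ?case
    by (auto simp: class_C_Suc dd_mult intro!: class_C_add)
qed

lemma class_C_cmult: "class_C k f \<Longrightarrow> class_C k (\<lambda>x. c * f x)"
  by (intro class_C_mult class_C_const)

lemma class_C_diff: "class_C k f \<Longrightarrow> class_C k g \<Longrightarrow> class_C k (\<lambda>x. f x - g x)"
  using class_C_add[of k f "\<lambda>x. (-1) * g x"] class_C_cmult[of k g "-1"] by simp

lemma class_C_sum: "(\<And>i. i \<in> I \<Longrightarrow> class_C k (f i)) \<Longrightarrow> class_C k (\<lambda>x. \<Sum>i\<in>I. f i x)"
  by (induction I rule: infinite_finite_induct) (auto intro: class_C_const class_C_add)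

lemma class_C_prod: "(\<And>i. i \<in> I \<Longrightarrow> class_C k (f i)) \<Longrightarrow> class_C k (\<lambda>x. \<Prod>i\<in>I. f i x)"
  by (induction I rule: infinite_finite_induct) (auto intro: class_C_const class_C_mult)

lemma class_C_compose:
  "class_C k (h :: real \<Rightarrow> real) \<Longrightarrow> class_C k f \<Longrightarrow> class_C k (\<lambda>x. h (f x))"
proof (induction k arbitrary: h f)
  case 0 then show ?case
    by (auto simp: class_C_0 intro: continuous_on_compose2)
next
  case (Suc k)
  then have "class_C k f" by (auto intro: class_C_SucD)
  moreover have "(\<lambda>x. h (f x)) differentiable (at x)" for x
    using Suc.prems differentiable_chain_at[of f x h] by (auto simp: class_C_Suc o_def)
  ultimately show ?case
    using Suc by (auto simp: class_C_Suc dd_comp intro!: class_C_mult)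
qed

lemma class_C_inner: "class_C k (\<lambda>x. a \<bullet> x)"
proof (cases k)
  case 0 then show ?thesis by (auto simp: class_C_0 intro!: continuous_intros)
next
  case (Suc j)
  have d: "((\<lambda>x. a \<bullet> x) has_derivative (\<lambda>x. a \<bullet> x)) (at x)" for x
    by (auto intro!: derivative_eq_intros)
  then have "dd u (\<lambda>x. a \<bullet> x) = (\<lambda>x. a \<bullet> u)" for u
    using dd_eq by blast
  with Suc d show ?thesis
    by (auto simp: class_C_Suc class_C_const differentiable_def)
qed

lemma nth_deriv_const: "us \<noteq> [] \<Longrightarrow> nth_deriv us (\<lambda>x. c) = (\<lambda>x. 0)"
  by (induction us arbitrary: c rule: rev_induct)
    (auto simp: nth_deriv_snoc dd_const, metis nth_deriv_Nil)

lemma nth_deriv_zero: "nth_deriv us (\<lambda>x. 0) = (\<lambda>x. 0)"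
  using nth_deriv_const nth_deriv_Nil by (metis)

lemma nth_deriv_add:
  "class_C (length us) f \<Longrightarrow> class_C (length us) g \<Longrightarrow>
   nth_deriv us (\<lambda>x. f x + g x) = (\<lambda>x. nth_deriv us f x + nth_deriv us g x)"
  by (induction us arbitrary: f g rule: rev_induct)
    (simp_all add: nth_deriv_snoc class_C_Suc dd_add)

lemma nth_deriv_cmult:
  "class_C (length us) f \<Longrightarrow> nth_deriv us (\<lambda>x. c * f x) = (\<lambda>x. c * nth_deriv us f x)"
  by (induction us arbitrary: f rule: rev_induct)
    (simp_all add: nth_deriv_snoc class_C_Suc dd_mult dd_const)

lemma nth_deriv_diff:
  "class_C (length us) f \<Longrightarrow> class_C (length us) g \<Longrightarrow>
   nth_deriv us (\<lambda>x. f x - g x) = (\<lambda>x. nth_deriv us f x - nth_deriv us g x)"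
  using nth_deriv_add[of us f "\<lambda>x. (-1) * g x"] class_C_cmult[of _ g "-1"]
    nth_deriv_cmult[of us g "-1"]
  by simp

lemma nth_deriv_sum:
  "(\<And>i. i \<in> I \<Longrightarrow> class_C (length us) (f i)) \<Longrightarrow>
   nth_deriv us (\<lambda>x. \<Sum>i\<in>I. f i x) = (\<lambda>x. \<Sum>i\<in>I. nth_deriv us (f i) x)"
  by (induction I rule: infinite_finite_induct)
    (auto simp: nth_deriv_zero nth_deriv_add class_C_sum)

lemma nth_deriv_local:
  assumes "open S" "\<And>x. x \<in> S \<Longrightarrow> f x = g x" "x \<in> S"
  shows "nth_deriv us f x = nth_deriv us g x"
  using assms(3)
proof (induction us arbitrary: x)
  case Nil then show ?case using assms by simp
next
  case (Cons u us)
  have "(nth_deriv us f has_derivative D) (at x) \<longleftrightarrow> (nth_deriv us g has_derivative D) (at x)" for D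
    using has_derivative_transform_within_open[OF _ assms(1) Cons.prems] Cons.IH by metis
  then show ?case
    by (simp add: nth_deriv_Cons dd_def frechet_derivative_def)
qed

text \<open>
Homogeneity in all arguments at once.  The map \<open>d\<close> serves both for a common scalar factor
(\<open>d = id\<close>) and for normalising the arguments (\<open>c = norm\<close>, \<open>d = sgn\<close>).
\<close>

lemma nth_deriv_scale_args:
  "class_C (length us) f \<Longrightarrow>
   nth_deriv (map (\<lambda>u. c u *\<^sub>R d u) us) f = (\<lambda>x. (\<Prod>u\<leftarrow>us. c u) * nth_deriv (map d us) f x)"
proof (induction us)
  case (Cons u us)
  then have IH: "nth_deriv (map (\<lambda>u. c u *\<^sub>R d u) us) f = (\<lambda>x. (\<Prod>u\<leftarrow>us. c u) * nth_deriv (map d us) f x)"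
    by (auto intro: class_C_SucD)
  have "class_C 1 (nth_deriv (map d us) f)"
    using class_C_nth_deriv[OF Cons.prems, of "map d us" 1] by simp
  then have D: "nth_deriv (map d us) f differentiable (at x)" for x
    by (simp add: class_C_Suc)
  show ?case
    by (rule ext) (simp add: nth_deriv_Cons IH dd_mult dd_const D dd_scale_arg)
qed simp

lemma dd_affine:
  assumes "\<And>y. f differentiable (at y)"
  shows "dd u (\<lambda>x. f (c *\<^sub>R x - a)) = (\<lambda>x. c * dd u f (c *\<^sub>R x - a))"
proof
  fix x
  have "((\<lambda>x. c *\<^sub>R x - a) has_derivative (\<lambda>x. c *\<^sub>R x)) (at x)"
    by (auto intro!: derivative_eq_intros)
  from dd_eq[OF has_derivative_compose[OF this has_derivative_dd[OF assms]], of u]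
  show "dd u (\<lambda>x. f (c *\<^sub>R x - a)) x = c * dd u f (c *\<^sub>R x - a)"
    using dd_scale_arg[OF assms] by simp
qed

lemma class_C_affine: "class_C k f \<Longrightarrow> class_C k (\<lambda>x. f (c *\<^sub>R x - a))"
proof (induction k arbitrary: f)
  case 0
  then show ?case by (auto simp: class_C_0 intro!: continuous_intros intro: continuous_on_compose2)
next
  case (Suc k)
  have f: "f differentiable (at y)" for y using Suc.prems by (simp add: class_C_Suc)
  have "((\<lambda>x. c *\<^sub>R x - a) has_derivative (\<lambda>x. c *\<^sub>R x)) (at x)" for x
    by (auto intro!: derivative_eq_intros)
  then have "(\<lambda>x. f (c *\<^sub>R x - a)) differentiable (at x)" for x
    using has_derivative_compose has_derivative_dd[OF f] unfolding differentiable_def by blast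
  then show ?case
    using Suc by (auto simp: class_C_Suc dd_affine[OF f] intro!: class_C_cmult)
qed

lemma nth_deriv_affine:
  "class_C (length us) f \<Longrightarrow>
   nth_deriv us (\<lambda>x. f (c *\<^sub>R x - a)) = (\<lambda>x. c ^ length us * nth_deriv us f (c *\<^sub>R x - a))"
proof (induction us arbitrary: f rule: rev_induct)
  case (snoc u us)
  then have "\<And>y. f differentiable (at y)" "class_C (length us) (dd u f)" by (auto simp: class_C_Suc)
  then show ?case
    using snoc.IH[of "dd u f"] class_C_affine[of "length us" "dd u f" c a]
    by (simp add: nth_deriv_snoc dd_affine nth_deriv_cmult mult.assoc)
qed simp

section \<open>Bounds on jets at a given length scale\<close>

text \<open>
Every slot is measured in units of \<open>\<epsilon>\<close>, which is the natural normalisation for a function that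
varies over distances of order \<open>\<epsilon>\<close>: then no power of \<open>\<epsilon>\<close> appears in the product rule, and
passing from \<open>f\<close> to \<open>dd u f\<close> only multiplies the constant by \<open>norm u / \<epsilon>\<close>.
\<close>

definition jet_le :: "nat \<Rightarrow> real \<Rightarrow> real \<Rightarrow> ('a::euclidean_space \<Rightarrow> real) \<Rightarrow> 'a \<Rightarrow> bool" where
  "jet_le k A \<epsilon> f x \<longleftrightarrow>
     (\<forall>us. length us \<le> k \<longrightarrow> \<bar>nth_deriv us f x\<bar> \<le> A * (\<Prod>u\<leftarrow>us. norm u / \<epsilon>))"

lemma jet_leD: "jet_le k A \<epsilon> f x \<Longrightarrow> length us \<le> k \<Longrightarrow> \<bar>nth_deriv us f x\<bar> \<le> A * (\<Prod>u\<leftarrow>us. norm u / \<epsilon>)"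
  by (simp add: jet_le_def)

lemma jet_le_0: "jet_le 0 A \<epsilon> f x \<longleftrightarrow> \<bar>f x\<bar> \<le> A"
  by (simp add: jet_le_def)

lemma jet_le_Suc:
  "jet_le (Suc k) A \<epsilon> f x \<longleftrightarrow> \<bar>f x\<bar> \<le> A \<and> (\<forall>u. jet_le k (A * (norm u / \<epsilon>)) \<epsilon> (dd u f) x)"
proof safe
  assume J: "jet_le (Suc k) A \<epsilon> f x"
  show "\<bar>f x\<bar> \<le> A" using jet_leD[OF J, of "[]"] by simp
  show "jet_le k (A * (norm u / \<epsilon>)) \<epsilon> (dd u f) x" for u
    unfolding jet_le_def
  proof (intro allI impI)
    fix us :: "'a list" assume "length us \<le> k"
    with jet_leD[OF J, of "us @ [u]"]
    show "\<bar>nth_deriv us (dd u f) x\<bar> \<le> A * (norm u / \<epsilon>) * (\<Prod>u\<leftarrow>us. norm u / \<epsilon>)"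
      by (simp add: nth_deriv_snoc mult.commute mult.left_commute)
  qed
next
  assume "\<bar>f x\<bar> \<le> A" "\<forall>u. jet_le k (A * (norm u / \<epsilon>)) \<epsilon> (dd u f) x"
  then show "jet_le (Suc k) A \<epsilon> f x"
    unfolding jet_le_def
    by (intro allI impI, rename_tac us, case_tac us rule: rev_cases) (auto simp: nth_deriv_snoc ac_simps)
qed

lemma prod_list_norm_nonneg: "0 \<le> \<epsilon> \<Longrightarrow> 0 \<le> (\<Prod>u\<leftarrow>us. norm u / \<epsilon>)"
  by (induction us) auto

lemma jet_le_mono:
  assumes "jet_le k A \<epsilon> f x" "0 < \<delta>" "\<delta> \<le> \<epsilon>" "A \<le> B" "j \<le> k"
  shows "jet_le j B \<delta> f x"
  unfolding jet_le_def
proof (intro allI impI)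
  fix us :: "'a list" assume "length us \<le> j"
  have "(\<Prod>u\<leftarrow>us. norm u / \<epsilon>) \<le> (\<Prod>u\<leftarrow>us. norm u / \<delta>)"
  proof (induction us)
    case (Cons u us)
    have "norm u / \<epsilon> \<le> norm u / \<delta>" using assms by (intro divide_left_mono) auto
    then have "(norm u / \<epsilon>) * (\<Prod>u\<leftarrow>us. norm u / \<epsilon>) \<le> (norm u / \<delta>) * (\<Prod>u\<leftarrow>us. norm u / \<delta>)"
      using Cons assms by (intro mult_mono prod_list_norm_nonneg) auto
    then show ?case by simp
  qed simp
  moreover have "0 \<le> A" using jet_leD[OF assms(1), of "[]"] by simp
  ultimately have "A * (\<Prod>u\<leftarrow>us. norm u / \<epsilon>) \<le> B * (\<Prod>u\<leftarrow>us. norm u / \<delta>)"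
    using assms by (auto intro!: mult_mono prod_list_norm_nonneg)
  then show "\<bar>nth_deriv us f x\<bar> \<le> B * (\<Prod>u\<leftarrow>us. norm u / \<delta>)"
    using jet_leD[OF assms(1), of us] \<open>length us \<le> j\<close> assms(5) by linarith
qed

lemma prod_list_norm_divide: "(\<Prod>u\<leftarrow>us. norm u / c) = (\<Prod>u\<leftarrow>us. norm u) / c ^ length us"
  by (induction us) auto

text \<open>
Passing to a length unit larger by the factor \<open>c\<close> costs at most \<open>c\<close> per derivative.
\<close>

lemma jet_le_rescale:
  assumes J: "jet_le k B (\<epsilon> / c) f x" and c: "1 \<le> c" and \<epsilon>: "0 < \<epsilon>"
  shows "jet_le k (B * c ^ k) \<epsilon> f x"
  unfolding jet_le_def
proof (intro allI impI)
  fix us :: "'a list" assume us: "length us \<le> k"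
  have B: "0 \<le> B" using jet_leD[OF J, of "[]"] by simp
  have "(\<Prod>u\<leftarrow>us. norm u / (\<epsilon> / c)) = c ^ length us * (\<Prod>u\<leftarrow>us. norm u / \<epsilon>)"
    by (induction us) (auto simp: field_simps)
  also have "\<dots> \<le> c ^ k * (\<Prod>u\<leftarrow>us. norm u / \<epsilon>)"
    using us c \<epsilon> by (intro mult_right_mono power_increasing prod_list_norm_nonneg) auto
  finally have "B * (\<Prod>u\<leftarrow>us. norm u / (\<epsilon> / c)) \<le> B * (c ^ k * (\<Prod>u\<leftarrow>us. norm u / \<epsilon>))"
    using B by (rule mult_left_mono)
  with jet_leD[OF J us] show "\<bar>nth_deriv us f x\<bar> \<le> B * c ^ k * (\<Prod>u\<leftarrow>us. norm u / \<epsilon>)"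
    by (simp add: mult.assoc)
qed

lemma jet_le_local:
  assumes "open S" "\<And>x. x \<in> S \<Longrightarrow> f x = g x" "x \<in> S"
  shows "jet_le k A \<epsilon> f x = jet_le k A \<epsilon> g x"
  using nth_deriv_local[OF assms] by (simp add: jet_le_def)

lemma jet_le_add:
  assumes "jet_le k A \<epsilon> f x" "jet_le k B \<epsilon> g x" "class_C k f" "class_C k g"
  shows "jet_le k (A + B) \<epsilon> (\<lambda>x. f x + g x) x"
  unfolding jet_le_def
proof (intro allI impI)
  fix us :: "'a list" assume l: "length us \<le> k"
  then have "nth_deriv us (\<lambda>x. f x + g x) x = nth_deriv us f x + nth_deriv us g x"
    using assms by (simp add: nth_deriv_add class_C_le)
  then show "\<bar>nth_deriv us (\<lambda>x. f x + g x) x\<bar> \<le> (A + B) * (\<Prod>u\<leftarrow>us. norm u / \<epsilon>)"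
    using jet_leD[OF assms(1) l] jet_leD[OF assms(2) l] by (simp add: distrib_right)
qed

lemma jet_le_cmult:
  assumes "jet_le k A \<epsilon> f x" "class_C k f"
  shows "jet_le k (\<bar>c\<bar> * A) \<epsilon> (\<lambda>x. c * f x) x"
  unfolding jet_le_def
proof (intro allI impI)
  fix us :: "'a list" assume l: "length us \<le> k"
  then have "nth_deriv us (\<lambda>x. c * f x) x = c * nth_deriv us f x"
    using assms by (simp add: nth_deriv_cmult class_C_le)
  then show "\<bar>nth_deriv us (\<lambda>x. c * f x) x\<bar> \<le> \<bar>c\<bar> * A * (\<Prod>u\<leftarrow>us. norm u / \<epsilon>)"
    using jet_leD[OF assms(1) l] by (simp add: abs_mult mult.assoc mult_left_mono)
qed

text \<open>
Leibniz' rule distributes \<open>k\<close> derivatives over two factors in \<open>2 ^ k\<close> ways.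
\<close>

lemma jet_le_mult:
  assumes "jet_le k A \<epsilon> f x" "jet_le k B \<epsilon> g x" "class_C k f" "class_C k g"
  shows "jet_le k (2 ^ k * A * B) \<epsilon> (\<lambda>x. f x * g x) x"
  using assms
proof (induction k arbitrary: A B f g)
  case 0
  then show ?case
    by (auto simp: jet_le_0 abs_mult intro!: mult_mono order_trans[OF abs_ge_zero])
next
  case (Suc k)
  have F: "\<bar>f x\<bar> \<le> A" "\<bar>g x\<bar> \<le> B" using Suc.prems by (auto simp: jet_le_Suc)
  have "A \<ge> 0" "B \<ge> 0" using F by auto
  have "jet_le k (2 ^ Suc k * A * B * (norm u / \<epsilon>)) \<epsilon> (dd u (\<lambda>x. f x * g x)) x" for u
  proof -
    have c: "class_C k f" "class_C k g" "class_C k (dd u f)" "class_C k (dd u g)"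
      using Suc.prems by (auto simp: class_C_Suc intro: class_C_SucD)
    have j: "jet_le k (A * (norm u / \<epsilon>)) \<epsilon> (dd u f) x" "jet_le k (B * (norm u / \<epsilon>)) \<epsilon> (dd u g) x"
      using Suc.prems by (auto simp: jet_le_Suc)
    have j': "jet_le k A \<epsilon> f x" "jet_le k B \<epsilon> g x"
      using Suc.prems by (auto simp: jet_le_def)
    have "jet_le k (2 ^ k * (A * (norm u / \<epsilon>)) * B + 2 ^ k * A * (B * (norm u / \<epsilon>))) \<epsilon>
       (\<lambda>x. dd u f x * g x + f x * dd u g x) x"
      by (intro jet_le_add Suc.IH class_C_mult c j j')
    moreover have "2 ^ k * (A * (norm u / \<epsilon>)) * B + 2 ^ k * A * (B * (norm u / \<epsilon>))
       = 2 ^ Suc k * A * B * (norm u / \<epsilon>)" by (simp add: algebra_simps)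
    moreover have "dd u (\<lambda>x. f x * g x) = (\<lambda>x. dd u f x * g x + f x * dd u g x)"
      using Suc.prems by (intro dd_mult) (auto simp: class_C_Suc)
    ultimately show ?thesis by (simp only:)
  qed
  moreover have "\<bar>f x * g x\<bar> \<le> 2 ^ Suc k * A * B"
  proof -
    have "\<bar>f x * g x\<bar> \<le> 1 * (A * B)" using F \<open>A \<ge> 0\<close> by (auto simp: abs_mult intro!: mult_mono)
    also have "\<dots> \<le> 2 ^ Suc k * (A * B)"
      using \<open>A \<ge> 0\<close> \<open>B \<ge> 0\<close> by (intro mult_right_mono one_le_power) auto
    finally show ?thesis by (simp add: mult.assoc)
  qed
  ultimately show ?case by (simp add: jet_le_Suc)
qed

lemma jet_le_sum:
  assumes "finite I" "\<And>i. i \<in> I \<Longrightarrow> jet_le k (A i) \<epsilon> (f i) x" "\<And>i. i \<in> I \<Longrightarrow> class_C k (f i)"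
  shows "jet_le k (\<Sum>i\<in>I. A i) \<epsilon> (\<lambda>x. \<Sum>i\<in>I. f i x) x"
  using assms
proof (induction I)
  case empty
  then show ?case by (simp add: jet_le_def nth_deriv_zero)
next
  case (insert i I)
  then show ?case by (auto intro!: jet_le_add class_C_sum)
qed

text \<open>
Continuity only bounds each derivative with fixed arguments.  The bound becomes uniform in the
arguments by expanding them in the standard basis, the innermost one first.
\<close>

lemma jet_le_exists_on_compact:
  assumes "compact K" "class_C k f"
  shows "\<exists>A. \<forall>x\<in>K. jet_le k A 1 f x"
  using assms(2)
proof (induction k arbitrary: f)
  case 0
  then have "compact (f ` K)"
    using assms(1) by (auto simp: class_C_0 intro: compact_continuous_image continuous_on_subset)
  then obtain A where "\<forall>x\<in>K. \<bar>f x\<bar> \<le> A"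
    by (auto dest!: compact_imp_bounded simp: bounded_iff)
  then show ?case by (auto simp: jet_le_0)
next
  case (Suc k)
  have "compact (f ` K)"
    using assms(1) class_C_continuous[OF Suc.prems]
    by (auto intro: compact_continuous_image continuous_on_subset)
  then obtain A0 where A0: "\<And>x. x \<in> K \<Longrightarrow> \<bar>f x\<bar> \<le> A0"
    using compact_imp_bounded[of "f ` K"] unfolding bounded_iff by auto
  have "\<forall>b. \<exists>A. \<forall>x\<in>K. jet_le k A 1 (dd b f) x"
    using Suc by (auto simp: class_C_Suc)
  then obtain A where A: "\<And>b x. x \<in> K \<Longrightarrow> jet_le k (A b) 1 (dd b f) x" by metis
  define B where "B = max A0 (\<Sum>b\<in>Basis. A b)"
  have "jet_le (Suc k) B 1 f x" if x: "x \<in> K" for x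
    unfolding jet_le_Suc
  proof (intro conjI allI)
    show "\<bar>f x\<bar> \<le> B" using A0[OF x] by (simp add: B_def)
    fix u
    have A0': "0 \<le> A b" for b using jet_leD[OF A[OF x], of "[]" b] by simp
    have c: "class_C k (\<lambda>x. (u \<bullet> b) * dd b f x)" for b
      using Suc.prems by (intro class_C_cmult) (simp add: class_C_Suc)
    have eq: "dd u f = (\<lambda>x. \<Sum>b\<in>Basis. (u \<bullet> b) * dd b f x)"
      using Suc.prems by (auto simp: class_C_Suc dd_basis)
    have "jet_le k (\<Sum>b\<in>Basis. \<bar>u \<bullet> b\<bar> * A b) 1 (dd u f) x"
      unfolding eq using Suc.prems
      by (intro jet_le_sum jet_le_cmult A x c) (auto simp: class_C_Suc)
    moreover have "(\<Sum>b\<in>Basis. \<bar>u \<bullet> b\<bar> * A b) \<le> B * (norm u / 1)"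
    proof -
      have "(\<Sum>b\<in>Basis. \<bar>u \<bullet> b\<bar> * A b) \<le> (\<Sum>b\<in>Basis. norm u * A b)"
        using A0' by (intro sum_mono mult_right_mono) (auto simp: Basis_le_norm)
      also have "\<dots> = (\<Sum>b\<in>Basis. A b) * norm u" by (simp add: sum_distrib_left mult.commute)
      also have "\<dots> \<le> B * norm u" by (intro mult_right_mono) (auto simp: B_def)
      finally show ?thesis by simp
    qed
    ultimately show "jet_le k (B * (norm u / 1)) 1 (dd u f) x"
      using jet_le_mono[of k "\<Sum>b\<in>Basis. \<bar>u \<bullet> b\<bar> * A b" 1 "dd u f" x 1 "B * (norm u / 1)" k] by linarith
  qed
  then show ?case by auto
qed

section \<open>Polynomials and Taylor's formula\<close>

text \<open>
Polynomials of degree less than \<open>n\<close>, described by the vanishing of the \<open>n\<close>-th derivative.  The bound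
is strict so that every derivative lowers it by one, down to the zero polynomial.
\<close>

primrec poly_lt :: "nat \<Rightarrow> ('a::euclidean_space \<Rightarrow> real) \<Rightarrow> bool" where
  "poly_lt 0 f \<longleftrightarrow> f = (\<lambda>x. 0)"
| "poly_lt (Suc n) f \<longleftrightarrow> (\<forall>x. f differentiable (at x)) \<and> (\<forall>u. poly_lt n (dd u f))"

lemma poly_lt_zero: "poly_lt n (\<lambda>x. 0)"
  by (induction n) (auto simp: dd_const)

lemma poly_lt_const: "poly_lt (Suc n) (\<lambda>x. c)"
  by (auto simp: dd_const poly_lt_zero)

lemma poly_lt_Suc: "poly_lt n f \<Longrightarrow> poly_lt (Suc n) f"
  by (induction n arbitrary: f) (auto simp: dd_const poly_lt_zero)

lemma poly_lt_le: "n \<le> k \<Longrightarrow> poly_lt n f \<Longrightarrow> poly_lt k f"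
  by (induction rule: dec_induct) (auto intro: poly_lt_Suc simp del: poly_lt.simps)

lemma poly_lt_class_C: "poly_lt n f \<Longrightarrow> class_C k f"
proof (induction k arbitrary: n f)
  case 0
  then have "poly_lt (Suc n) f" by (rule poly_lt_Suc)
  then show ?case
    by (auto simp: class_C_0 intro!: continuous_at_imp_continuous_on differentiable_imp_continuous_within)
next
  case (Suc k)
  have "poly_lt (Suc n) f" using Suc.prems by (rule poly_lt_Suc)
  then show ?case using Suc.IH by (auto simp: class_C_Suc)
qed

lemma poly_lt_nth_deriv: "poly_lt n f \<Longrightarrow> poly_lt (n - length us) (nth_deriv us f)"
proof (induction us)
  case (Cons u us)
  then have "poly_lt (n - length us) (nth_deriv us f)" by simp
  then show ?case
    by (cases "n - length us") (auto simp: nth_deriv_Cons dd_const diff_Suc)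
qed simp

lemma poly_lt_add: "poly_lt n f \<Longrightarrow> poly_lt n g \<Longrightarrow> poly_lt n (\<lambda>x. f x + g x)"
  by (induction n arbitrary: f g) (auto simp: dd_add)

lemma poly_lt_sum: "(\<And>i. i \<in> I \<Longrightarrow> poly_lt n (f i)) \<Longrightarrow> poly_lt n (\<lambda>x. \<Sum>i\<in>I. f i x)"
  by (induction I rule: infinite_finite_induct) (auto simp: poly_lt_zero intro!: poly_lt_add)

text \<open>
The two summands of the product rule have one factor of smaller degree; a constant factor has
derivative zero, which is where the degree bounds stop decreasing.
\<close>

lemma poly_lt_mult:
  "poly_lt (Suc a) f \<Longrightarrow> poly_lt (Suc b) g \<Longrightarrow> poly_lt (Suc (a + b)) (\<lambda>x. f x * g x)"
proof (induction "a + b" arbitrary: a b f g rule: less_induct)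
  case less
  have d: "\<And>x. f differentiable (at x)" "\<And>x. g differentiable (at x)" using less.prems by auto
  have 1: "poly_lt (a + b) (\<lambda>x. dd u f x * g x)" for u
  proof (cases a)
    case 0
    then have "dd u f = (\<lambda>x. 0)" using less.prems by simp
    then show ?thesis by (simp add: poly_lt_zero)
  next
    case (Suc a')
    then have "poly_lt (Suc a') (dd u f)" using less.prems by simp
    with less.hyps[of a' b "dd u f" g] less.prems Suc show ?thesis by simp
  qed
  have 2: "poly_lt (a + b) (\<lambda>x. f x * dd u g x)" for u
  proof (cases b)
    case 0
    then have "dd u g = (\<lambda>x. 0)" using less.prems by simp
    then show ?thesis by (simp add: poly_lt_zero)
  next
    case (Suc b')
    then have "poly_lt (Suc b') (dd u g)" using less.prems by simp
    with less.hyps[of a b' f "dd u g"] less.prems Suc show ?thesis by simp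
  qed
  show ?case
    using d poly_lt_add[OF 1 2] by (auto simp: dd_mult)
qed

lemma poly_lt_cmult: "poly_lt n f \<Longrightarrow> poly_lt n (\<lambda>x. c * f x)"
  by (induction n arbitrary: f) (auto simp: dd_mult dd_const)

lemma poly_lt_inner: "poly_lt (Suc 1) (\<lambda>x. a \<bullet> x)"
proof -
  have d: "((\<lambda>x. a \<bullet> x) has_derivative (\<lambda>x. a \<bullet> x)) (at x)" for x
    by (auto intro!: derivative_eq_intros)
  then have "dd u (\<lambda>x. a \<bullet> x) = (\<lambda>x. a \<bullet> u)" for u
    using dd_eq by blast
  with d show ?thesis
    by (auto simp: dd_const differentiable_def)
qed

lemma poly_lt_power: "poly_lt (Suc a) f \<Longrightarrow> poly_lt (Suc (k * a)) (\<lambda>x. f x ^ k)"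
proof (induction k)
  case 0 show ?case using poly_lt_const[of 0 1] by (simp del: poly_lt.simps)
next
  case (Suc k)
  then have "poly_lt (Suc (a + k * a)) (\<lambda>x. f x * f x ^ k)"
    by (intro poly_lt_mult) (auto simp del: poly_lt.simps)
  then show ?case by (simp del: poly_lt.simps)
qed

lemma poly_lt_prod:
  "finite I \<Longrightarrow> (\<And>i. i \<in> I \<Longrightarrow> poly_lt (Suc (a i)) (f i)) \<Longrightarrow>
   poly_lt (Suc (\<Sum>i\<in>I. a i)) (\<lambda>x. \<Prod>i\<in>I. f i x)"
proof (induction I rule: finite_induct)
  case empty show ?case using poly_lt_const[of 0 1] by (simp del: poly_lt.simps)
next
  case (insert i I)
  then have "poly_lt (Suc (a i + (\<Sum>i\<in>I. a i))) (\<lambda>x. f i x * (\<Prod>i\<in>I. f i x))"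
    by (intro poly_lt_mult) (auto simp del: poly_lt.simps)
  with insert show ?case by (simp del: poly_lt.simps)
qed

lemma poly_lt_polynomial_deg_le:
  fixes P :: "real ^ 'b::finite \<Rightarrow> real"
  assumes "polynomial_deg_le m P" shows "poly_lt (Suc m) P"
proof -
  obtain c :: "('b \<Rightarrow> nat) \<Rightarrow> real" where c: "\<And>x. P x = (\<Sum>\<alpha> | (\<Sum>i\<in>UNIV. \<alpha> i) \<le> m. c \<alpha> * (\<Prod>i\<in>UNIV. (x $ i) ^ \<alpha> i))"
    using assms unfolding polynomial_deg_le_def by blast
  have "poly_lt (Suc m) (\<lambda>x::real^'b. c \<alpha> * (\<Prod>i\<in>UNIV. (x $ i) ^ \<alpha> i))" if \<alpha>: "(\<Sum>i\<in>UNIV. \<alpha> i) \<le> m" for \<alpha>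
  proof -
    have "poly_lt (Suc (\<alpha> i * 1)) (\<lambda>x::real^'b. (x $ i) ^ \<alpha> i)" for i
      using poly_lt_power[OF poly_lt_inner[of "axis i (1::real)"], of "\<alpha> i"]
      by (simp add: inner_axis' del: poly_lt.simps)
    then have "poly_lt (Suc (\<Sum>i\<in>UNIV. \<alpha> i)) (\<lambda>x::real^'b. \<Prod>i\<in>UNIV. (x $ i) ^ \<alpha> i)"
      by (intro poly_lt_prod) (auto simp del: poly_lt.simps)
    then have "poly_lt (Suc (0 + (\<Sum>i\<in>UNIV. \<alpha> i))) (\<lambda>x::real^'b. c \<alpha> * (\<Prod>i\<in>UNIV. (x $ i) ^ \<alpha> i))"
      by (intro poly_lt_mult poly_lt_const)
    then show ?thesis using \<alpha> by (auto intro: poly_lt_le[rotated] simp del: poly_lt.simps)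
  qed
  then have "poly_lt (Suc m) (\<lambda>x. \<Sum>\<alpha> | (\<Sum>i\<in>UNIV. \<alpha> i) \<le> m. c \<alpha> * (\<Prod>i\<in>UNIV. (x $ i) ^ \<alpha> i))"
    by (intro poly_lt_sum) auto
  moreover have "P = (\<lambda>x. \<Sum>\<alpha> | (\<Sum>i\<in>UNIV. \<alpha> i) \<le> m. c \<alpha> * (\<Prod>i\<in>UNIV. (x $ i) ^ \<alpha> i))"
    using c by auto
  ultimately show ?thesis by simp
qed

lemma poly_lt_nth_deriv_0:
  assumes "poly_lt n f" "n \<le> length us" shows "nth_deriv us f = (\<lambda>x. 0)"
  using poly_lt_nth_deriv[OF assms(1), of us] assms(2) by simp

lemma has_real_derivative_line:
  assumes "nth_deriv us f differentiable (at (z + t *\<^sub>R w))"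
  shows "((\<lambda>t. nth_deriv us f (z + t *\<^sub>R w)) has_real_derivative nth_deriv (w # us) f (z + t *\<^sub>R w)) (at t)"
proof -
  have l: "((\<lambda>t. z + t *\<^sub>R w) has_derivative (\<lambda>t. t *\<^sub>R w)) (at t)"
    by (auto intro!: derivative_eq_intros)
  show ?thesis
    using has_derivative_compose[OF l has_derivative_dd[OF assms]]
    by (simp add: has_field_derivative_def nth_deriv_Cons dd_scale_arg[OF assms] mult_commute_abs)
qed

text \<open>
Maclaurin's formula along the segment from \<open>z\<close> to \<open>x\<close>; the remainder is a derivative of order \<open>n\<close>.
\<close>

lemma taylor_poly_lt:
  assumes "poly_lt n f"
  shows "f x = (\<Sum>i<n. nth_deriv (replicate i (x - z)) f z / fact i)"
proof -
  define D where "D i t = nth_deriv (replicate i (x - z)) f (z + t *\<^sub>R (x - z))" for i and t :: real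
  have "DERIV (D i) t :> D (Suc i) t" for i t
  proof -
    have "class_C 1 (nth_deriv (replicate i (x - z)) f)"
      using class_C_nth_deriv[OF poly_lt_class_C[OF assms, of "i + 1"], of "replicate i (x - z)" 1] by simp
    then show ?thesis
      using has_real_derivative_line[of "replicate i (x - z)" f z t "x - z"]
      unfolding D_def by (simp add: class_C_Suc)
  qed
  then obtain t where "D 0 1 = (\<Sum>i<n. (D i 0 / fact i) * 1 ^ i) + (D n t / fact n) * 1 ^ n"
    using Maclaurin_all_le[of D "D 0" 1 n] by auto
  moreover have "D n t = 0"
    using poly_lt_nth_deriv_0[OF assms, of "replicate n (x - z)"] by (simp add: D_def)
  ultimately show ?thesis by (simp add: D_def)
qed

text \<open>
In units of \<open>a\<close> the displacement \<open>x - z\<close> has length at most \<open>1\<close>, so each of the at most \<open>m + 1\<close>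
Taylor terms of a derivative of \<open>Q\<close> at \<open>z\<close> is bounded by \<open>A\<close>.
\<close>

lemma jet_le_poly_move:
  assumes Q: "poly_lt (Suc m) Q" and J: "jet_le m A a Q z" and x: "norm (x - z) \<le> a" and a: "0 < a"
  shows "jet_le m (real (Suc m) * A) a Q x"
  unfolding jet_le_def
proof (intro allI impI)
  fix us :: "'a list" assume us: "length us \<le> m"
  define R where "R = (\<Prod>u\<leftarrow>us. norm u / a)"
  have R: "0 \<le> R" unfolding R_def using a by (intro prod_list_norm_nonneg) auto
  have A: "0 \<le> A" using jet_leD[OF J, of "[]"] by simp
  have "poly_lt (Suc m - length us) (nth_deriv us Q)" by (rule poly_lt_nth_deriv[OF Q])
  from taylor_poly_lt[OF this, of x z]
  have "\<bar>nth_deriv us Q x\<bar> = \<bar>\<Sum>i<Suc m - length us. nth_deriv (replicate i (x - z) @ us) Q z / fact i\<bar>"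
    by (simp add: nth_deriv_append)
  also have "\<dots> \<le> (\<Sum>i<Suc m - length us. A * R)"
  proof (rule order_trans[OF sum_abs sum_mono])
    fix i assume i: "i \<in> {..<Suc m - length us}"
    have "\<bar>nth_deriv (replicate i (x - z) @ us) Q z\<bar> \<le> A * ((norm (x - z) / a) ^ i * R)"
      using jet_leD[OF J, of "replicate i (x - z) @ us"] i us by (simp add: R_def)
    also have "(norm (x - z) / a) ^ i * R \<le> 1 * R"
      using x a R by (intro mult_right_mono power_le_one) auto
    finally have "\<bar>nth_deriv (replicate i (x - z) @ us) Q z\<bar> \<le> A * R"
      using A by (simp add: mult_left_mono)
    moreover have "\<bar>nth_deriv (replicate i (x - z) @ us) Q z\<bar> / fact i
        \<le> \<bar>nth_deriv (replicate i (x - z) @ us) Q z\<bar> / 1"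
      by (intro divide_left_mono) auto
    ultimately show "\<bar>nth_deriv (replicate i (x - z) @ us) Q z / fact i\<bar> \<le> A * R" by simp
  qed
  also have "\<dots> = real (Suc m - length us) * (A * R)" by simp
  also have "\<dots> \<le> real (Suc m) * (A * R)" using A R by (intro mult_right_mono) auto
  finally show "\<bar>nth_deriv us Q x\<bar> \<le> real (Suc m) * A * (\<Prod>u\<leftarrow>us. norm u / a)" by (simp add: R_def mult.assoc)
qed

section \<open>Whitney's condition at a given scale\<close>

lemma norm_scaleR_sgn: "norm v *\<^sub>R sgn v = v"
  by (cases "v = 0") (auto simp: sgn_div_norm)

text \<open>
The supremum in \<open>form_norm\<close> is taken in the reals, so it bounds the form only once the set of values
is known to be bounded; homogeneity then removes the restriction to unit vectors.
\<close>

lemma form_norm_bound: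
  assumes g: "class_C (length us) g"
  shows "\<bar>nth_deriv us g z\<bar> \<le> form_norm (length us) (\<lambda>us. nth_deriv us g z) * (\<Prod>u\<leftarrow>us. norm u)"
    and "0 \<le> form_norm (length us) (\<lambda>us. nth_deriv us g z)"
proof -
  let ?j = "length us"
  let ?S = "{\<bar>nth_deriv us g z\<bar> | us. length us = ?j \<and> (\<forall>u\<in>set us. norm u = 1)}"
  obtain A where "jet_le ?j A 1 g z"
    using jet_le_exists_on_compact[of "{z}" ?j g] g by auto
  have "\<bar>nth_deriv vs g z\<bar> \<le> A" if "length vs = ?j" "\<forall>u\<in>set vs. norm u = 1" for vs
  proof -
    have "(\<Prod>u\<leftarrow>vs. norm u) = 1" using that(2) by (induction vs) auto
    then show ?thesis using jet_leD[OF \<open>jet_le ?j A 1 g z\<close>, of vs] that by simp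
  qed
  then have bdd: "bdd_above ?S" by (auto simp: bdd_above_def)
  have le: "\<bar>nth_deriv vs g z\<bar> \<le> form_norm ?j (\<lambda>us. nth_deriv us g z)"
    if "length vs = ?j" "\<forall>u\<in>set vs. norm u = 1" for vs
    unfolding form_norm_def using that by (intro cSup_upper[OF _ bdd]) auto
  obtain b :: 'a where "b \<in> Basis" using nonempty_Basis by blast
  then show nn: "0 \<le> form_norm ?j (\<lambda>us. nth_deriv us g z)"
    using le[of "replicate ?j b"] by fastforce
  have eq: "nth_deriv us g z = (\<Prod>u\<leftarrow>us. norm u) * nth_deriv (map sgn us) g z"
    using nth_deriv_scale_args[OF g, of norm sgn] by (simp add: norm_scaleR_sgn)
  show "\<bar>nth_deriv us g z\<bar> \<le> form_norm ?j (\<lambda>us. nth_deriv us g z) * (\<Prod>u\<leftarrow>us. norm u)"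
  proof (cases "0 \<in> set us")
    case True
    then have "(\<Prod>u\<leftarrow>us. norm u) = 0" by (induction us) auto
    then show ?thesis using eq by simp
  next
    case False
    then have "\<forall>u\<in>set (map sgn us). norm u = 1" by (auto simp: norm_sgn)
    then have "\<bar>nth_deriv (map sgn us) g z\<bar> \<le> form_norm ?j (\<lambda>us. nth_deriv us g z)"
      by (intro le) auto
    moreover have "0 \<le> (\<Prod>u\<leftarrow>us. norm u)" using prod_list_norm_nonneg[of 1 us] by simp
    ultimately show ?thesis unfolding eq
      by (simp add: abs_mult mult.commute mult_left_mono)
  qed
qed

text \<open>
In units of any length \<open>a \<ge> norm (y - z)\<close>, all the quotients in Whitney's condition turn into a single
jet bound \<open>e * a ^ m\<close> for \<open>P y - P z\<close>.
\<close>

lemma cond_W_jet: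
  fixes P :: "'a::euclidean_space \<Rightarrow> 'a \<Rightarrow> real"
  assumes W: "cond_W m P C" and K: "compact K" "K \<subseteq> C"
    and P: "\<And>y. y \<in> C \<Longrightarrow> poly_lt (Suc m) (P y)" and e: "e > 0"
  shows "\<exists>\<delta>>0. \<forall>y\<in>K. \<forall>z\<in>K. \<forall>a. 0 < a \<and> a \<le> \<delta> \<and> norm (y - z) \<le> a \<longrightarrow>
           jet_le m (e * a ^ m) a (\<lambda>x. P y x - P z x) z"
proof -
  have "(whitney_rho m P K \<longlongrightarrow> 0) (at_right 0)"
    using W K unfolding cond_W_def by auto
  then have "eventually (\<lambda>\<delta>. whitney_rho m P K \<delta> < ennreal e) (at_right 0)"
    using e by (auto intro: order_tendstoD simp: order_tendsto_iff)
  then obtain b where b: "b > 0" "\<And>\<delta>. 0 < \<delta> \<Longrightarrow> \<delta> < b \<Longrightarrow> whitney_rho m P K \<delta> < ennreal e"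
    by (auto simp: eventually_at_right_field)
  define \<delta> where "\<delta> = b / 2"
  have \<delta>: "\<delta> > 0" "whitney_rho m P K \<delta> < ennreal e" using b by (auto simp: \<delta>_def)
  show ?thesis
  proof (intro exI[of _ \<delta>] conjI ballI allI impI, fact)
    fix y z a assume y: "y \<in> K" and z: "z \<in> K" and a: "0 < a \<and> a \<le> \<delta> \<and> norm (y - z) \<le> a"
    have c: "class_C k (P y)" "class_C k (P z)" for k
      using P K y z poly_lt_class_C by blast+
    show "jet_le m (e * a ^ m) a (\<lambda>x. P y x - P z x) z"
      unfolding jet_le_def
    proof (intro allI impI)
      fix us :: "'a list" assume us: "length us \<le> m"
      define R where "R = (\<Prod>u\<leftarrow>us. norm u)"
      have R: "0 \<le> R" unfolding R_def using prod_list_norm_nonneg[of 1 us] by simp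
      define N where "N = form_norm (length us) (\<lambda>us. nth_deriv us (\<lambda>x. P y x - P z x) z)"
      have N: "\<bar>nth_deriv us (\<lambda>x. P y x - P z x) z\<bar> \<le> N * R" "0 \<le> N"
        using form_norm_bound[OF class_C_diff[OF c], of us z] by (auto simp: N_def R_def)
      have "\<bar>nth_deriv us (\<lambda>x. P y x - P z x) z\<bar> \<le> e * a ^ (m - length us) * R"
      proof (cases "y = z")
        case True
        then show ?thesis using R e a by (simp add: nth_deriv_zero)
      next
        case False
        then have yz: "0 < norm (y - z)" by simp
        have eqN: "N = form_norm (length us) (\<lambda>us. nth_deriv us (P y) z - nth_deriv us (P z) z)"
          unfolding N_def using nth_deriv_diff[OF c] by simp
        have "ennreal (N / norm (y - z) ^ (m - length us)) \<le> whitney_rho m P K \<delta>"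
          unfolding whitney_rho_def
          using us y z yz a eqN
          by (intro Sup_upper CollectI exI[of _ "length us"] exI[of _ y] exI[of _ z]) auto
        also have "\<dots> < ennreal e" by fact
        finally have "N / norm (y - z) ^ (m - length us) < e"
          using e by (simp add: ennreal_less_iff N)
        then have "N < e * norm (y - z) ^ (m - length us)"
          using yz by (simp add: divide_simps)
        also have "\<dots> \<le> e * a ^ (m - length us)"
          using e a by (intro mult_left_mono power_mono) auto
        finally have "N * R \<le> e * a ^ (m - length us) * R" using R by (intro mult_right_mono) auto
        with N show ?thesis by linarith
      qed
      also have "\<dots> = e * a ^ m * (\<Prod>u\<leftarrow>us. norm u / a)"
      proof -
        have "(\<Prod>u\<leftarrow>us. norm u / a) = R / a ^ length us"
          unfolding R_def by (induction us) auto
        then show ?thesis using a us by (simp add: power_diff)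
      qed
      finally show "\<bar>nth_deriv us (\<lambda>x. P y x - P z x) z\<bar> \<le> e * a ^ m * (\<Prod>u\<leftarrow>us. norm u / a)" .
    qed
  qed
qed

section \<open>Second derivatives and convexity\<close>

text \<open>
The sum in condition \<open>(CW)\<close> is the Taylor expansion of \<open>D\<^sup>2p(v\<^sup>2)\<close> from \<open>y\<close> in direction \<open>w\<close>; so the
condition is a lower bound for second derivatives at points off \<open>C\<close>.
\<close>

lemma nth_deriv_second_poly:
  assumes P: "poly_lt (Suc m) p" and m: "m \<ge> 2"
  shows "nth_deriv [v, v] p (y + t *\<^sub>R w) =
    (\<Sum>j=2..m. t ^ (j - 2) / fact (j - 2) * nth_deriv (replicate (j - 2) w @ [v, v]) p y)"
proof -
  let ?g = "nth_deriv [v, v] p"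
  have g: "poly_lt (m - 1) ?g" using poly_lt_nth_deriv[OF P, of "[v, v]"] m by simp
  have "?g (y + t *\<^sub>R w) = (\<Sum>i<m - 1. nth_deriv (replicate i (t *\<^sub>R w)) ?g y / fact i)"
    using taylor_poly_lt[OF g, of "y + t *\<^sub>R w" y] by simp
  also have "\<dots> = (\<Sum>i<m - 1. t ^ i / fact i * nth_deriv (replicate i w @ [v, v]) p y)"
  proof (rule sum.cong[OF refl])
    fix i
    have "nth_deriv (replicate i (t *\<^sub>R w)) ?g y = t ^ i * nth_deriv (replicate i w) ?g y"
      using nth_deriv_scale_args[of "replicate i w" ?g "\<lambda>_. t" "\<lambda>u. u"] poly_lt_class_C[OF g]
      by (simp add: prod_list_replicate map_replicate_const)
    then show "nth_deriv (replicate i (t *\<^sub>R w)) ?g y / fact i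
       = t ^ i / fact i * nth_deriv (replicate i w @ [v, v]) p y"
      by (simp add: nth_deriv_append)
  qed
  also have "\<dots> = (\<Sum>j=2..m. t ^ (j - 2) / fact (j - 2) * nth_deriv (replicate (j - 2) w @ [v, v]) p y)"
    using m by (intro sum.reindex_bij_witness[of _ "\<lambda>j. j - 2" "\<lambda>i. i + 2"]) auto
  finally show ?thesis .
qed

lemma nth_deriv_second_scale:
  assumes "class_C 2 f" shows "nth_deriv [c *\<^sub>R v, c *\<^sub>R v] f x = c\<^sup>2 * nth_deriv [v, v] f x"
  using nth_deriv_scale_args[of "[v, v]" f "\<lambda>_. c" "\<lambda>u. u"] assms
  by (simp add: power2_eq_square numeral_2_eq_2)

lemma nth_deriv_second_bound:
  assumes f: "class_C 2 f" and M: "\<And>v. norm v = 1 \<Longrightarrow> nth_deriv [v, v] f x \<ge> M"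
  shows "nth_deriv [v, v] f x \<ge> M * (norm v)\<^sup>2"
proof -
  have "nth_deriv [v, v] f x = (norm v)\<^sup>2 * nth_deriv [sgn v, sgn v] f x"
    using nth_deriv_second_scale[OF f, of "norm v" "sgn v" x] by (simp add: norm_scaleR_sgn)
  then show ?thesis
    using mult_left_mono[OF M[of "sgn v"], of "(norm v)\<^sup>2"]
    by (cases "v = 0") (auto simp: norm_sgn mult.commute)
qed

lemma line_second_derivative:
  assumes f: "class_C 2 f"
  shows "((\<lambda>t. f (x + t *\<^sub>R h)) has_real_derivative dd h f (x + t *\<^sub>R h)) (at t)"
    and "((\<lambda>t. dd h f (x + t *\<^sub>R h)) has_real_derivative nth_deriv [h, h] f (x + t *\<^sub>R h)) (at t)"
  using has_real_derivative_line[of "[]" f x t h] has_real_derivative_line[of "[h]" f x t h] f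
  by (auto simp: numeral_2_eq_2 class_C_Suc nth_deriv_Cons)

lemma convex_on_UNIV_second_deriv:
  assumes f: "class_C 2 f" and nn: "\<And>x v. norm v = 1 \<Longrightarrow> nth_deriv [v, v] f x \<ge> 0"
  shows "convex_on UNIV f"
proof (intro convex_onI)
  fix t :: real and x y :: 'a assume t: "0 < t" "t < 1"
  have "nth_deriv [v, v] f x \<ge> 0" for x v
    using nth_deriv_second_bound[OF f, of 0 x v] nn by auto
  then have "convex_on UNIV (\<lambda>t. f (x + t *\<^sub>R (y - x)))"
    using line_second_derivative[OF f]
    by (intro f''_ge0_imp_convex[where f' = "\<lambda>t. dd (y - x) f (x + t *\<^sub>R (y - x))" and
          f'' = "\<lambda>t. nth_deriv [y - x, y - x] f (x + t *\<^sub>R (y - x))"]) auto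
  from convex_onD[OF this, of t 0 1] t
  have "f (x + t *\<^sub>R (y - x)) \<le> (1 - t) * f x + t * f y" by simp
  moreover have "(1 - t) *\<^sub>R x + t *\<^sub>R y = x + t *\<^sub>R (y - x)" by (simp add: algebra_simps)
  ultimately show "f ((1 - t) *\<^sub>R x + t *\<^sub>R y) \<le> (1 - t) * f x + t * f y" by simp
qed simp

lemma strongly_convex_lower_bound:
  assumes f: "class_C 2 f" and M: "\<And>x v. norm v = 1 \<Longrightarrow> nth_deriv [v, v] f x \<ge> M"
  shows "f (x + h) \<ge> f x + dd h f x + M / 2 * (norm h)\<^sup>2"
proof -
  define D where "D i t = (if i = 0 then f (x + t *\<^sub>R h) else if i = 1 then dd h f (x + t *\<^sub>R h)
     else nth_deriv [h, h] f (x + t *\<^sub>R h))" for i :: nat and t :: real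
  have "DERIV (D i) t :> D (Suc i) t" if "i < 2" for i t
  proof -
    from that have "i = 0 \<or> i = 1" by auto
    then show ?thesis
      using line_second_derivative[OF f] by (auto simp: D_def[abs_def])
  qed
  then obtain t where "D 0 1 = (\<Sum>i<2. D i 0 / fact i * 1 ^ i) + D 2 t / fact 2 * 1 ^ 2"
    using Maclaurin[of 1 2 D "D 0"] by auto
  then have "f (x + h) = f x + dd h f x + nth_deriv [h, h] f (x + t *\<^sub>R h) / 2"
    by (simp add: D_def numeral_2_eq_2)
  then show ?thesis using nth_deriv_second_bound[OF f M, of h "x + t *\<^sub>R h"] by simp
qed

section \<open>Flat functions of one variable\<close>

definition flat_modulus :: "(real \<Rightarrow> real) \<Rightarrow> bool" where
  "flat_modulus \<omega> \<longleftrightarrow> continuous_on UNIV \<omega> \<and> mono \<omega> \<and> (\<forall>s\<le>0. \<omega> s = 0)"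

lemma flat_modulus_nonneg: "flat_modulus \<omega> \<Longrightarrow> 0 \<le> \<omega> s"
  unfolding flat_modulus_def mono_def by (metis linorder_linear order_refl)

lemma flat_modulus_antiderivative:
  assumes \<omega>: "flat_modulus \<omega>"
  obtains h where "\<And>s. (h has_real_derivative \<omega> s) (at s)" "flat_modulus h"
proof -
  obtain H where H: "\<And>s. (H has_vector_derivative \<omega> s) (at s)"
    using einterval_antiderivative[of "-\<infinity>" "\<infinity>" \<omega>] \<omega>
    by (auto simp: flat_modulus_def continuous_on_eq_continuous_at)
  define h where "h s = H s - H 0" for s
  have h: "(h has_real_derivative \<omega> s) (at s)" for s
    using H[of s] unfolding h_def[abs_def] has_real_derivative_iff_has_vector_derivative
    by (auto intro!: derivative_eq_intros)
  have nn: "mono h"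
    using DERIV_nonneg_imp_nondecreasing[of _ _ h] h flat_modulus_nonneg[OF \<omega>]
    by (intro monoI) blast
  have z: "h s = 0" if "s \<le> 0" for s
  proof (cases "s < 0")
    case True
    obtain z where "s < z" "z < 0" "h 0 - h s = (0 - s) * \<omega> z"
      using MVT2[OF True, of h \<omega>] h by auto
    then show ?thesis using \<omega> by (simp add: flat_modulus_def h_def)
  qed (use that in \<open>simp add: h_def\<close>)
  have "continuous_on UNIV h"
    using h by (intro continuous_at_imp_continuous_on ballI DERIV_isCont) auto
  with nn z have "flat_modulus h" by (simp add: flat_modulus_def)
  with h that show ?thesis by blast
qed

lemma has_derivative_real_dd:
  assumes "\<And>s. (h has_real_derivative g s) (at s)"
  shows "h differentiable (at s)" "dd u h = (\<lambda>s. u * g s)"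
proof -
  have d: "(h has_derivative (\<lambda>u. u * g s)) (at s)" for s
    using assms[of s] by (simp add: has_field_derivative_def mult_commute_abs)
  then show "h differentiable (at s)" by (auto simp: differentiable_def)
  show "dd u h = (\<lambda>s. u * g s)" by (rule ext) (rule dd_eq[OF d])
qed

text \<open>
Integrating \<open>k\<close> times a function that dominates \<open>\<omega>\<close>.  Since \<open>H(s) \<ge> H(s) - H(s/2) \<ge> (s/2) h(s/2)\<close>
for an antiderivative \<open>H\<close> of an increasing \<open>h\<close>, each integration gains a factor \<open>s\<close> at the price of
evaluating the lower bound at \<open>s/2\<close> and of a power of \<open>2\<close>.  This loss is compensated in advance by
applying the induction hypothesis to \<open>\<lambda>s. 2 ^ Suc k * \<omega> (2 * s)\<close>.
\<close>

lemma flat_function_above_modulus: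
  assumes "flat_modulus \<omega>"
  shows "\<exists>h. class_C k h \<and> (\<forall>i\<le>k. flat_modulus (nth_deriv (replicate i 1) h) \<and>
           (\<forall>s>0. s ^ (k - i) * \<omega> s \<le> nth_deriv (replicate i 1) h s))"
  using assms
proof (induction k arbitrary: \<omega>)
  case 0
  then show ?case by (intro exI[of _ \<omega>]) (auto simp: class_C_0 flat_modulus_def)
next
  case (Suc k)
  define \<omega>' where "\<omega>' s = 2 ^ Suc k * \<omega> (2 * s)" for s
  have \<omega>': "flat_modulus \<omega>'"
    using Suc.prems unfolding flat_modulus_def \<omega>'_def[abs_def]
    by (auto simp: mono_def intro!: continuous_intros intro: continuous_on_compose2)
  obtain h where h: "class_C k h" "\<And>i. i \<le> k \<Longrightarrow> flat_modulus (nth_deriv (replicate i 1) h)"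
    and lb: "\<And>i s. i \<le> k \<Longrightarrow> s > 0 \<Longrightarrow> s ^ (k - i) * \<omega>' s \<le> nth_deriv (replicate i 1) h s"
    using Suc.IH[OF \<omega>'] by blast
  have hf: "flat_modulus h" using h(2)[of 0] by simp
  obtain H where H: "\<And>s. (H has_real_derivative h s) (at s)" "flat_modulus H"
    using flat_modulus_antiderivative[OF hf] by blast
  have dH: "dd 1 H = h" using has_derivative_real_dd(2)[OF H(1), of 1] by simp
  have n: "nth_deriv (replicate (Suc i) 1) H = nth_deriv (replicate i 1) h" for i
    using nth_deriv_snoc[of "replicate i 1" 1 H] by (simp add: dH replicate_append_same)
  have "class_C (Suc k) H"
    using has_derivative_real_dd[OF H(1)] h(1) by (auto simp: class_C_Suc intro!: class_C_cmult)
  moreover have "flat_modulus (nth_deriv (replicate i 1) H)" if "i \<le> Suc k" for i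
    using that h(2) H(2) n by (cases i) auto
  moreover have "s ^ (Suc k - i) * \<omega> s \<le> nth_deriv (replicate i 1) H s" if i: "i \<le> Suc k" and s: "s > 0" for i s
  proof (cases i)
    case 0
    obtain z where z: "s / 2 < z" "z < s" "H s - H (s / 2) = (s - s / 2) * h z"
      using MVT2[of "s / 2" s H h] H(1) s by auto
    have "(s / 2) ^ k * \<omega>' (s / 2) \<le> h (s / 2)" using lb[of 0 "s / 2"] s by simp
    also have "\<dots> \<le> h z" using z hf by (auto simp: flat_modulus_def mono_def)
    finally have "(s / 2) * ((s / 2) ^ k * \<omega>' (s / 2)) \<le> (s / 2) * h z"
      using s by (intro mult_left_mono) auto
    also have "\<dots> = H s - H (s / 2)" using z by (simp add: field_simps)
    also have "\<dots> \<le> H s" using flat_modulus_nonneg[OF H(2)] by simp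
    finally have "(s / 2) ^ Suc k * 2 ^ Suc k * \<omega> s \<le> H s" by (simp add: \<omega>'_def mult_ac)
    then show ?thesis using 0 by (simp add: power_divide)
  next
    case (Suc j)
    have "1 * \<omega> s \<le> 2 ^ Suc k * \<omega> (2 * s)"
      using s Suc.prems flat_modulus_nonneg[OF Suc.prems]
      by (intro mult_mono one_le_power) (auto simp: flat_modulus_def mono_def)
    then have "s ^ (k - j) * \<omega> s \<le> s ^ (k - j) * \<omega>' s"
      using s by (intro mult_left_mono) (auto simp: \<omega>'_def)
    also have "\<dots> \<le> nth_deriv (replicate j 1) h s" using lb[of j s] i s Suc by simp
    finally show ?thesis using Suc n by simp
  qed
  ultimately show ?case by blast
qed

text \<open>
Choose \<open>\<delta>\<^sub>k\<close> such that the values at arguments up to \<open>\<delta>\<^sub>k\<close> are at most \<open>B 2\<^sup>-\<^sup>k\<close>.  The sum over \<open>k\<close> of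
\<open>2 B 2\<^sup>-\<^sup>k\<close> times the ramp rising from \<open>0\<close> at \<open>0\<close> to \<open>1\<close> at \<open>\<delta>\<^sub>k\<close> converges uniformly; if \<open>k\<close> is the
first index with \<open>\<delta>\<^sub>k < t\<close>, its \<open>k\<close>-th term alone is large enough at \<open>t\<close>.
\<close>

lemma flat_modulus_majorant:
  fixes Q :: "(real \<times> real) set"
  assumes pos: "\<And>t a. (t, a) \<in> Q \<Longrightarrow> 0 < t" and B: "\<And>t a. (t, a) \<in> Q \<Longrightarrow> a \<le> B"
    and lim: "\<And>e. e > 0 \<Longrightarrow> \<exists>\<delta>>0. \<forall>(t, a)\<in>Q. t \<le> \<delta> \<longrightarrow> a \<le> e"
  shows "\<exists>\<omega>. flat_modulus \<omega> \<and> (\<forall>(t, a)\<in>Q. a \<le> \<omega> t)"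
proof -
  define B' where "B' = max B 1"
  have B': "B' > 0" "\<And>t a. (t, a) \<in> Q \<Longrightarrow> a \<le> B'" using B by (auto simp: B'_def le_max_iff_disj)
  have "\<forall>k. \<exists>\<delta>>0. \<forall>(t, a)\<in>Q. t \<le> \<delta> \<longrightarrow> a \<le> B' / 2 ^ k"
    using B' by (intro allI lim) auto
  then obtain \<delta> where \<delta>: "\<And>k. \<delta> k > 0" "\<And>k t a. (t, a) \<in> Q \<Longrightarrow> t \<le> \<delta> k \<Longrightarrow> a \<le> B' / 2 ^ k"
    by (metis (no_types, lifting) case_prod_conv)
  define c where "c k s = 2 * B' * (1 / 2) ^ k * min 1 (max 0 (s / \<delta> k))" for k :: nat and s
  have c0: "0 \<le> c k s" for k s using B' by (auto simp: c_def)
  have c1: "norm (c k s) \<le> 2 * B' * (1 / 2) ^ k" for k s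
  proof -
    have "c k s \<le> 2 * B' * (1 / 2) ^ k * 1" unfolding c_def using B' by (intro mult_left_mono) auto
    then show ?thesis using c0[of k s] by simp
  qed
  have summ: "summable (\<lambda>k. 2 * B' * (1 / 2 :: real) ^ k)" by (intro summable_mult summable_geometric) auto
  have sc: "summable (\<lambda>k. c k s)" for s
    by (rule summable_comparison_test'[OF summ, of 0]) (use c1 in auto)
  define \<omega> where "\<omega> s = (\<Sum>k. c k s)" for s
  have "continuous_on UNIV \<omega>"
  proof (rule uniform_limit_theorem)
    show "uniform_limit UNIV (\<lambda>n s. \<Sum>k<n. c k s) \<omega> sequentially"
      unfolding \<omega>_def[abs_def] using c1 summ by (intro Weierstrass_m_test) auto
    have "continuous_on UNIV (c k)" for k
      unfolding c_def[abs_def] using \<delta>(1)[of k] by (intro continuous_intros) auto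
    then show "\<forall>\<^sub>F n in sequentially. continuous_on UNIV (\<lambda>s. \<Sum>k<n. c k s)"
      by (intro always_eventually allI continuous_on_sum) auto
  qed simp
  moreover have "mono \<omega>"
  proof (rule monoI)
    fix s t :: real assume "s \<le> t"
    then have "s / \<delta> k \<le> t / \<delta> k" for k using \<delta>(1)[of k] by (intro divide_right_mono) auto
    then have "c k s \<le> c k t" for k
      unfolding c_def using B' by (intro mult_left_mono min.mono max.mono) auto
    then show "\<omega> s \<le> \<omega> t" unfolding \<omega>_def by (intro suminf_le sc)
  qed
  moreover have "\<omega> s = 0" if "s \<le> 0" for s
  proof -
    have "s / \<delta> k \<le> 0" for k using \<delta>(1)[of k] that by (simp add: divide_le_0_iff)
    then have "c k s = 0" for k by (simp add: c_def max_absorb1)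
    then show ?thesis by (simp add: \<omega>_def)
  qed
  moreover have "a \<le> \<omega> t" if Q: "(t, a) \<in> Q" for t a
  proof (cases "a \<le> 0")
    case True
    then show ?thesis using suminf_nonneg[OF sc c0, of t] by (simp add: \<omega>_def)
  next
    case False
    have "\<exists>k. \<delta> k < t"
    proof (rule ccontr)
      assume "\<not> ?thesis"
      then have le: "a \<le> B' * (1 / 2) ^ k" for k
        using \<delta>(2)[OF Q, of k] by (simp add: not_less power_divide)
      have "(\<lambda>k. B' * (1 / 2 :: real) ^ k) \<longlonglongrightarrow> B' * 0"
        by (intro tendsto_intros LIMSEQ_power_zero) auto
      from LIMSEQ_le_const[OF this, of a] le have "a \<le> 0" by simp
      with False show False by simp
    qed
    define k where "k = (LEAST k. \<delta> k < t)"
    have k: "\<delta> k < t" "\<And>j. j < k \<Longrightarrow> t \<le> \<delta> j"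
      using LeastI_ex[OF \<open>\<exists>k. \<delta> k < t\<close>] not_less_Least[of _ "\<lambda>k. \<delta> k < t"]
      unfolding k_def by (blast intro: leI)+
    have "a \<le> 2 * B' * (1 / 2) ^ k"
    proof (cases k)
      case 0
      then show ?thesis using B'(2)[OF Q] B'(1) by simp
    next
      case (Suc j)
      then show ?thesis using \<delta>(2)[OF Q k(2)[of j]] by (simp add: power_divide)
    qed
    also have "\<dots> = c k t" using k \<delta>(1)[of k] by (simp add: c_def)
    also have "\<dots> \<le> \<omega> t"
      unfolding \<omega>_def using sum_le_suminf[OF sc, of "{k}" t] c0 by simp
    finally show ?thesis .
  qed
  ultimately show ?thesis unfolding flat_modulus_def by blast
qed

text \<open>
The normalised antiderivative of the bump \<open>h(t) h(1 - t)\<close>, with \<open>h\<close> flat to the left of \<open>0\<close>.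
\<close>

lemma smooth_step:
  "\<exists>S :: real \<Rightarrow> real. class_C p S \<and> (\<forall>t\<le>0. S t = 0) \<and> (\<forall>t\<ge>1. S t = (1::real))"
proof -
  have "flat_modulus (max 0)"
    by (auto simp: flat_modulus_def mono_def max_def intro!: continuous_intros
        intro: continuous_on_max[where f = "\<lambda>_. 0" and g = "\<lambda>x. x", unfolded max_def])
  then obtain h where h: "class_C p h" "\<And>i. i \<le> p \<Longrightarrow> flat_modulus (nth_deriv (replicate i 1) h)"
    "\<And>i s. i \<le> p \<Longrightarrow> s > 0 \<Longrightarrow> s ^ (p - i) * max 0 s \<le> nth_deriv (replicate i 1) h s"
    using flat_function_above_modulus[of "max 0" p] by blast
  have hf: "flat_modulus h" using h(2)[of 0] by simp
  have hpos: "h s > 0" if "s > 0" for s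
  proof -
    have "0 < s ^ p * max 0 s" using that by simp
    also have "\<dots> \<le> h s" using h(3)[of 0 s] that by simp
    finally show ?thesis .
  qed
  define \<beta> where "\<beta> t = h t * h (1 - t)" for t
  have c\<beta>: "class_C p \<beta>"
  proof -
    have "class_C p (\<lambda>t::real. h (1 - 1 \<bullet> t))"
      by (intro class_C_compose[OF h(1)] class_C_diff class_C_const class_C_inner)
    then show ?thesis unfolding \<beta>_def[abs_def] by (intro class_C_mult h(1)) (simp add: inner_real_def)
  qed
  have \<beta>0: "\<beta> t \<ge> 0" for t using flat_modulus_nonneg[OF hf] by (simp add: \<beta>_def)
  have \<beta>z: "\<beta> t = 0" if "t \<le> 0 \<or> 1 \<le> t" for t using hf that by (auto simp: \<beta>_def flat_modulus_def)
  have \<beta>p: "\<beta> t > 0" if "0 < t" "t < 1" for t using hpos that by (simp add: \<beta>_def)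
  obtain H where H: "\<And>s. (H has_vector_derivative \<beta> s) (at s)"
    using einterval_antiderivative[of "-\<infinity>" "\<infinity>" \<beta>] class_C_continuous[OF c\<beta>]
    by (auto simp: continuous_on_eq_continuous_at)
  then have HD: "(H has_real_derivative \<beta> s) (at s)" for s
    by (simp add: has_real_derivative_iff_has_vector_derivative)
  have const: "H s = H t" if "s \<le> t" "t \<le> 0 \<or> 1 \<le> s" for s t
  proof (cases "s = t")
    case False
    then have "s < t" using that by simp
    then obtain z where "s < z" "z < t" "H t - H s = (t - s) * \<beta> z"
      using MVT2[of s t H \<beta>] HD by auto
    then show ?thesis using \<beta>z[of z] that by auto
  qed simp
  obtain z where "0 < z" "z < 1" "H 1 - H 0 = (1 - 0) * \<beta> z"
    using MVT2[of 0 1 H \<beta>] HD by auto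
  then have H1: "H 1 - H 0 > 0" using \<beta>p by simp
  define S where "S t = (1 / (H 1 - H 0)) * (H t - H 0)" for t
  have "class_C (Suc p) H"
    using has_derivative_real_dd[OF HD] c\<beta> by (auto simp: class_C_Suc intro!: class_C_cmult)
  from class_C_SucD[OF this] have "class_C p S"
    unfolding S_def[abs_def] by (intro class_C_cmult class_C_diff class_C_const)
  moreover have "S t = 0" if "t \<le> 0" for t using const[of t 0] that by (simp add: S_def)
  moreover have "S t = 1" if "1 \<le> t" for t using const[of 1 t] that H1 by (simp add: S_def)
  ultimately show ?thesis by blast
qed

section \<open>A lattice partition of unity\<close>

definition lattice_vec :: "('n::finite \<Rightarrow> int) \<Rightarrow> real ^ 'n" where
  "lattice_vec j = (\<chi> i. of_int (j i))"

definition nearby :: "real ^ 'n::finite \<Rightarrow> ('n \<Rightarrow> int) set" where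
  "nearby x = PiE UNIV (\<lambda>i. {\<lfloor>x $ i\<rfloor> - 1, \<lfloor>x $ i\<rfloor>, \<lfloor>x $ i\<rfloor> + 1})"

lemma finite_nearby: "finite (nearby x)"
  unfolding nearby_def by (intro finite_PiE) auto

lemma card_nearby: "card (nearby (x :: real ^ 'n::finite)) \<le> 3 ^ CARD('n)"
proof -
  have "card (nearby x) = (\<Prod>i\<in>UNIV. card {\<lfloor>x $ i\<rfloor> - 1, \<lfloor>x $ i\<rfloor>, \<lfloor>x $ i\<rfloor> + 1})"
    unfolding nearby_def by (intro card_PiE) auto
  also have "\<dots> \<le> (\<Prod>i\<in>(UNIV::'n set). 3)" by (intro prod_mono) (auto simp: card_insert_if)
  finally show ?thesis by simp
qed

lemma nearby_iff: "j \<in> nearby x \<longleftrightarrow> (\<forall>i. j i \<in> {\<lfloor>x $ i\<rfloor> - 1, \<lfloor>x $ i\<rfloor>, \<lfloor>x $ i\<rfloor> + 1})"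
  by (simp add: nearby_def PiE_UNIV_domain Pi_iff)

lemma in_nearbyI:
  assumes "\<And>i. \<bar>(x - lattice_vec j) $ i\<bar> \<le> 1" shows "j \<in> nearby x"
  unfolding nearby_iff
proof
  fix i
  have "\<bar>x $ i - of_int (j i)\<bar> \<le> 1" using assms[of i] by (simp add: lattice_vec_def)
  then have "\<lfloor>x $ i\<rfloor> - 1 \<le> j i \<and> j i \<le> \<lfloor>x $ i\<rfloor> + 1" by linarith
  then show "j i \<in> {\<lfloor>x $ i\<rfloor> - 1, \<lfloor>x $ i\<rfloor>, \<lfloor>x $ i\<rfloor> + 1}" by auto
qed

text \<open>
For a smooth step \<open>S\<close> the integer translates of \<open>b(t) = S(1 + t) - S(t)\<close> telescope to \<open>1\<close> and \<open>b\<close>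
vanishes off \<open>(-1, 1)\<close>.  The product of \<open>b\<close> over the coordinates is the required function.
\<close>

lemma lattice_partition:
  "\<exists>\<phi> :: real ^ 'n::finite \<Rightarrow> real. class_C p \<phi> \<and> (\<forall>x. \<phi> x \<noteq> 0 \<longrightarrow> (\<forall>i. \<bar>x $ i\<bar> < 1)) \<and>
     (\<forall>x. (\<Sum>j\<in>nearby x. \<phi> (x - lattice_vec j)) = 1)"
proof -
  obtain S :: "real \<Rightarrow> real" where S: "class_C p S" "\<And>t. t \<le> 0 \<Longrightarrow> S t = 0" "\<And>t. t \<ge> 1 \<Longrightarrow> S t = (1::real)"
    using smooth_step[of p] by blast
  define b where "b t = S (1 + t) - S t" for t :: real
  define \<phi> where "\<phi> x = (\<Prod>i\<in>UNIV. b (x $ i))" for x :: "real ^ 'n"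
  have "class_C p \<phi>"
  proof -
    have "class_C p (\<lambda>x::real^'n. S (1 + axis i 1 \<bullet> x) - S (axis i 1 \<bullet> x))" for i
      by (intro class_C_diff class_C_compose[OF S(1)] class_C_add class_C_const class_C_inner)
    then show ?thesis
      unfolding \<phi>_def[abs_def] b_def by (intro class_C_prod) (simp add: inner_axis')
  qed
  moreover have "\<bar>x $ i\<bar> < 1" if "\<phi> x \<noteq> 0" for x i
  proof (rule ccontr)
    assume "\<not> \<bar>x $ i\<bar> < 1"
    then have "b (x $ i) = 0" using S(2,3) by (auto simp: b_def abs_if split: if_splits)
    with that show False by (auto simp: \<phi>_def)
  qed
  moreover have "(\<Sum>j\<in>nearby x. \<phi> (x - lattice_vec j)) = 1" for x :: "real ^ 'n"
  proof -
    have "(\<Sum>j\<in>nearby x. \<phi> (x - lattice_vec j)) =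
        (\<Sum>j\<in>nearby x. \<Prod>i\<in>UNIV. b (x $ i - of_int (j i)))"
      by (simp add: \<phi>_def lattice_vec_def)
    also have "\<dots> = (\<Prod>i\<in>UNIV. \<Sum>l\<in>{\<lfloor>x $ i\<rfloor> - 1, \<lfloor>x $ i\<rfloor>, \<lfloor>x $ i\<rfloor> + 1}. b (x $ i - of_int l))"
      unfolding nearby_def by (subst prod_sum_PiE) auto
    also have "\<dots> = (\<Prod>i\<in>(UNIV::'n set). 1)"
    proof (rule prod.cong[OF refl])
      fix i
      let ?t = "x $ i"
      have "(\<Sum>l\<in>{\<lfloor>?t\<rfloor> - 1, \<lfloor>?t\<rfloor>, \<lfloor>?t\<rfloor> + 1}. b (?t - of_int l)) = S (?t - of_int \<lfloor>?t\<rfloor> + 2) - S (?t - of_int \<lfloor>?t\<rfloor> - 1)"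
        by (simp add: b_def algebra_simps)
      also have "\<dots> = 1" by (subst S(3), linarith, subst S(2), linarith, simp)
      finally show "(\<Sum>l\<in>{\<lfloor>?t\<rfloor> - 1, \<lfloor>?t\<rfloor>, \<lfloor>?t\<rfloor> + 1}. b (?t - of_int l)) = 1" .
    qed
    finally show ?thesis by simp
  qed
  ultimately show ?thesis by blast
qed

section \<open>Series of functions of class C^k\<close>

text \<open>
A summable bound on the \<open>p\<close>-jets allows one termwise differentiation, and the series of derivatives
satisfies the same hypothesis with \<open>p - 1\<close>.
\<close>

lemma class_C_series:
  assumes "\<And>k. class_C p (E k)" "\<And>k x. jet_le p (M k) 1 (E k) x" "summable M"
  shows "class_C p (\<lambda>x. \<Sum>k. E k x) \<and>
    (\<forall>us x. length us \<le> p \<longrightarrow> (\<lambda>k. nth_deriv us (E k) x) sums nth_deriv us (\<lambda>x. \<Sum>k. E k x) x)"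
  using assms
proof (induction p arbitrary: E M)
  case 0
  have b: "norm (E k x) \<le> M k" for k x using 0 by (simp add: jet_le_0)
  have "continuous_on UNIV (\<lambda>x. \<Sum>k. E k x)"
  proof (rule uniform_limit_theorem)
    show "uniform_limit UNIV (\<lambda>n s. \<Sum>k<n. E k s) (\<lambda>x. \<Sum>k. E k x) sequentially"
      using b 0 by (intro Weierstrass_m_test) auto
    show "\<forall>\<^sub>F n in sequentially. continuous_on UNIV (\<lambda>s. \<Sum>k<n. E k s)"
      using 0 by (intro always_eventually allI continuous_on_sum) (auto simp: class_C_0)
  qed simp
  moreover have "summable (\<lambda>k. E k x)" for x
    by (rule summable_comparison_test'[OF 0(3), of 0]) (use b in auto)
  ultimately show ?case by (auto simp: class_C_0 summable_sums)
next
  case (Suc p)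
  have b: "norm (E k x) \<le> M k" for k x using Suc.prems(2) by (simp add: jet_le_Suc)
  have s: "summable (\<lambda>k. E k x)" for x
    by (rule summable_comparison_test'[OF Suc.prems(3), of 0]) (use b in auto)
  have IH: "class_C p (\<lambda>x. \<Sum>k. dd u (E k) x) \<and>
    (\<forall>us x. length us \<le> p \<longrightarrow>
       (\<lambda>k. nth_deriv us (dd u (E k)) x) sums nth_deriv us (\<lambda>x. \<Sum>k. dd u (E k) x) x)" for u
    using Suc.prems by (intro Suc.IH[of "\<lambda>k. dd u (E k)" "\<lambda>k. M k * norm u"])
      (auto simp: class_C_Suc jet_le_Suc intro: summable_mult2)
  have d: "\<bar>dd h (E k) x\<bar> \<le> M k * norm h" for k h x
    using jet_leD[OF Suc.prems(2), of "[h]" k x] by (simp add: nth_deriv_Cons)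
  have sd: "summable (\<lambda>k. dd h (E k) x)" for h x
    by (rule summable_comparison_test'[OF summable_mult2[OF Suc.prems(3), of "norm h"], of 0]) (use d in auto)
  have D: "((\<lambda>x. \<Sum>k. E k x) has_derivative (\<lambda>h. \<Sum>k. dd h (E k) x)) (at x)" for x
  proof -
    have "\<exists>g. \<forall>x\<in>UNIV. (\<lambda>n. E n x) sums (g x) \<and>
        (g has_derivative (\<lambda>h. \<Sum>k. dd h (E k) x)) (at x within UNIV)"
    proof (rule has_derivative_series)
      show "(E n has_derivative (\<lambda>h. dd h (E n) x)) (at x within UNIV)" for n x
        using Suc.prems(1)[of n] by (simp add: class_C_Suc has_derivative_dd)
      show "(\<lambda>n. E n 0) sums (\<Sum>n. E n 0)" using s by (rule summable_sums)
      fix e :: real assume e: "e > 0"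
      obtain N where N: "\<And>n. n \<ge> N \<Longrightarrow> norm (\<Sum>k. M (k + n)) < e"
        using suminf_exist_split[OF e Suc.prems(3)] by blast
      have "norm ((\<Sum>i<n. dd h (E i) x) - (\<Sum>k. dd h (E k) x)) \<le> e * norm h" if n: "n \<ge> N" for n x h
      proof -
        have sM: "summable (\<lambda>k. M (k + n))" using Suc.prems(3) by (simp add: summable_iff_shift)
        have "norm ((\<Sum>i<n. dd h (E i) x) - (\<Sum>k. dd h (E k) x)) = \<bar>\<Sum>k. dd h (E (k + n)) x\<bar>"
          using suminf_split_initial_segment[OF sd[of h x], of n] by simp
        also have "\<dots> \<le> (\<Sum>k. M (k + n) * norm h)"
          using norm_suminf_le[of "\<lambda>k. dd h (E (k + n)) x" "\<lambda>k. M (k + n) * norm h"] d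
            summable_mult2[OF sM] by simp
        also have "\<dots> = (\<Sum>k. M (k + n)) * norm h" using suminf_mult2[OF sM] by simp
        also have "\<dots> \<le> e * norm h" using N[OF n] by (intro mult_right_mono) auto
        finally show ?thesis .
      qed
      then show "\<forall>\<^sub>F n in sequentially. \<forall>x\<in>UNIV. \<forall>h.
          norm ((\<Sum>i<n. dd h (E i) x) - (\<Sum>k. dd h (E k) x)) \<le> e * norm h"
        unfolding eventually_sequentially by blast
    qed auto
    then obtain g where g: "\<And>x. (\<lambda>n. E n x) sums (g x)"
        "\<And>x. (g has_derivative (\<lambda>h. \<Sum>k. dd h (E k) x)) (at x)" by auto
    then have "g = (\<lambda>x. \<Sum>k. E k x)" by (auto simp: sums_iff)
    with g show ?thesis by simp
  qed
  have dF: "dd u (\<lambda>x. \<Sum>k. E k x) = (\<lambda>x. \<Sum>k. dd u (E k) x)" for u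
    by (rule ext) (rule dd_eq[OF D])
  show ?case
  proof (intro conjI allI impI)
    show "class_C (Suc p) (\<lambda>x. \<Sum>k. E k x)"
      using D IH by (auto simp: class_C_Suc dF differentiable_def)
    fix us :: "'a list" and x assume "length us \<le> Suc p"
    then show "(\<lambda>k. nth_deriv us (E k) x) sums nth_deriv us (\<lambda>x. \<Sum>k. E k x) x"
      using IH s by (cases us rule: rev_cases) (auto simp: nth_deriv_snoc dF summable_sums)
  qed
qed

lemma jet_le_suminf:
  assumes E: "\<And>k. jet_le p (M k) \<epsilon> (E k) x" and M: "summable M"
    and s: "\<And>us. length us \<le> p \<Longrightarrow> (\<lambda>k. nth_deriv us (E k) x) sums nth_deriv us G x"
  shows "jet_le p (\<Sum>k. M k) \<epsilon> G x"
  unfolding jet_le_def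
proof (intro allI impI)
  fix us :: "'a list" assume us: "length us \<le> p"
  let ?R = "\<Prod>u\<leftarrow>us. norm u / \<epsilon>"
  have "norm (\<Sum>k. nth_deriv us (E k) x) \<le> (\<Sum>k. M k * ?R)"
    using jet_leD[OF E us] by (intro norm_suminf_le summable_mult2[OF M]) auto
  also have "\<dots> = (\<Sum>k. M k) * ?R" using suminf_mult2[OF M] by simp
  finally show "\<bar>nth_deriv us G x\<bar> \<le> (\<Sum>k. M k) * ?R"
    using s[OF us] by (simp add: sums_iff)
qed

section \<open>The Whitney extension of class C^(m-1)\<close>

text \<open>
The bumps of all scales are dilates and translates of the single function \<open>\<phi>\<close>, so that one jet
bound \<open>A\<close> serves for every scale.
\<close>

locale whitney_field =
  fixes C :: "(real ^ 'n::finite) set" and P :: "real ^ 'n \<Rightarrow> real ^ 'n \<Rightarrow> real" and m :: nat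
    and \<phi> :: "real ^ 'n \<Rightarrow> real" and A :: real
  assumes compact_C: "compact C" and m_pos: "m \<ge> 1"
    and poly: "\<And>y. y \<in> C \<Longrightarrow> poly_lt (Suc m) (P y)"
    and bump_C: "class_C (m - 1) \<phi>"
    and bump_support: "\<And>x i. \<phi> x \<noteq> 0 \<Longrightarrow> \<bar>x $ i\<bar> < 1"
    and bump_sum: "\<And>x. (\<Sum>j\<in>nearby x. \<phi> (x - lattice_vec j)) = 1"
    and bump_jet: "\<And>x. jet_le (m - 1) A 1 \<phi> x"
begin

definition "p = m - 1"

definition "N = real CARD('n)"

definition bump :: "real \<Rightarrow> ('n \<Rightarrow> int) \<Rightarrow> real ^ 'n \<Rightarrow> real" where
  "bump \<epsilon> j x = \<phi> ((1 / \<epsilon>) *\<^sub>R x - lattice_vec j)"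

text \<open>
  At scale \<open>\<epsilon>\<close>, the indices \<open>J \<epsilon>\<close> are the lattice points near \<open>C\<close>, and \<open>site \<epsilon> j\<close> is a point of \<open>C\<close> near
  the lattice point \<open>j\<close>.  The supports of the bumps have radius at most \<open>N * \<epsilon>\<close>.  The radius \<open>4 * N * \<epsilon>\<close>
  for \<open>J\<close> is chosen such that \<open>T \<epsilon> = 1\<close> within distance \<open>3 * N * \<epsilon>\<close> of \<open>C\<close>, while everything at scale
  \<open>\<epsilon> / 2\<close> is supported within \<open>5 * N * (\<epsilon> / 2)\<close>, hence where \<open>S \<epsilon>\<close> is already accurate.
\<close>

definition J :: "real \<Rightarrow> ('n \<Rightarrow> int) set" where
  "J \<epsilon> = {j. \<exists>y\<in>C. norm (\<epsilon> *\<^sub>R lattice_vec j - y) \<le> 4 * N * \<epsilon>}"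

definition site :: "real \<Rightarrow> ('n \<Rightarrow> int) \<Rightarrow> real ^ 'n" where
  "site \<epsilon> j = (SOME y. y \<in> C \<and> norm (\<epsilon> *\<^sub>R lattice_vec j - y) \<le> 4 * N * \<epsilon>)"

definition S :: "real \<Rightarrow> real ^ 'n \<Rightarrow> real" where
  "S \<epsilon> x = (\<Sum>j\<in>J \<epsilon>. bump \<epsilon> j x * P (site \<epsilon> j) x)"

definition T :: "real \<Rightarrow> real ^ 'n \<Rightarrow> real" where
  "T \<epsilon> x = (\<Sum>j\<in>J \<epsilon>. bump \<epsilon> j x)"

text \<open>
  The correction that replaces \<open>S (2 * \<epsilon>)\<close> by \<open>S \<epsilon>\<close> where \<open>T \<epsilon> = 1\<close>.  As
  \<open>E \<epsilon> = (\<Sum>j\<in>J \<epsilon>. bump \<epsilon> j * (P (site \<epsilon> j) - S (2 * \<epsilon>)))\<close>, it vanishes away from \<open>C\<close>.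
\<close>

definition E :: "real \<Rightarrow> real ^ 'n \<Rightarrow> real" where
  "E \<epsilon> x = S \<epsilon> x - T \<epsilon> x * S (2 * \<epsilon>) x"

text \<open>
  The closed cube around the lattice point \<open>j\<close>, whose complement is an open set on which the bump
  vanishes, so that its derivatives vanish there as well.
\<close>

definition active :: "real \<Rightarrow> ('n \<Rightarrow> int) \<Rightarrow> real ^ 'n \<Rightarrow> bool" where
  "active \<epsilon> j x \<longleftrightarrow> (\<forall>i. \<bar>((1 / \<epsilon>) *\<^sub>R x - lattice_vec j) $ i\<bar> \<le> 1)"

definition "Q = 3 ^ CARD('n) * 2 ^ p * A"

lemma N_ge_1: "N \<ge> 1"
  using zero_less_card_finite[where 'a = 'n] by (simp add: N_def Suc_le_eq del: zero_less_card_finite)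

lemma A_nonneg: "A \<ge> 0" using jet_leD[OF bump_jet, of "[]"] by fastforce

lemma Q_nonneg: "Q \<ge> 0" using A_nonneg by (simp add: Q_def)

lemma site: "j \<in> J \<epsilon> \<Longrightarrow> site \<epsilon> j \<in> C \<and> norm (\<epsilon> *\<^sub>R lattice_vec j - site \<epsilon> j) \<le> 4 * N * \<epsilon>"
  unfolding J_def site_def by (rule someI_ex) auto

lemma finite_J:
  assumes "\<epsilon> > 0" shows "finite (J \<epsilon>)"
proof -
  obtain R where R: "\<And>y. y \<in> C \<Longrightarrow> norm y \<le> R"
    using compact_imp_bounded[OF compact_C] by (auto simp: bounded_iff)
  define B where "B = \<lceil>(R + 4 * N * \<epsilon>) / \<epsilon>\<rceil>"
  have "j \<in> PiE UNIV (\<lambda>i. {-B..B})" if j: "j \<in> J \<epsilon>" for j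
  proof -
    have "\<bar>j i\<bar> \<le> B" for i
    proof -
      have "\<epsilon> * \<bar>of_int (j i)\<bar> = \<bar>(\<epsilon> *\<^sub>R (lattice_vec j :: real ^ 'n)) $ i\<bar>"
        using assms by (simp add: lattice_vec_def abs_mult)
      also have "\<dots> \<le> norm (\<epsilon> *\<^sub>R (lattice_vec j :: real ^ 'n))" by (rule component_le_norm_cart)
      also have "\<dots> \<le> R + 4 * N * \<epsilon>"
        using site[OF j] R[of "site \<epsilon> j"] norm_triangle_sub[of "\<epsilon> *\<^sub>R lattice_vec j" "site \<epsilon> j"] by linarith
      finally have "real_of_int \<bar>j i\<bar> \<le> (R + 4 * N * \<epsilon>) / \<epsilon>" using assms by (simp add: field_simps)
      then show ?thesis unfolding B_def by linarith
    qed
    then show ?thesis by (auto simp: PiE_UNIV_domain abs_le_iff minus_le_iff)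
  qed
  then have "J \<epsilon> \<subseteq> PiE UNIV (\<lambda>i. {-B..B})" by blast
  then show ?thesis by (rule finite_subset) (intro finite_PiE, auto)
qed

lemma active_norm:
  assumes "active \<epsilon> j x" "\<epsilon> > 0" shows "norm (x - \<epsilon> *\<^sub>R lattice_vec j) \<le> N * \<epsilon>"
proof -
  have "norm ((1 / \<epsilon>) *\<^sub>R x - lattice_vec j) \<le> (\<Sum>i\<in>UNIV. \<bar>((1 / \<epsilon>) *\<^sub>R x - lattice_vec j) $ i\<bar>)"
    by (rule norm_le_l1_cart)
  also have "\<dots> \<le> (\<Sum>i\<in>(UNIV :: 'n set). 1)"
    using assms(1) by (intro sum_mono) (auto simp: active_def)
  finally have "\<epsilon> * norm ((1 / \<epsilon>) *\<^sub>R x - lattice_vec j) \<le> N * \<epsilon>"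
    using assms(2) by (simp add: N_def)
  also have "\<epsilon> * norm ((1 / \<epsilon>) *\<^sub>R x - lattice_vec j) = norm (\<epsilon> *\<^sub>R ((1 / \<epsilon>) *\<^sub>R x - lattice_vec j))"
    using assms(2) by simp
  also have "\<epsilon> *\<^sub>R ((1 / \<epsilon>) *\<^sub>R x - lattice_vec j) = x - \<epsilon> *\<^sub>R lattice_vec j"
    using assms(2) by (simp add: scaleR_diff_right)
  finally show ?thesis .
qed

lemma active_nearby: "active \<epsilon> j x \<Longrightarrow> j \<in> nearby ((1 / \<epsilon>) *\<^sub>R x)"
  by (rule in_nearbyI) (auto simp: active_def)

lemma bump_active: "bump \<epsilon> j x \<noteq> 0 \<Longrightarrow> active \<epsilon> j x"
  unfolding bump_def active_def using bump_support less_imp_le by blast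

lemma active_site:
  assumes "active \<epsilon> j x" "j \<in> J \<epsilon>" "\<epsilon> > 0" shows "norm (x - site \<epsilon> j) \<le> 5 * N * \<epsilon>"
  using active_norm[OF assms(1,3)] site[OF assms(2)]
    norm_triangle_ineq[of "x - \<epsilon> *\<^sub>R lattice_vec j" "\<epsilon> *\<^sub>R lattice_vec j - site \<epsilon> j"]
  by (auto simp: algebra_simps)

lemma inactive_open:
  assumes "\<not> active \<epsilon> j x"
  obtains U where "open U" "x \<in> U" "\<And>z. z \<in> U \<Longrightarrow> bump \<epsilon> j z = 0"
proof -
  obtain i where i: "1 < \<bar>((1 / \<epsilon>) *\<^sub>R x - lattice_vec j) $ i\<bar>" using assms by (auto simp: active_def not_le)
  let ?U = "{z. 1 < \<bar>((1 / \<epsilon>) *\<^sub>R z - lattice_vec j) $ i\<bar>}"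
  have "open ?U" by (intro open_Collect_less continuous_intros)
  moreover have "bump \<epsilon> j z = 0" if "z \<in> ?U" for z
    using bump_active[of \<epsilon> j z] that unfolding active_def by (metis mem_Collect_eq not_le)
  ultimately show ?thesis using that[of ?U] i by blast
qed

lemma T_eq_1:
  assumes \<epsilon>: "\<epsilon> > 0" and y: "y \<in> C" "norm (x - y) \<le> 3 * N * \<epsilon>"
  shows "T \<epsilon> x = 1"
proof -
  have "j \<in> J \<epsilon>" if "bump \<epsilon> j x \<noteq> 0" for j
  proof -
    have "norm (\<epsilon> *\<^sub>R lattice_vec j - y) \<le> 4 * N * \<epsilon>"
      using active_norm[OF bump_active[OF that] \<epsilon>] y
        norm_triangle_ineq[of "\<epsilon> *\<^sub>R lattice_vec j - x" "x - y"]
      by (auto simp: norm_minus_commute)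
    with y show ?thesis by (auto simp: J_def)
  qed
  then have "T \<epsilon> x = (\<Sum>j\<in>nearby ((1 / \<epsilon>) *\<^sub>R x). bump \<epsilon> j x)"
    unfolding T_def using finite_J[OF \<epsilon>] finite_nearby bump_active active_nearby
    by (intro sum.mono_neutral_cong) blast+
  then show ?thesis using bump_sum by (simp add: bump_def)
qed

lemma class_C_bump: "class_C p (bump \<epsilon> j)"
proof -
  have "class_C p (\<lambda>x. \<phi> ((1 / \<epsilon>) *\<^sub>R x - lattice_vec j))"
    using bump_C unfolding p_def by (intro class_C_affine)
  then show ?thesis by (simp add: bump_def[abs_def])
qed

lemma class_C_P: "y \<in> C \<Longrightarrow> class_C k (P y)"
  using poly poly_lt_class_C by blast

lemma class_C_S: "class_C p (S \<epsilon>)"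
  unfolding S_def[abs_def] using site by (intro class_C_sum class_C_mult class_C_bump class_C_P) blast

lemma class_C_T: "class_C p (T \<epsilon>)"
  unfolding T_def[abs_def] by (intro class_C_sum class_C_bump)

lemma class_C_E: "class_C p (E \<epsilon>)"
  unfolding E_def[abs_def] by (intro class_C_diff class_C_mult class_C_S class_C_T)

lemma jet_bump:
  assumes "\<epsilon> > 0" shows "jet_le p A \<epsilon> (bump \<epsilon> j) x"
  unfolding jet_le_def
proof (intro allI impI)
  fix us :: "(real ^ 'n) list" assume us: "length us \<le> p"
  let ?z = "(1 / \<epsilon>) *\<^sub>R x - lattice_vec j"
  have "nth_deriv us (bump \<epsilon> j) x = (1 / \<epsilon>) ^ length us * nth_deriv us \<phi> ?z"
    using nth_deriv_affine[of us \<phi> "1 / \<epsilon>" "lattice_vec j"] class_C_le[OF bump_C] us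
    by (simp add: bump_def[abs_def] p_def)
  then have "\<bar>nth_deriv us (bump \<epsilon> j) x\<bar> = (1 / \<epsilon>) ^ length us * \<bar>nth_deriv us \<phi> ?z\<bar>"
    using assms by (simp add: abs_mult)
  also have "\<dots> \<le> (1 / \<epsilon>) ^ length us * (A * (\<Prod>u\<leftarrow>us. norm u / 1))"
    using jet_leD[OF bump_jet, of us ?z] us assms by (intro mult_left_mono) (auto simp: p_def)
  also have "(1 / \<epsilon>) ^ length us * (A * (\<Prod>u\<leftarrow>us. norm u / 1)) = A * (\<Prod>u\<leftarrow>us. norm u / \<epsilon>)"
    by (simp add: prod_list_norm_divide[of \<epsilon>] power_divide)
  finally show "\<bar>nth_deriv us (bump \<epsilon> j) x\<bar> \<le> A * (\<Prod>u\<leftarrow>us. norm u / \<epsilon>)" .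
qed

text \<open>
At most \<open>3 ^ CARD('n)\<close> bumps are active at a given point, independently of the scale.  The functions
\<open>g j\<close> are controlled only at the points where the bump with index \<open>j\<close> is active.
\<close>

lemma jet_bump_sum:
  assumes \<epsilon>: "\<epsilon> > 0" and B: "B \<ge> 0"
    and g: "\<And>j. j \<in> J \<epsilon> \<Longrightarrow> class_C p (g j)"
    and b: "\<And>j. j \<in> J \<epsilon> \<Longrightarrow> active \<epsilon> j x \<Longrightarrow> jet_le p B \<epsilon> (g j) x"
  shows "jet_le p (Q * B) \<epsilon> (\<lambda>x. \<Sum>j\<in>J \<epsilon>. bump \<epsilon> j x * g j x) x"
proof -
  define c where "c j = (if active \<epsilon> j x then 2 ^ p * A * B else 0)" for j
  have "jet_le p (\<Sum>j\<in>J \<epsilon>. c j) \<epsilon> (\<lambda>x. \<Sum>j\<in>J \<epsilon>. bump \<epsilon> j x * g j x) x"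
  proof (intro jet_le_sum finite_J \<epsilon>)
    fix j assume j: "j \<in> J \<epsilon>"
    show "class_C p (\<lambda>x. bump \<epsilon> j x * g j x)" by (intro class_C_mult class_C_bump g j)
    show "jet_le p (c j) \<epsilon> (\<lambda>x. bump \<epsilon> j x * g j x) x"
    proof (cases "active \<epsilon> j x")
      case True
      then show ?thesis using jet_le_mult[OF jet_bump[OF \<epsilon>] b[OF j True] class_C_bump g[OF j]]
        by (simp add: c_def)
    next
      case False
      then obtain U where U: "open U" "x \<in> U" "\<And>z. z \<in> U \<Longrightarrow> bump \<epsilon> j z = 0"
        using inactive_open by blast
      have "jet_le p 0 \<epsilon> (\<lambda>x. bump \<epsilon> j x * g j x) x = jet_le p 0 \<epsilon> (\<lambda>x. 0) x"
        using U by (intro jet_le_local[of U]) auto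
      then show ?thesis using False by (simp add: c_def jet_le_def nth_deriv_zero)
    qed
  qed
  moreover have "(\<Sum>j\<in>J \<epsilon>. c j) \<le> Q * B"
  proof -
    have "(\<Sum>j\<in>J \<epsilon>. c j) = (\<Sum>j\<in>{j\<in>J \<epsilon>. active \<epsilon> j x}. 2 ^ p * A * B)"
      unfolding c_def using finite_J[OF \<epsilon>] by (subst sum.inter_filter) auto
    also have "\<dots> = real (card {j\<in>J \<epsilon>. active \<epsilon> j x}) * (2 ^ p * A * B)" by simp
    also have "\<dots> \<le> real (3 ^ CARD('n)) * (2 ^ p * A * B)"
    proof (intro mult_right_mono of_nat_mono)
      have "card {j\<in>J \<epsilon>. active \<epsilon> j x} \<le> card (nearby ((1 / \<epsilon>) *\<^sub>R x))"
        using active_nearby by (intro card_mono finite_nearby) auto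
      also have "\<dots> \<le> 3 ^ CARD('n)" by (rule card_nearby)
      finally show "card {j\<in>J \<epsilon>. active \<epsilon> j x} \<le> 3 ^ CARD('n)" .
    qed (use A_nonneg B in auto)
    finally show ?thesis by (simp add: Q_def)
  qed
  ultimately show ?thesis using jet_le_mono[of p "\<Sum>j\<in>J \<epsilon>. c j" \<epsilon> _ x \<epsilon> "Q * B" p] \<epsilon> by blast
qed

definition whitney_at :: "real \<Rightarrow> real \<Rightarrow> bool" where
  "whitney_at e a \<longleftrightarrow> (\<forall>y\<in>C. \<forall>z\<in>C. norm (y - z) \<le> a \<longrightarrow>
     jet_le m (e * a ^ m) a (\<lambda>x. P y x - P z x) z)"

lemma jet_P_diff:
  assumes W: "whitney_at e a" and yz: "y \<in> C" "z \<in> C" "norm (y - z) \<le> a" and x: "norm (x - z) \<le> a"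
    and \<epsilon>: "0 < \<epsilon>" "\<epsilon> \<le> a"
  shows "jet_le p (real (Suc m) * (e * a ^ m)) \<epsilon> (\<lambda>x. P y x - P z x) x"
proof -
  have "jet_le m (e * a ^ m) a (\<lambda>x. P y x - P z x) z" using W yz by (auto simp: whitney_at_def)
  moreover have "poly_lt (Suc m) (\<lambda>x. P y x - P z x)"
    using poly_lt_add[OF poly[OF yz(1)] poly_lt_cmult[OF poly[OF yz(2)], of "-1"]]
    by (simp del: poly_lt.simps)
  ultimately have "jet_le m (real (Suc m) * (e * a ^ m)) a (\<lambda>x. P y x - P z x) x"
    using x \<epsilon> by (intro jet_le_poly_move) auto
  then show ?thesis using \<epsilon> by (rule jet_le_mono) (auto simp: p_def)
qed

text \<open>
Where the bumps sum to \<open>1\<close>, the difference \<open>S \<epsilon> - P y\<close> is the blend of the differences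
\<open>P (site \<epsilon> j) - P y\<close>, and all the sites that matter lie within \<open>8 * N * \<epsilon>\<close> of \<open>y\<close>.
\<close>

lemma jet_S_diff:
  assumes \<epsilon>: "\<epsilon> > 0" and e: "e \<ge> 0" and W: "whitney_at e (8 * N * \<epsilon>)"
    and y: "y \<in> C" "norm (x - y) < 3 * N * \<epsilon>"
  shows "jet_le p (Q * (real (Suc m) * (e * (8 * N * \<epsilon>) ^ m))) \<epsilon> (\<lambda>x. S \<epsilon> x - P y x) x"
proof -
  let ?a = "8 * N * \<epsilon>"
  have "open {z. norm (z - y) < 3 * N * \<epsilon>}" by (intro open_Collect_less continuous_intros)
  moreover have "S \<epsilon> z - P y z = (\<Sum>j\<in>J \<epsilon>. bump \<epsilon> j z * (P (site \<epsilon> j) z - P y z))"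
    if "z \<in> {z. norm (z - y) < 3 * N * \<epsilon>}" for z
  proof -
    have "T \<epsilon> z = 1" using that y by (intro T_eq_1[OF \<epsilon>, of y]) auto
    then have "P y z = (\<Sum>j\<in>J \<epsilon>. bump \<epsilon> j z) * P y z" by (simp add: T_def)
    then show ?thesis
      unfolding S_def by (simp add: right_diff_distrib sum_subtractf sum_distrib_right)
  qed
  moreover have "jet_le p (Q * (real (Suc m) * (e * ?a ^ m))) \<epsilon>
      (\<lambda>x. \<Sum>j\<in>J \<epsilon>. bump \<epsilon> j x * (P (site \<epsilon> j) x - P y x)) x"
  proof (intro jet_bump_sum \<epsilon>)
    show "0 \<le> real (Suc m) * (e * ?a ^ m)" using e \<epsilon> N_ge_1 by simp
    fix j assume j: "j \<in> J \<epsilon>"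
    show "class_C p (\<lambda>x. P (site \<epsilon> j) x - P y x)"
      using site[OF j] y by (intro class_C_diff class_C_P) auto
    assume a: "active \<epsilon> j x"
    show "jet_le p (real (Suc m) * (e * ?a ^ m)) \<epsilon> (\<lambda>x. P (site \<epsilon> j) x - P y x) x"
    proof (rule jet_P_diff[OF W])
      show "norm (site \<epsilon> j - y) \<le> ?a"
        using active_site[OF a j \<epsilon>] y norm_triangle_ineq[of "site \<epsilon> j - x" "x - y"]
        by (auto simp: norm_minus_commute)
      have "1 * \<epsilon> \<le> N * \<epsilon>" using N_ge_1 \<epsilon> by (intro mult_right_mono) auto
      then show "norm (x - y) \<le> ?a" "\<epsilon> \<le> ?a" using y \<epsilon> unfolding mult.assoc by linarith+
    qed (use site[OF j] y \<epsilon> in auto)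
  qed
  ultimately show ?thesis using jet_le_local[of "{z. norm (z - y) < 3 * N * \<epsilon>}" "\<lambda>x. S \<epsilon> x - P y x"] y
    by (metis (no_types, lifting) mem_Collect_eq)
qed

definition "Q' = Q * (real (Suc m) + Q * real (Suc m))"

lemma Q'_nonneg: "Q' \<ge> 0" using Q_nonneg by (simp add: Q'_def)

text \<open>
If \<open>bump \<epsilon> j\<close> is active at \<open>x\<close>, then \<open>x\<close> is within \<open>5 * N * \<epsilon>\<close> of the site of \<open>j\<close>, which is inside the
region \<open>3 * N * (2 * \<epsilon>)\<close> where the previous approximation \<open>S (2 * \<epsilon>)\<close> is close to the polynomial of
that site.  So the bound holds at all points, near \<open>C\<close> or not.
\<close>

lemma jet_E:
  assumes \<epsilon>: "\<epsilon> > 0" and e: "e \<ge> 0" and W: "whitney_at e (16 * N * \<epsilon>)"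
  shows "jet_le p (Q' * (e * (16 * N * \<epsilon>) ^ m)) \<epsilon> (E \<epsilon>) x"
proof -
  let ?a = "16 * N * \<epsilon>"
  define B where "B = e * ?a ^ m"
  have B: "B \<ge> 0" using e \<epsilon> N_ge_1 by (simp add: B_def)
  have a: "\<epsilon> \<le> N * \<epsilon>" using N_ge_1 \<epsilon> by simp
  have "E \<epsilon> = (\<lambda>x. \<Sum>j\<in>J \<epsilon>. bump \<epsilon> j x * (P (site \<epsilon> j) x - S (2 * \<epsilon>) x))"
    unfolding E_def S_def[of \<epsilon>] T_def
    by (auto simp: right_diff_distrib sum_subtractf sum_distrib_right)
  moreover have "jet_le p (Q * ((real (Suc m) + Q * real (Suc m)) * B)) \<epsilon>
      (\<lambda>x. \<Sum>j\<in>J \<epsilon>. bump \<epsilon> j x * (P (site \<epsilon> j) x - S (2 * \<epsilon>) x)) x"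
  proof (intro jet_bump_sum \<epsilon>)
    show "0 \<le> (real (Suc m) + Q * real (Suc m)) * B" using Q_nonneg B by simp
    fix j assume j: "j \<in> J \<epsilon>"
    show "class_C p (\<lambda>x. P (site \<epsilon> j) x - S (2 * \<epsilon>) x)"
      using site[OF j] by (intro class_C_diff class_C_P class_C_S) auto
    assume act: "active \<epsilon> j x"
    let ?y = "site \<epsilon> j"
    have y: "?y \<in> C" "norm (x - ?y) \<le> 5 * N * \<epsilon>" using site[OF j] active_site[OF act j \<epsilon>] by auto
    have W': "whitney_at e (8 * N * (2 * \<epsilon>))" using W by (simp add: mult_ac)
    have "jet_le p (Q * (real (Suc m) * (e * (8 * N * (2 * \<epsilon>)) ^ m))) (2 * \<epsilon>) (\<lambda>x. S (2 * \<epsilon>) x - P ?y x) x"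
    proof (rule jet_S_diff[OF _ e W'])
      show "norm (x - ?y) < 3 * N * (2 * \<epsilon>)" using y(2) \<epsilon> a by (unfold mult.assoc mult.left_commute[of N 2], linarith)
    qed (use y \<epsilon> in auto)
    also have "8 * N * (2 * \<epsilon>) = ?a" by simp
    finally have "jet_le p (Q * (real (Suc m) * B)) (2 * \<epsilon>) (\<lambda>x. S (2 * \<epsilon>) x - P ?y x) x"
      by (simp add: B_def)
    then have "jet_le p ((real (Suc m) + Q * real (Suc m)) * B) \<epsilon> (\<lambda>x. S (2 * \<epsilon>) x - P ?y x) x"
      by (rule jet_le_mono) (use \<epsilon> B in \<open>auto simp: algebra_simps\<close>)
    from jet_le_cmult[OF this, of "-1"]
    show "jet_le p ((real (Suc m) + Q * real (Suc m)) * B) \<epsilon> (\<lambda>x. P ?y x - S (2 * \<epsilon>) x) x"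
      using y by (simp add: class_C_diff class_C_S class_C_P)
  qed
  ultimately show ?thesis by (simp add: Q'_def B_def mult_ac)
qed

lemma support_bound:
  obtains R where "\<And>\<epsilon> x. 0 < \<epsilon> \<Longrightarrow> \<epsilon> \<le> 1 \<Longrightarrow> norm x > R \<Longrightarrow> S \<epsilon> x = 0 \<and> T \<epsilon> x = 0"
proof -
  obtain R where R: "\<And>y. y \<in> C \<Longrightarrow> norm y \<le> R"
    using compact_imp_bounded[OF compact_C] by (auto simp: bounded_iff)
  have "bump \<epsilon> j x = 0" if \<epsilon>: "0 < \<epsilon>" "\<epsilon> \<le> 1" and x: "norm x > R + 5 * N" and j: "j \<in> J \<epsilon>" for \<epsilon> x j
  proof (rule ccontr)
    assume "bump \<epsilon> j x \<noteq> 0"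
    then have "norm (x - site \<epsilon> j) \<le> 5 * N * \<epsilon>" by (intro active_site bump_active j \<epsilon>)
    moreover have "5 * N * \<epsilon> \<le> 5 * N * 1" using N_ge_1 \<epsilon> by (intro mult_left_mono) auto
    ultimately show False
      using x R[of "site \<epsilon> j"] site[OF j] norm_triangle_sub[of x "site \<epsilon> j"] by auto
  qed
  then show ?thesis by (intro that[of "R + 5 * N"]) (auto simp: S_def T_def)
qed

text \<open>
The sum of \<open>S \<epsilon>\<^sub>0\<close> and of the corrections at the scales \<open>\<epsilon>\<^sub>k = \<epsilon>\<^sub>0 / 2 ^ k\<close>.  Whitney's condition with
error \<open>1\<close> gives convergence in \<open>C\<^sup>p\<close>.  For the estimate with a small error \<open>e\<close> at distance about \<open>\<epsilon>\<^sub>K\<close>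
from \<open>C\<close>, the first \<open>K\<close> corrections telescope and leave \<open>S \<epsilon>\<^sub>K\<close> plus the corrections at finer scales,
to which the condition with error \<open>e\<close> applies.
\<close>

theorem smooth_extension:
  assumes W: "\<And>e. e > 0 \<Longrightarrow> \<exists>\<delta>>0. \<forall>a. 0 < a \<and> a \<le> \<delta> \<longrightarrow> whitney_at e a"
  shows "\<exists>F R. class_C p F \<and> (\<forall>x. norm x > R \<longrightarrow> F x = 0) \<and>
    (\<forall>e>0. \<exists>\<delta>>0. \<forall>y\<in>C. \<forall>x r. norm (x - y) \<le> r \<and> 0 < r \<and> r \<le> \<delta> \<longrightarrow>
       jet_le p (e * r ^ m) r (\<lambda>x. F x - P y x) x)"
proof -
  have mp: "m = Suc p" using m_pos by (simp add: p_def)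
  obtain \<delta>1 where \<delta>1: "\<delta>1 > 0" "\<And>a. 0 < a \<Longrightarrow> a \<le> \<delta>1 \<Longrightarrow> whitney_at 1 a"
    using W[of 1] by auto
  define \<epsilon>0 where "\<epsilon>0 = min 1 (\<delta>1 / (16 * N))"
  define \<epsilon> where "\<epsilon> k = \<epsilon>0 / 2 ^ k" for k :: nat
  have \<epsilon>0: "\<epsilon>0 > 0" "\<epsilon>0 \<le> 1" "16 * N * \<epsilon>0 \<le> \<delta>1"
    using \<delta>1 N_ge_1 by (auto simp: \<epsilon>0_def min_def field_simps)
  have \<epsilon>_Suc: "2 * \<epsilon> (Suc k) = \<epsilon> k" for k by (simp add: \<epsilon>_def)
  have \<epsilon>_add: "\<epsilon> (K + k) = \<epsilon> K / 2 ^ k" for K k by (simp add: \<epsilon>_def power_add)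
  have \<epsilon>_pos: "\<epsilon> k > 0" for k using \<epsilon>0 by (simp add: \<epsilon>_def)
  have \<epsilon>_anti: "\<epsilon> l \<le> \<epsilon> k" if "k \<le> l" for k l
    unfolding \<epsilon>_def using that \<epsilon>0 by (intro divide_left_mono) auto
  have \<epsilon>_le1: "\<epsilon> k \<le> 1" for k using \<epsilon>_anti[of 0 k] \<epsilon>0 unfolding \<epsilon>_def[of 0] by simp
  \<comment> \<open>The term of level K + k + 1 is measured at the scale of level K; one power of
      two survives because the order p of differentiation is below m.\<close>
  have jet_E_rescaled: "jet_le p (Q' * (16 * N) ^ m * e * \<epsilon> K ^ m * (1 / 2) ^ Suc k) (\<epsilon> K) (E (\<epsilon> (K + Suc k))) x"
    if e: "e \<ge> 0" and We: "\<And>a. 0 < a \<Longrightarrow> a \<le> 16 * N * \<epsilon> K \<Longrightarrow> whitney_at e a" for e K k x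
  proof -
    let ?l = "K + Suc k"
    have "16 * N * \<epsilon> ?l \<le> 16 * N * \<epsilon> K" using \<epsilon>_anti[of K ?l] N_ge_1 by (intro mult_left_mono) auto
    then have "whitney_at e (16 * N * \<epsilon> ?l)"
      using \<epsilon>_pos[of ?l] N_ge_1 by (intro We) auto
    from jet_E[OF \<epsilon>_pos e this, of x]
    have "jet_le p (Q' * (e * (16 * N * \<epsilon> ?l) ^ m)) (\<epsilon> K / 2 ^ Suc k) (E (\<epsilon> ?l)) x"
      by (simp only: \<epsilon>_add)
    from jet_le_rescale[OF this _ \<epsilon>_pos]
    have "jet_le p (Q' * (e * (16 * N * \<epsilon> ?l) ^ m) * (2 ^ Suc k) ^ p) (\<epsilon> K) (E (\<epsilon> ?l)) x"
      using one_le_power[of "2::real" "Suc k"] by simp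
    also have "Q' * (e * (16 * N * \<epsilon> ?l) ^ m) * (2 ^ Suc k) ^ p = Q' * (16 * N) ^ m * e * \<epsilon> K ^ m * (1 / 2) ^ Suc k"
    proof -
      have "(2 ^ Suc k) ^ m = (2 ^ Suc k :: real) * (2 ^ Suc k) ^ p"
        using arg_cong[OF mp, of "\<lambda>n. (2 ^ Suc k :: real) ^ n"] by (simp only: power_Suc)
      then have "(2 ^ Suc k :: real) ^ p / (2 ^ Suc k) ^ m = (1 / 2) ^ Suc k"
        by (simp add: power_one_over divide_simps)
      moreover have "(16 * N * \<epsilon> ?l) ^ m = (16 * N) ^ m * (\<epsilon> K ^ m / (2 ^ Suc k) ^ m)"
        unfolding \<epsilon>_add power_mult_distrib[of "16 * N"] power_divide ..
      moreover have "Q' * (e * (a * (b / s))) * t = Q' * a * e * b * (t / s)" for a b s t by simp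
      ultimately show ?thesis by (simp only:)
    qed
    finally show ?thesis .
  qed
  have geom: "(\<lambda>k. c * (1 / 2 :: real) ^ Suc k) sums c" for c
    using sums_mult[OF power_half_series, of c] by simp
  define M where "M k = Q' * (16 * N) ^ m * 1 * \<epsilon> 0 ^ m * (1 / 2) ^ Suc k * (1 / \<epsilon>0) ^ p" for k
  have "summable (\<lambda>k. Q' * (16 * N) ^ m * 1 * \<epsilon> 0 ^ m * (1 / 2) ^ Suc k)" using geom sums_summable by blast
  then have M: "summable M" unfolding M_def[abs_def] by (rule summable_mult2)
  have JM: "jet_le p (M k) 1 (E (\<epsilon> (Suc k))) x" for k x
  proof -
    have "jet_le p (Q' * (16 * N) ^ m * 1 * \<epsilon> 0 ^ m * (1 / 2) ^ Suc k) (\<epsilon> 0) (E (\<epsilon> (0 + Suc k))) x"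
      using \<delta>1 \<epsilon>0 by (intro jet_E_rescaled) (auto simp: \<epsilon>_def)
    then have "jet_le p (Q' * (16 * N) ^ m * 1 * \<epsilon> 0 ^ m * (1 / 2) ^ Suc k) (1 / (1 / \<epsilon>0)) (E (\<epsilon> (Suc k))) x"
      by (simp add: \<epsilon>_def)
    from jet_le_rescale[OF this] show ?thesis using \<epsilon>0 by (simp add: M_def)
  qed
  define G where "G x = (\<Sum>k. E (\<epsilon> (Suc k)) x)" for x
  have G: "class_C p G" and Gs: "\<And>us x. length us \<le> p \<Longrightarrow>
      (\<lambda>k. nth_deriv us (E (\<epsilon> (Suc k))) x) sums nth_deriv us G x"
    using class_C_series[of p "\<lambda>k. E (\<epsilon> (Suc k))" M, OF class_C_E JM M] by (auto simp: G_def[abs_def])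
  define F where "F x = S (\<epsilon> 0) x + G x" for x
  have F: "class_C p F" unfolding F_def[abs_def] by (intro class_C_add class_C_S G)
  obtain R where R: "\<And>\<epsilon> x. 0 < \<epsilon> \<Longrightarrow> \<epsilon> \<le> 1 \<Longrightarrow> norm x > R \<Longrightarrow> S \<epsilon> x = 0 \<and> T \<epsilon> x = 0"
    using support_bound by blast
  have FR: "F x = 0" if "norm x > R" for x
    using R[OF \<epsilon>_pos \<epsilon>_le1 that] by (simp add: F_def G_def E_def)
  have near: "jet_le p ((Q * real (Suc m) * (8 * N) ^ m + Q' * (16 * N) ^ m) * e * \<epsilon> K ^ m) (\<epsilon> K) (\<lambda>x. F x - P y x) x"
    if e: "e \<ge> 0" and We: "\<And>a. 0 < a \<Longrightarrow> a \<le> 16 * N * \<epsilon> K \<Longrightarrow> whitney_at e a"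
      and y: "y \<in> C" "norm (x - y) < 3 * N * \<epsilon> K" for e K y x
  proof -
    define H where "H x = F x - S (\<epsilon> K) x" for x
    have H: "class_C p H" unfolding H_def[abs_def] by (intro class_C_diff F class_C_S)
    have "jet_le p (\<Sum>k. Q' * (16 * N) ^ m * e * \<epsilon> K ^ m * (1 / 2) ^ Suc k) (\<epsilon> K) H x"
    proof (rule jet_le_suminf)
      show "jet_le p (Q' * (16 * N) ^ m * e * \<epsilon> K ^ m * (1 / 2) ^ Suc k) (\<epsilon> K) (E (\<epsilon> (Suc (k + K)))) x" for k
        using jet_E_rescaled[OF e We, of K k x] by (simp add: add.commute)
      show "summable (\<lambda>k. Q' * (16 * N) ^ m * e * \<epsilon> K ^ m * (1 / 2) ^ Suc k)"
        using geom sums_summable by blast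
      fix us :: "(real ^ 'n) list" assume us: "length us \<le> p"
      have c: "class_C (length us) (S \<epsilon>')" "class_C (length us) G" "class_C (length us) F" for \<epsilon>'
        using class_C_le[OF class_C_S us] class_C_le[OF G us] class_C_le[OF F us] by auto
      \<comment> \<open>Near x all cutoffs T up to level K are 1, so the first K terms telescope.\<close>
      have step: "nth_deriv us (E (\<epsilon> (Suc k))) x = nth_deriv us (S (\<epsilon> (Suc k))) x - nth_deriv us (S (\<epsilon> k)) x"
        if k: "k < K" for k
      proof -
        let ?U = "{z. norm (z - y) < 3 * N * \<epsilon> K}"
        have "T (\<epsilon> (Suc k)) z = 1" if "z \<in> ?U" for z
        proof (rule T_eq_1[OF \<epsilon>_pos y(1)])
          have "3 * N * \<epsilon> K \<le> 3 * N * \<epsilon> (Suc k)"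
            using \<epsilon>_anti[of "Suc k" K] k N_ge_1 by (intro mult_left_mono) auto
          with that show "norm (z - y) \<le> 3 * N * \<epsilon> (Suc k)" by simp
        qed
        then have "E (\<epsilon> (Suc k)) z = S (\<epsilon> (Suc k)) z - S (\<epsilon> k) z" if "z \<in> ?U" for z
          using that by (simp add: E_def \<epsilon>_Suc)
        moreover have "open ?U" by (intro open_Collect_less continuous_intros)
        ultimately have "nth_deriv us (E (\<epsilon> (Suc k))) x = nth_deriv us (\<lambda>z. S (\<epsilon> (Suc k)) z - S (\<epsilon> k) z) x"
          using y by (intro nth_deriv_local[of ?U]) auto
        then show ?thesis using nth_deriv_diff[OF c(1) c(1)] by simp
      qed
      have "(\<Sum>k<K. nth_deriv us (E (\<epsilon> (Suc k))) x) = nth_deriv us (S (\<epsilon> K)) x - nth_deriv us (S (\<epsilon> 0)) x"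
        using step sum_lessThan_telescope[of "\<lambda>k. nth_deriv us (S (\<epsilon> k)) x" K] by simp
      moreover have "nth_deriv us H x = nth_deriv us (S (\<epsilon> 0)) x + nth_deriv us G x - nth_deriv us (S (\<epsilon> K)) x"
        unfolding H_def[abs_def] nth_deriv_diff[OF c(3) c(1)]
        unfolding F_def[abs_def] nth_deriv_add[OF c(1) c(2)] by simp
      ultimately have "nth_deriv us H x = nth_deriv us G x - (\<Sum>k<K. nth_deriv us (E (\<epsilon> (Suc k))) x)"
        by linarith
      then show "(\<lambda>k. nth_deriv us (E (\<epsilon> (Suc (k + K)))) x) sums nth_deriv us H x"
        using sums_split_initial_segment[OF Gs[OF us, of x], of K] by simp
    qed
    then have 1: "jet_le p (Q' * (16 * N) ^ m * e * \<epsilon> K ^ m) (\<epsilon> K) H x"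
      using geom[of "Q' * (16 * N) ^ m * e * \<epsilon> K ^ m"] by (simp add: sums_iff)
    have 2: "jet_le p (Q * (real (Suc m) * (e * (8 * N * \<epsilon> K) ^ m))) (\<epsilon> K) (\<lambda>x. S (\<epsilon> K) x - P y x) x"
      using \<epsilon>_pos[of K] N_ge_1 by (intro jet_S_diff[OF \<epsilon>_pos e _ y] We) auto
    have "jet_le p (Q' * (16 * N) ^ m * e * \<epsilon> K ^ m + Q * (real (Suc m) * (e * (8 * N * \<epsilon> K) ^ m))) (\<epsilon> K)
        (\<lambda>x. H x + (S (\<epsilon> K) x - P y x)) x"
      by (intro jet_le_add 1 2 H class_C_diff class_C_S class_C_P y)
    then show ?thesis by (simp add: H_def algebra_simps power_mult_distrib)
  qed
  define B where "B = (Q * real (Suc m) * (8 * N) ^ m + Q' * (16 * N) ^ m) * 2 ^ m + 1"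
  have B: "B > 0" using Q_nonneg Q'_nonneg N_ge_1 by (simp add: B_def add_nonneg_pos)
  have "\<exists>\<delta>>0. \<forall>y\<in>C. \<forall>x r. norm (x - y) \<le> r \<and> 0 < r \<and> r \<le> \<delta> \<longrightarrow>
       jet_le p (e * r ^ m) r (\<lambda>x. F x - P y x) x" if e: "e > 0" for e
  proof -
    obtain d where d: "d > 0" "\<And>a. 0 < a \<Longrightarrow> a \<le> d \<Longrightarrow> whitney_at (e / B) a"
      using W[of "e / B"] e B by auto
    define \<delta> where "\<delta> = min (\<epsilon> 0) (d / (32 * N))"
    show ?thesis
    proof (intro exI[of _ \<delta>] conjI ballI allI impI)
      show "\<delta> > 0" using d \<epsilon>_pos N_ge_1 by (simp add: \<delta>_def)
      fix y x r assume y: "y \<in> C" and r: "norm (x - y) \<le> r \<and> 0 < r \<and> r \<le> \<delta>"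
      have "\<exists>k. \<epsilon> k < r"
      proof -
        obtain k where "(1 / 2) ^ k < r / \<epsilon> 0"
          using real_arch_pow_inv[of "r / \<epsilon> 0" "1 / 2"] r \<epsilon>_pos by auto
        then have "(1 / 2) ^ k * \<epsilon> 0 < r" using \<epsilon>_pos[of 0] by (simp add: pos_less_divide_eq)
        then have "\<epsilon> k < r" by (simp add: \<epsilon>_def power_one_over)
        then show ?thesis ..
      qed
      define l where "l = (LEAST k. \<epsilon> k < r)"
      have l: "\<epsilon> l < r" "\<And>j. j < l \<Longrightarrow> r \<le> \<epsilon> j"
        using LeastI_ex[OF \<open>\<exists>k. \<epsilon> k < r\<close>] not_less_Least[of _ "\<lambda>k. \<epsilon> k < r"]
        unfolding l_def by (blast intro: leI)+
      have "r \<le> \<epsilon> 0" using r by (simp add: \<delta>_def)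
      then obtain K where K: "l = Suc K" using l(1) by (cases l) auto
      have rK: "\<epsilon> K < 2 * r" "r \<le> \<epsilon> K" using l K \<epsilon>_Suc[of K] by auto
      show "jet_le p (e * r ^ m) r (\<lambda>x. F x - P y x) x"
      proof -
        define c where "c = Q * real (Suc m) * (8 * N) ^ m + Q' * (16 * N) ^ m"
        have c: "c \<ge> 0" using Q_nonneg Q'_nonneg N_ge_1 by (simp add: c_def)
        have "16 * N * \<epsilon> K \<le> 16 * N * (2 * r)" using rK N_ge_1 by (intro mult_left_mono) auto
        also have "\<dots> \<le> d" using r N_ge_1 by (simp add: \<delta>_def field_simps)
        finally have "16 * N * \<epsilon> K \<le> d" .
        moreover have "1 * \<epsilon> K \<le> N * \<epsilon> K" using N_ge_1 \<epsilon>_pos[of K] by (intro mult_right_mono) auto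
        then have "norm (x - y) < 3 * N * \<epsilon> K" using r rK(2) \<epsilon>_pos[of K] unfolding mult.assoc by linarith
        ultimately have "jet_le p (c * (e / B) * \<epsilon> K ^ m) (\<epsilon> K) (\<lambda>x. F x - P y x) x"
          unfolding c_def using e B d(2) by (intro near y) auto
        then show ?thesis
        proof (rule jet_le_mono)
          have "c * (e / B) * \<epsilon> K ^ m \<le> c * (e / B) * (2 * r) ^ m"
            using c e B rK \<epsilon>_pos[of K] by (intro mult_left_mono power_mono) auto
          also have "\<dots> = (c * 2 ^ m / B) * (e * r ^ m)" by (simp add: power_mult_distrib)
          also have "\<dots> \<le> 1 * (e * r ^ m)"
            using B e r by (intro mult_right_mono) (auto simp: B_def c_def)
          finally show "c * (e / B) * \<epsilon> K ^ m \<le> e * r ^ m" by simp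
        qed (use r rK in auto)
      qed
    qed
  qed
  then show ?thesis using F FR by blast
qed

end

section \<open>Convex barriers\<close>

lemma compose_second_deriv:
  assumes h: "class_C 2 h" and g: "class_C 2 g"
  shows "nth_deriv [v, v] (\<lambda>x. h (g x)) x =
    nth_deriv [1, 1] h (g x) * (dd v g x)\<^sup>2 + nth_deriv [1] h (g x) * nth_deriv [v, v] g x"
proof -
  have d: "\<And>t. h differentiable (at t)" "\<And>x. g differentiable (at x)"
    "\<And>t. dd 1 h differentiable (at t)" "\<And>x. dd v g differentiable (at x)"
    using h g by (auto simp: numeral_2_eq_2 class_C_Suc)
  have "(\<lambda>x. dd 1 h (g x)) differentiable (at x)" for x
    using differentiable_chain_at[OF d(2) d(3), of x] by (simp add: o_def)
  then show ?thesis
    by (simp add: nth_deriv_Cons dd_comp[OF d(1,2)] dd_mult[OF _ d(4)] dd_comp[OF d(3,2)] power2_eq_square)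
qed

text \<open>
By induction, \<open>dd u (h \<circ> g)\<close> is the product of \<open>h' \<circ> g\<close>, which is flat at \<open>y\<close>, and a function with
bounded jet.
\<close>

lemma compose_flat:
  assumes "class_C k h" "class_C k g" "\<And>i. i \<le> k \<Longrightarrow> nth_deriv (replicate i (1::real)) h (g y) = 0"
  shows "jet_le k 0 1 (\<lambda>x. h (g x)) y"
  using assms
proof (induction k arbitrary: h)
  case 0
  from "0.prems"(3)[of 0] show ?case by (simp add: jet_le_0)
next
  case (Suc k)
  have h0: "h (g y) = 0" using Suc.prems(3)[of 0] by simp
  have "jet_le k 0 1 (dd u (\<lambda>x. h (g x))) y" for u
  proof -
    have d: "class_C k (dd 1 h)" "class_C k g" "class_C k (dd u g)"
      using Suc.prems by (auto simp: class_C_Suc intro: class_C_SucD)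
    have J: "jet_le k 0 1 (\<lambda>x. dd 1 h (g x)) y"
    proof (rule Suc.IH[OF d(1,2)])
      show "nth_deriv (replicate i 1) (dd 1 h) (g y) = 0" if "i \<le> k" for i
        using Suc.prems(3)[of "Suc i"] nth_deriv_snoc[of "replicate i 1" 1 h] that
        by (simp add: replicate_append_same)
    qed
    obtain B where "jet_le k B 1 (dd u g) y"
      using jet_le_exists_on_compact[of "{y}" k "dd u g"] d by auto
    from jet_le_mult[OF J this class_C_compose[OF d(1,2)] d(3)]
    have "jet_le k 0 1 (\<lambda>x. dd 1 h (g x) * dd u g x) y" by simp
    moreover have "dd u (\<lambda>x. h (g x)) = (\<lambda>x. dd 1 h (g x) * dd u g x)"
      using Suc.prems by (intro dd_comp) (auto simp: class_C_Suc)
    ultimately show ?thesis by simp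
  qed
  with h0 show ?case by (simp add: jet_le_Suc)
qed

lemma jet_le_0_nth_deriv: "jet_le k 0 \<epsilon> f y \<Longrightarrow> length us \<le> k \<Longrightarrow> nth_deriv us f y = 0"
  using jet_leD by fastforce

text \<open>
A convex function that is flat on \<open>C\<close> and whose second derivative dominates the given power of the
distance to \<open>C\<close> in the ball of radius \<open>R\<close>.  Outside this ball convexity is all that is asked.
\<close>

definition convex_barrier :: "nat \<Rightarrow> 'a::euclidean_space set \<Rightarrow> (real \<Rightarrow> real) \<Rightarrow> real \<Rightarrow> ('a \<Rightarrow> real) \<Rightarrow> bool" where
  "convex_barrier p C \<omega> R H \<longleftrightarrow> class_C p H \<and> (\<forall>y\<in>C. jet_le p 0 1 H y) \<and>
     (\<forall>x v. norm v = 1 \<longrightarrow> 0 \<le> nth_deriv [v, v] H x) \<and>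
     (\<forall>x v. norm v = 1 \<and> norm x \<le> R \<longrightarrow> infdist x C ^ (p - 1) * \<omega> (infdist x C) \<le> nth_deriv [v, v] H x)"

lemma flat_modulus_dilate: "flat_modulus \<omega> \<Longrightarrow> 0 \<le> a \<Longrightarrow> 0 \<le> b \<Longrightarrow> flat_modulus (\<lambda>t. a * \<omega> (b * t))"
  unfolding flat_modulus_def mono_def
  by (auto simp: mult_left_mono mult_nonneg_nonpos intro!: continuous_intros mult_left_mono[of "\<omega> _"]
      intro: continuous_on_compose2)

lemma jet_le_sum_flat:
  assumes "finite I" "\<And>i. i \<in> I \<Longrightarrow> jet_le k 0 \<epsilon> (f i) x" "\<And>i. i \<in> I \<Longrightarrow> class_C k (f i)"
  shows "jet_le k 0 \<epsilon> (\<lambda>x. \<Sum>i\<in>I. f i x) x"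
  using jet_le_sum[OF assms(1), of k "\<lambda>_. 0" \<epsilon> f x] assms by simp

text \<open>
Move from \<open>x\<close> towards the Slater point \<open>x0\<close>.  If \<open>s\<close> is the largest violation \<open>\<psi>\<^sub>i x - 1\<close> and \<open>\<eta>\<close> the
least slack \<open>1 - \<psi>\<^sub>i x0\<close>, then by convexity all constraints hold after the fraction \<open>s / (s + \<eta>)\<close> of
the way.
\<close>

lemma ovaloid_intersection_regular:
  fixes \<psi> :: "'i \<Rightarrow> 'a::euclidean_space \<Rightarrow> real"
  assumes fin: "finite I" and I: "I \<noteq> {}"
    and cvx: "\<And>i. i \<in> I \<Longrightarrow> convex_on UNIV (\<psi> i)"
    and C: "C = {x. \<forall>i\<in>I. \<psi> i x \<le> 1}"
    and x0: "\<And>i. i \<in> I \<Longrightarrow> \<psi> i x0 < 1"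
  shows "\<exists>L>0. \<forall>x. norm x \<le> R \<longrightarrow> x \<notin> C \<longrightarrow> (\<exists>i\<in>I. 1 < \<psi> i x \<and> infdist x C \<le> L * (\<psi> i x - 1))"
proof -
  define \<eta> where "\<eta> = Min ((\<lambda>i. 1 - \<psi> i x0) ` I)"
  have \<eta>: "\<eta> > 0" using fin I x0 by (simp add: \<eta>_def)
  have \<eta>': "\<psi> i x0 \<le> 1 - \<eta>" if "i \<in> I" for i
  proof -
    have "\<eta> \<le> 1 - \<psi> i x0" using fin that by (simp add: \<eta>_def)
    then show ?thesis by simp
  qed
  define L where "L = (\<bar>R\<bar> + norm x0 + 1) / \<eta>"
  have "\<exists>i\<in>I. 1 < \<psi> i x \<and> infdist x C \<le> L * (\<psi> i x - 1)" if x: "norm x \<le> R" "x \<notin> C" for x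
  proof -
    define s where "s = Max ((\<lambda>i. \<psi> i x - 1) ` I)"
    have "s \<in> (\<lambda>i. \<psi> i x - 1) ` I" unfolding s_def using fin I by (intro Max_in) auto
    then obtain i where i: "i \<in> I" "s = \<psi> i x - 1" by blast
    have s_max: "\<psi> j x \<le> 1 + s" if "j \<in> I" for j
    proof -
      have "\<psi> j x - 1 \<le> s" unfolding s_def using fin that by (intro Max_ge) auto
      then show ?thesis by simp
    qed
    have s: "s > 0"
    proof (rule ccontr)
      assume "\<not> s > 0"
      then have "x \<in> C" unfolding C using s_max by force
      with x show False by simp
    qed
    define l where "l = s / (s + \<eta>)"
    have l: "0 \<le> l" "l \<le> 1" "l \<le> s / \<eta>"
      using s \<eta> by (auto simp: l_def intro!: divide_left_mono)
    define y where "y = (1 - l) *\<^sub>R x + l *\<^sub>R x0"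
    have "y \<in> C" unfolding C
    proof (intro CollectI ballI)
      fix j assume j: "j \<in> I"
      have "\<psi> j y \<le> (1 - l) * \<psi> j x + l * \<psi> j x0"
        unfolding y_def using l by (intro convex_onD[OF cvx[OF j]]) auto
      also have "\<dots> \<le> (1 - l) * (1 + s) + l * (1 - \<eta>)"
        using l s_max[OF j] \<eta>'[OF j] by (intro add_mono mult_left_mono) auto
      also have "\<dots> = 1 + s - l * (s + \<eta>)" by (simp add: algebra_simps)
      also have "\<dots> = 1" using s \<eta> by (simp add: l_def)
      finally show "\<psi> j y \<le> 1" .
    qed
    then have "infdist x C \<le> dist x y" by (rule infdist_le)
    also have "\<dots> = norm (l *\<^sub>R (x - x0))" by (simp add: dist_norm y_def algebra_simps)
    also have "\<dots> = l * norm (x - x0)" using l by simp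
    also have "\<dots> \<le> (s / \<eta>) * (\<bar>R\<bar> + norm x0 + 1)"
      using l x s \<eta> norm_triangle_ineq4[of x x0] by (intro mult_mono) auto
    also have "\<dots> = L * s" by (simp add: L_def)
    finally show ?thesis using i s by auto
  qed
  moreover have "L > 0" using \<eta> by (auto simp: L_def intro!: divide_pos_pos add_nonneg_pos)
  ultimately show ?thesis by blast
qed

text \<open>
In tangential directions the second derivative of \<open>h(\<psi>\<^sub>i - 1)\<close> is only \<open>h'(\<psi>\<^sub>i - 1) D\<^sup>2\<psi>\<^sub>i\<close>, so the
lower bound has to come from \<open>h'\<close>, that is, from the term \<open>i = 1\<close> in
\<open>flat_function_above_modulus\<close>; the violation of some constraint is at least \<open>infdist x C / L\<close>.
\<close>

lemma convex_barrier_ovaloids: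
  fixes \<psi> :: "'i \<Rightarrow> 'a::euclidean_space \<Rightarrow> real"
  assumes fin: "finite I" and I: "I \<noteq> {}" and p: "p \<ge> 2" and \<omega>: "flat_modulus \<omega>"
    and M: "\<And>i. i \<in> I \<Longrightarrow> M i > 0" and \<psi>: "\<And>i. i \<in> I \<Longrightarrow> class_C p (\<psi> i)"
    and D: "\<And>i x v. i \<in> I \<Longrightarrow> norm v = 1 \<Longrightarrow> nth_deriv [v, v] (\<psi> i) x \<ge> M i"
    and C: "C = {x. \<forall>i\<in>I. \<psi> i x \<le> 1}"
    and x0: "\<And>i. i \<in> I \<Longrightarrow> \<psi> i x0 < 1"
  shows "\<exists>H. convex_barrier p C \<omega> R H"
proof -
  have \<psi>2: "class_C 2 (\<psi> i)" if "i \<in> I" for i using class_C_le[OF \<psi>[OF that] p] .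
  have "convex_on UNIV (\<psi> i)" if "i \<in> I" for i
    using convex_on_UNIV_second_deriv[OF \<psi>2[OF that]] D[OF that] M[OF that]
    by (meson less_imp_le order_trans)
  then obtain L where L: "L > 0"
    "\<And>x. norm x \<le> R \<Longrightarrow> x \<notin> C \<Longrightarrow> \<exists>i\<in>I. 1 < \<psi> i x \<and> infdist x C \<le> L * (\<psi> i x - 1)"
    using ovaloid_intersection_regular[OF fin I _ C x0, of R] by blast
  define \<mu> where "\<mu> = Min (M ` I)"
  have \<mu>: "\<mu> > 0" "\<And>i. i \<in> I \<Longrightarrow> \<mu> \<le> M i" using fin I M by (auto simp: \<mu>_def)
  define \<omega>' where "\<omega>' t = (L ^ (p - 1) / \<mu>) * \<omega> (L * t)" for t
  have "flat_modulus \<omega>'" unfolding \<omega>'_def[abs_def] using \<omega> L \<mu> by (intro flat_modulus_dilate) auto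
  then obtain h where h: "class_C p h" "\<And>i. i \<le> p \<Longrightarrow> flat_modulus (nth_deriv (replicate i 1) h)"
    "\<And>i s. i \<le> p \<Longrightarrow> s > 0 \<Longrightarrow> s ^ (p - i) * \<omega>' s \<le> nth_deriv (replicate i 1) h s"
    using flat_function_above_modulus[of \<omega>' p] by blast
  have h1: "flat_modulus (nth_deriv [1] h)" "flat_modulus (nth_deriv [1, 1] h)"
    "\<And>s. s > 0 \<Longrightarrow> s ^ (p - 1) * \<omega>' s \<le> nth_deriv [1] h s"
    using h(2)[of 1] h(2)[of 2] h(3)[of 1] p by (auto simp: numeral_2_eq_2)
  define f where "f i x = h (\<psi> i x - 1)" for i x
  have g: "class_C p (\<lambda>x. \<psi> i x - 1)" if "i \<in> I" for i using that by (intro class_C_diff \<psi> class_C_const)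
  have fC: "class_C p (f i)" if "i \<in> I" for i
    unfolding f_def[abs_def] by (intro class_C_compose[OF h(1) g] that)
  have Df: "nth_deriv [v, v] (f i) x \<ge> nth_deriv [1] h (\<psi> i x - 1) * \<mu>" if i: "i \<in> I" and v: "norm v = 1" for i x v
  proof -
    have "nth_deriv [v, v] (\<lambda>x. \<psi> i x - 1) x = nth_deriv [v, v] (\<psi> i) x"
      using nth_deriv_diff[of "[v, v]" "\<psi> i" "\<lambda>_. 1"] \<psi>2[OF i] by (simp add: class_C_const nth_deriv_const numeral_2_eq_2)
    moreover have "nth_deriv [v, v] (\<psi> i) x \<ge> \<mu>" using D[OF i v] \<mu>(2)[OF i] by (meson order_trans)
    ultimately show ?thesis
      unfolding f_def[abs_def]
      using compose_second_deriv[OF class_C_le[OF h(1) p] class_C_le[OF g[OF i] p], of v x]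
        flat_modulus_nonneg[OF h1(1)] flat_modulus_nonneg[OF h1(2)]
      by (auto intro!: add_increasing mult_left_mono)
  qed
  have Df0: "nth_deriv [v, v] (f i) x \<ge> 0" if "i \<in> I" "norm v = 1" for i x v
    using Df[OF that, of x] flat_modulus_nonneg[OF h1(1), of "\<psi> i x - 1"] \<mu>(1)
    by (meson less_imp_le mult_nonneg_nonneg order_trans)
  define H where "H x = (\<Sum>i\<in>I. f i x)" for x
  have DH: "nth_deriv [v, v] H x = (\<Sum>i\<in>I. nth_deriv [v, v] (f i) x)" for v x
    unfolding H_def[abs_def] using nth_deriv_sum[of I "[v, v]" f] class_C_le[OF fC p]
    by (simp add: numeral_2_eq_2)
  have "convex_barrier p C \<omega> R H"
    unfolding convex_barrier_def
  proof (intro conjI allI impI ballI)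
    show "class_C p H" unfolding H_def[abs_def] by (intro class_C_sum fC)
    show "jet_le p 0 1 H y" if y: "y \<in> C" for y
      unfolding H_def[abs_def]
    proof (intro jet_le_sum_flat fin fC)
      fix i assume i: "i \<in> I"
      then have "\<psi> i y - 1 \<le> 0" using y C by auto
      then show "jet_le p 0 1 (f i) y"
        unfolding f_def[abs_def] using h(2) i
        by (intro compose_flat h(1) g) (auto simp: flat_modulus_def)
    qed
    fix x v :: 'a
    show "0 \<le> nth_deriv [v, v] H x" if "norm v = 1"
      unfolding DH using Df0 that by (intro sum_nonneg) auto
    assume a: "norm v = 1 \<and> norm x \<le> R"
    let ?d = "infdist x C"
    show "?d ^ (p - 1) * \<omega> ?d \<le> nth_deriv [v, v] H x"
    proof (cases "?d = 0")
      case True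
      then have "?d ^ (p - 1) * \<omega> ?d = 0" using \<omega> by (simp add: flat_modulus_def)
      then show ?thesis unfolding DH using Df0 a by (simp only: sum_nonneg)
    next
      case False
      then have d: "?d > 0" using infdist_nonneg[of x C] by simp
      then have "x \<notin> C" by auto
      then obtain i where i: "i \<in> I" "1 < \<psi> i x" "?d \<le> L * (\<psi> i x - 1)" using L(2) a by blast
      have "?d ^ (p - 1) * \<omega> ?d = (?d / L) ^ (p - 1) * \<omega>' (?d / L) * \<mu>"
        using L \<mu> by (simp add: \<omega>'_def power_divide)
      also have "\<dots> \<le> nth_deriv [1] h (?d / L) * \<mu>"
        using h1(3)[of "?d / L"] d L \<mu> by (intro mult_right_mono) auto
      also have "\<dots> \<le> nth_deriv [1] h (\<psi> i x - 1) * \<mu>"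
        using h1(1) i L \<mu> by (intro mult_right_mono) (auto simp: flat_modulus_def mono_def field_simps)
      also have "\<dots> \<le> nth_deriv [v, v] (f i) x" using Df i a by blast
      also have "\<dots> \<le> nth_deriv [v, v] H x"
        unfolding DH using Df0 a i fin by (intro member_le_sum) auto
      finally show ?thesis .
    qed
  qed
  then show ?thesis by blast
qed

lemma exists_large_component: "\<exists>i. norm (z :: real ^ 'n::finite) \<le> real CARD('n) * \<bar>z $ i\<bar>"
proof (rule ccontr)
  assume "\<not> ?thesis"
  then have l: "\<And>i. real CARD('n) * \<bar>z $ i\<bar> < norm z" by (simp add: not_le)
  have "real CARD('n) * (\<Sum>i\<in>UNIV. \<bar>z $ i\<bar>) < (\<Sum>i\<in>(UNIV :: 'n set). norm z)"
    unfolding sum_distrib_left using l by (intro sum_strict_mono) auto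
  also have "\<dots> = real CARD('n) * norm z" by simp
  finally have "(\<Sum>i\<in>UNIV. \<bar>z $ i\<bar>) < norm z" by simp
  with norm_le_l1_cart[of z] show False by simp
qed

text \<open>
Let \<open>z\<close> be large in coordinate \<open>i\<close> and \<open>v\<close> in coordinate \<open>j\<close>.  Unless one of the coordinates \<open>i\<close>, \<open>j\<close>
is good for both vectors, \<open>z\<^sub>j\<close> and \<open>v\<^sub>i\<close> are too small to cancel \<open>z\<^sub>i\<close> and \<open>v\<^sub>j\<close>.
\<close>

lemma direction_seeing_both:
  fixes z v :: "real ^ 'n::finite"
  assumes N: "N = real CARD('n)"
  shows "\<exists>i j. norm z \<le> 4 * N * \<bar>z $ i + z $ j\<bar> \<and> norm v \<le> 4 * N * \<bar>v $ i + v $ j\<bar>"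
proof -
  have N0: "N > 0" using N by simp
  obtain i where i: "norm z \<le> N * \<bar>z $ i\<bar>" using exists_large_component[of z] N by blast
  obtain j where j: "norm v \<le> N * \<bar>v $ j\<bar>" using exists_large_component[of v] N by blast
  have lift: "norm w \<le> 4 * N * b" if "norm w \<le> N * a" "a \<le> 4 * b" for a b and w :: "real ^ 'n"
  proof -
    have "N * a \<le> N * (4 * b)" using that N0 by (intro mult_left_mono) auto
    with that show ?thesis by simp
  qed
  consider "\<bar>v $ j\<bar> \<le> 4 * \<bar>v $ i\<bar>" | "\<bar>z $ i\<bar> \<le> 4 * \<bar>z $ j\<bar>" | "4 * \<bar>v $ i\<bar> < \<bar>v $ j\<bar>" "4 * \<bar>z $ j\<bar> < \<bar>z $ i\<bar>"
    by linarith
  then show ?thesis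
  proof cases
    case 1
    then show ?thesis by (intro exI[of _ i] conjI lift[OF i] lift[OF j]) (auto simp: abs_if split: if_splits)
  next
    case 2
    then show ?thesis by (intro exI[of _ j] conjI lift[OF i] lift[OF j]) (auto simp: abs_if split: if_splits)
  next
    case 3
    then show ?thesis
      by (intro exI[of _ i] exI[of _ j] conjI lift[OF i] lift[OF j]) (auto simp: abs_if split: if_splits)
  qed
qed

text \<open>
Here a sublevel function \<open>\<psi>\<close> grows only quadratically at the point, too slowly for \<open>h(\<psi> - 1)\<close>.  Instead
\<open>H\<close> sums \<open>h(\<plusminus>(e\<^sub>i + e\<^sub>j) \<bullet> (x - c))\<close> over all \<open>i\<close>, \<open>j\<close> and signs.  For given \<open>x - c\<close> and \<open>v\<close> one of these
linear forms is comparable to the norm on both vectors, and the bound comes from \<open>h''\<close>.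
\<close>

lemma convex_barrier_singleton:
  fixes c :: "real ^ 'n::finite"
  assumes p: "p \<ge> 2" and \<omega>: "flat_modulus \<omega>"
  shows "\<exists>H. convex_barrier p {c} \<omega> R H"
proof -
  define \<kappa> where "\<kappa> = 1 / (4 * real CARD('n))"
  have \<kappa>: "\<kappa> > 0" by (simp add: \<kappa>_def)
  define R' where "R' = \<bar>R\<bar> + norm c"
  define \<omega>' where "\<omega>' t = (R' / \<kappa> ^ p) * \<omega> ((1 / \<kappa>) * t)" for t
  have "flat_modulus \<omega>'" unfolding \<omega>'_def[abs_def] using \<omega> \<kappa> by (intro flat_modulus_dilate) (auto simp: R'_def)
  then obtain h where h: "class_C p h" "\<And>i. i \<le> p \<Longrightarrow> flat_modulus (nth_deriv (replicate i 1) h)"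
    "\<And>i s. i \<le> p \<Longrightarrow> s > 0 \<Longrightarrow> s ^ (p - i) * \<omega>' s \<le> nth_deriv (replicate i 1) h s"
    using flat_function_above_modulus[of \<omega>' p] by blast
  have h2: "flat_modulus (nth_deriv [1, 1] h)" "\<And>s. s > 0 \<Longrightarrow> s ^ (p - 2) * \<omega>' s \<le> nth_deriv [1, 1] h s"
    using h(2)[of 2] h(3)[of 2] p by (auto simp: numeral_2_eq_2)
  define a :: "'n \<times> 'n \<times> real \<Rightarrow> real ^ 'n" where
    "a = (\<lambda>(i, j, \<sigma>). \<sigma> *\<^sub>R (axis i 1 + axis j 1))"
  define I where "I = (UNIV :: 'n set) \<times> (UNIV :: 'n set) \<times> {1, -1 :: real}"
  have fin: "finite I" by (simp add: I_def)
  have a_inner: "a (i, j, \<sigma>) \<bullet> x = \<sigma> * (x $ i + x $ j)" for i j \<sigma> x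
    by (simp add: a_def inner_add_left inner_axis')
  define f where "f \<alpha> x = h (a \<alpha> \<bullet> x - a \<alpha> \<bullet> c)" for \<alpha> x
  have g: "class_C k (\<lambda>x. a \<alpha> \<bullet> x - a \<alpha> \<bullet> c)" for \<alpha> k by (intro class_C_diff class_C_inner class_C_const)
  have fC: "class_C p (f \<alpha>)" for \<alpha> unfolding f_def[abs_def] by (rule class_C_compose[OF h(1) g])
  have Df: "nth_deriv [v, v] (f \<alpha>) x = nth_deriv [1, 1] h (a \<alpha> \<bullet> (x - c)) * (a \<alpha> \<bullet> v)\<^sup>2" for \<alpha> v x
  proof -
    have "((\<lambda>x. a \<alpha> \<bullet> x - a \<alpha> \<bullet> c) has_derivative (\<lambda>x. a \<alpha> \<bullet> x)) (at x)" for x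
      by (auto intro!: derivative_eq_intros)
    then have "dd v (\<lambda>x. a \<alpha> \<bullet> x - a \<alpha> \<bullet> c) = (\<lambda>x. a \<alpha> \<bullet> v)" using dd_eq by blast
    then show ?thesis
      unfolding f_def[abs_def] using compose_second_deriv[OF class_C_le[OF h(1) p] g, of v \<alpha> x]
      by (simp add: nth_deriv_Cons dd_const inner_diff_right)
  qed
  have Df0: "nth_deriv [v, v] (f \<alpha>) x \<ge> 0" for v \<alpha> x
    unfolding Df using flat_modulus_nonneg[OF h2(1)] by simp
  define H where "H x = (\<Sum>\<alpha>\<in>I. f \<alpha> x)" for x
  have DH: "nth_deriv [v, v] H x = (\<Sum>\<alpha>\<in>I. nth_deriv [v, v] (f \<alpha>) x)" for v x
    unfolding H_def[abs_def] using nth_deriv_sum[of I "[v, v]" f] class_C_le[OF fC p]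
    by (simp add: numeral_2_eq_2)
  have "convex_barrier p {c} \<omega> R H"
    unfolding convex_barrier_def
  proof (intro conjI allI impI ballI)
    show "class_C p H" unfolding H_def[abs_def] by (intro class_C_sum fC)
    show "jet_le p 0 1 H y" if y: "y \<in> {c}" for y
      unfolding H_def[abs_def]
    proof (intro jet_le_sum_flat fin fC)
      show "jet_le p 0 1 (f \<alpha>) y" for \<alpha>
        unfolding f_def[abs_def] using h(2) y
        by (intro compose_flat h(1) g) (auto simp: flat_modulus_def)
    qed
    fix x v :: "real ^ 'n"
    show "0 \<le> nth_deriv [v, v] H x" unfolding DH using Df0 by (intro sum_nonneg) auto
    assume A: "norm v = 1 \<and> norm x \<le> R"
    define d where "d = infdist x {c}"
    have d: "d = norm (x - c)" by (simp add: d_def infdist_singleton dist_norm)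
    have "d ^ (p - 1) * \<omega> d \<le> nth_deriv [v, v] H x"
    proof (cases "d = 0")
      case True
      then have "d ^ (p - 1) * \<omega> d = 0" using \<omega> by (simp add: flat_modulus_def)
      then show ?thesis unfolding DH using Df0 by (simp only: sum_nonneg)
    next
      case False
      then have d0: "d > 0" by (simp add: d)
      have dR: "d \<le> R'" using norm_triangle_ineq4[of x c] A unfolding d R'_def by linarith
      obtain i j where ij: "d \<le> 4 * real CARD('n) * \<bar>(x - c) $ i + (x - c) $ j\<bar>"
        "1 \<le> 4 * real CARD('n) * \<bar>v $ i + v $ j\<bar>"
        using direction_seeing_both[OF refl, of "x - c" v] A d by auto
      then have ij: "\<kappa> * d \<le> \<bar>(x - c) $ i + (x - c) $ j\<bar>" "\<kappa> \<le> \<bar>v $ i + v $ j\<bar>"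
        by (auto simp: \<kappa>_def field_simps)
      define \<sigma> :: real where "\<sigma> = (if (x - c) $ i + (x - c) $ j \<ge> 0 then 1 else -1)"
      define \<alpha> where "\<alpha> = (i, j, \<sigma>)"
      have \<alpha>: "\<alpha> \<in> I" by (auto simp: \<alpha>_def I_def \<sigma>_def)
      have 1: "\<kappa> * d \<le> a \<alpha> \<bullet> (x - c)"
        using ij(1) by (simp add: \<alpha>_def a_inner \<sigma>_def abs_if split: if_splits)
      have 2: "\<kappa>\<^sup>2 \<le> (a \<alpha> \<bullet> v)\<^sup>2"
        using power_mono[OF ij(2), of 2] \<kappa> by (simp add: \<alpha>_def a_inner \<sigma>_def power_mult_distrib)
      have pe: "p - 1 = Suc (p - 2)" using p by auto
      have "d ^ (p - 1) * \<omega> d = d * (d ^ (p - 2) * \<omega> d)" by (simp only: pe power_Suc mult.assoc)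
      also have "\<dots> \<le> R' * (d ^ (p - 2) * \<omega> d)"
        using dR d0 flat_modulus_nonneg[OF \<omega>] by (intro mult_right_mono) auto
      also have "\<dots> = (\<kappa> * d) ^ (p - 2) * \<omega>' (\<kappa> * d) * \<kappa>\<^sup>2"
      proof -
        have "\<kappa> ^ p = \<kappa> ^ (p - 2) * \<kappa>\<^sup>2" using p by (metis le_add_diff_inverse2 power_add)
        then show ?thesis using \<kappa> by (simp add: \<omega>'_def power_mult_distrib)
      qed
      also have "\<dots> \<le> nth_deriv [1, 1] h (\<kappa> * d) * \<kappa>\<^sup>2"
        using h2(2)[of "\<kappa> * d"] \<kappa> d0 by (intro mult_right_mono) auto
      also have "\<dots> \<le> nth_deriv [1, 1] h (a \<alpha> \<bullet> (x - c)) * (a \<alpha> \<bullet> v)\<^sup>2"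
        using h2(1) 1 2 flat_modulus_nonneg[OF h2(1)]
        by (intro mult_mono) (auto simp: flat_modulus_def mono_def)
      also have "\<dots> = nth_deriv [v, v] (f \<alpha>) x" by (simp add: Df)
      also have "\<dots> \<le> nth_deriv [v, v] H x"
        unfolding DH using Df0 \<alpha> fin by (intro member_le_sum) auto
      finally show ?thesis .
    qed
    then show "infdist x {c} ^ (p - 1) * \<omega> (infdist x {c}) \<le> nth_deriv [v, v] H x" by (simp add: d_def)
  qed
  then show ?thesis by blast
qed

section \<open>Convex extension from a compact set\<close>

lemma whitney_extension:
  fixes C :: "(real ^ 'n::finite) set"
  assumes C: "compact C" and m: "m \<ge> 1"
    and P: "\<And>y. y \<in> C \<Longrightarrow> poly_lt (Suc m) (P y)" and W: "cond_W m P C"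
  shows "\<exists>F R. class_C (m - 1) F \<and> (\<forall>x. norm x > R \<longrightarrow> F x = 0) \<and>
    (\<forall>e>0. \<exists>\<delta>>0. \<forall>y\<in>C. \<forall>x r. norm (x - y) \<le> r \<and> 0 < r \<and> r \<le> \<delta> \<longrightarrow>
       jet_le (m - 1) (e * r ^ m) r (\<lambda>x. F x - P y x) x)"
proof -
  obtain \<phi> :: "real ^ 'n \<Rightarrow> real" where \<phi>: "class_C (m - 1) \<phi>" "\<And>x i. \<phi> x \<noteq> 0 \<Longrightarrow> \<bar>x $ i\<bar> < 1"
    "\<And>x. (\<Sum>j\<in>nearby x. \<phi> (x - lattice_vec j)) = 1"
    using lattice_partition[of "m - 1"] by metis
  define K :: "(real ^ 'n) set" where "K = cbox (\<chi> i. -1) (\<chi> i. 1)"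
  have "compact K" by (simp add: K_def compact_cbox)
  from jet_le_exists_on_compact[OF this \<phi>(1)] obtain A
    where A: "\<And>x. x \<in> K \<Longrightarrow> jet_le (m - 1) A 1 \<phi> x" by blast
  have "0 \<in> K" by (simp add: K_def mem_box_cart)
  from jet_leD[OF A[OF this], of "[]"] have A0: "A \<ge> 0" by simp
  have J: "jet_le (m - 1) A 1 \<phi> x" for x
  proof (cases "x \<in> K")
    case False
    have "\<phi> z = 0" if "z \<in> - K" for z
    proof (rule ccontr)
      assume "\<phi> z \<noteq> 0"
      then have "\<bar>z $ i\<bar> < 1" for i by (rule \<phi>(2))
      then have "-1 \<le> z $ i \<and> z $ i \<le> 1" for i by (smt (verit))
      then have "z \<in> K" by (simp add: K_def mem_box_cart)
      with that show False by simp
    qed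
    moreover have "open (- K)" by (simp add: K_def open_Compl closed_cbox)
    ultimately have "jet_le (m - 1) A 1 \<phi> x = jet_le (m - 1) A 1 (\<lambda>x. 0) x"
      using False by (intro jet_le_local[of "- K"]) auto
    moreover have "jet_le (m - 1) A 1 (\<lambda>x. 0) x"
      unfolding jet_le_def nth_deriv_zero abs_zero
      by (intro allI impI mult_nonneg_nonneg A0 prod_list_norm_nonneg) simp
    ultimately show ?thesis by simp
  qed (rule A)
  interpret whitney_field C P m \<phi> A
    by unfold_locales (use C m P \<phi> J in auto)
  have "\<exists>\<delta>>0. \<forall>a. 0 < a \<and> a \<le> \<delta> \<longrightarrow> whitney_at e a" if "e > 0" for e
    using cond_W_jet[OF W C _ P that] unfolding whitney_at_def by (metis order_refl)
  from smooth_extension[OF this] show ?thesis unfolding p_def by simp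
qed

text \<open>
For \<open>r \<le> 1\<close> the bound on a derivative of order at most \<open>p < m\<close> of \<open>F - Q\<close> at \<open>y\<close> is \<open>O(e)\<close>; let \<open>e\<close>
tend to \<open>0\<close>.
\<close>

lemma extension_jet_on_C:
  assumes J: "\<And>e. e > 0 \<Longrightarrow> \<exists>\<delta>>0. \<forall>r. 0 < r \<and> r \<le> \<delta> \<longrightarrow> jet_le p (e * r ^ m) r (\<lambda>x. F x - Q x) y"
    and pm: "p < m" and c: "class_C p F" "class_C p Q" and us: "length us \<le> p"
  shows "nth_deriv us F y = nth_deriv us Q y"
proof -
  define w where "w = (\<Prod>u\<leftarrow>us. norm u)"
  have w0: "w \<ge> 0" using prod_list_norm_nonneg[of 1 us] by (simp add: w_def)
  have le: "\<bar>nth_deriv us F y - nth_deriv us Q y\<bar> \<le> e * w" if e: "e > 0" for e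
  proof -
    obtain \<delta> where \<delta>: "\<delta> > 0" "\<And>r. 0 < r \<Longrightarrow> r \<le> \<delta> \<Longrightarrow> jet_le p (e * r ^ m) r (\<lambda>x. F x - Q x) y"
      using J[OF e] by blast
    define r where "r = min \<delta> 1"
    have r: "0 < r" "r \<le> 1" "r \<le> \<delta>" using \<delta> by (auto simp: r_def)
    have "nth_deriv us (\<lambda>x. F x - Q x) y = nth_deriv us F y - nth_deriv us Q y"
      using nth_deriv_diff[OF class_C_le[OF c(1) us] class_C_le[OF c(2) us]] by simp
    then have "\<bar>nth_deriv us F y - nth_deriv us Q y\<bar> \<le> e * r ^ m * (w / r ^ length us)"
      using jet_leD[OF \<delta>(2)[OF r(1,3)] us] by (simp add: w_def prod_list_norm_divide[of r])
    also have "\<dots> = r ^ (m - length us) * (e * w)"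
      using us pm r by (simp add: power_diff field_simps)
    also have "\<dots> \<le> 1 * (e * w)" using r e w0 by (intro mult_right_mono power_le_one) auto
    finally show ?thesis by simp
  qed
  have "\<bar>nth_deriv us F y - nth_deriv us Q y\<bar> \<le> 0"
  proof (rule field_le_epsilon)
    fix e :: real assume "e > 0"
    then have "\<bar>nth_deriv us F y - nth_deriv us Q y\<bar> \<le> e / (w + 1) * w" using w0 by (intro le) auto
    also have "\<dots> \<le> e" using w0 \<open>e > 0\<close> by (simp add: divide_simps)
    finally show "\<bar>nth_deriv us F y - nth_deriv us Q y\<bar> \<le> 0 + e" by simp
  qed
  then show ?thesis by simp
qed

lemma cond_CW_second_deriv:
  fixes P :: "'a::euclidean_space \<Rightarrow> 'a \<Rightarrow> real"
  assumes CW: "cond_CW m P C" and P: "\<And>y. y \<in> C \<Longrightarrow> poly_lt (Suc m) (P y)" and m: "m \<ge> 2" and e: "e > 0"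
  shows "\<exists>\<delta>>0. \<forall>y\<in>C. \<forall>x v. norm v = 1 \<and> 0 < norm (x - y) \<and> norm (x - y) \<le> \<delta> \<longrightarrow>
           nth_deriv [v, v] (P y) x \<ge> - e * norm (x - y) ^ (m - 2)"
proof -
  obtain \<delta> where \<delta>: "\<delta> > 0" and L: "\<And>y v w t. y \<in> C \<Longrightarrow> norm v = 1 \<and> norm w = 1 \<and> 0 < t \<and> t \<le> \<delta> \<Longrightarrow>
      (\<Sum>j=2..m. t ^ (j - 2) / fact (j - 2) * nth_deriv (replicate (j - 2) w @ [v, v]) (P y) y) \<ge> - e * t ^ (m - 2)"
    using CW e unfolding cond_CW_def by meson
  show ?thesis
  proof (intro exI[of _ \<delta>] conjI ballI allI impI \<delta>)
    fix y x v :: 'a assume y: "y \<in> C" and a: "norm v = 1 \<and> 0 < norm (x - y) \<and> norm (x - y) \<le> \<delta>"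
    have x: "x = y + norm (x - y) *\<^sub>R sgn (x - y)" by (simp add: norm_scaleR_sgn)
    have "norm (sgn (x - y)) = 1" using a by (auto simp: norm_sgn)
    then have "- e * norm (x - y) ^ (m - 2) \<le> nth_deriv [v, v] (P y) (y + norm (x - y) *\<^sub>R sgn (x - y))"
      unfolding nth_deriv_second_poly[OF P[OF y] m] using a by (intro L y) simp
    then show "nth_deriv [v, v] (P y) x \<ge> - e * norm (x - y) ^ (m - 2)" by (simp flip: x)
  qed
qed

text \<open>
The lower bound off \<open>y\<close> tends to \<open>0\<close> as the point approaches \<open>y\<close>, because \<open>m - 2 > 0\<close>.
\<close>

lemma cond_CW_nonneg:
  assumes CW: "cond_CW m P C" and P: "\<And>y. y \<in> C \<Longrightarrow> poly_lt (Suc m) (P y)" and m: "m \<ge> 3"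
    and y: "y \<in> C" and v: "norm v = 1"
  shows "nth_deriv [v, v] (P y) y \<ge> 0"
proof -
  obtain \<delta> where \<delta>: "\<delta> > 0" "\<And>x. 0 < norm (x - y) \<Longrightarrow> norm (x - y) \<le> \<delta> \<Longrightarrow>
      nth_deriv [v, v] (P y) x \<ge> - 1 * norm (x - y) ^ (m - 2)"
    using cond_CW_second_deriv[OF CW P, of 1] m y v by fastforce
  define g where "g t = nth_deriv [v, v] (P y) (y + t *\<^sub>R v) + t ^ (m - 2)" for t :: real
  have "continuous_on UNIV (nth_deriv [v, v] (P y))"
    using class_C_nth_deriv[OF poly_lt_class_C[OF P[OF y], of 2], of "[v, v]" 0] by (simp add: class_C_0)
  moreover have "continuous_on UNIV (\<lambda>t::real. y + t *\<^sub>R v)" by (intro continuous_intros)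
  ultimately have "continuous_on UNIV (\<lambda>t::real. nth_deriv [v, v] (P y) (y + t *\<^sub>R v))"
    by (rule continuous_on_compose2) simp
  then have "continuous_on UNIV g"
    unfolding g_def[abs_def] by (intro continuous_on_add continuous_on_power continuous_on_id)
  then have "(g \<longlongrightarrow> g 0) (at_right 0)"
    by (auto simp: continuous_on_def intro: tendsto_within_subset)
  moreover have "eventually (\<lambda>t. 0 \<le> g t) (at_right 0)"
    unfolding eventually_at_right_field
  proof (intro exI[of _ \<delta>] conjI allI impI \<delta>)
    fix t :: real assume "0 < t" "t < \<delta>"
    then show "0 \<le> g t" using \<delta>(2)[of "y + t *\<^sub>R v"] v by (simp add: g_def)
  qed
  ultimately have "0 \<le> g 0" by (rule tendsto_lowerbound) simp
  then show ?thesis using m by (simp add: g_def power_0_left)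
qed

text \<open>
The set \<open>Q\<close> of pairs of a distance \<open>d\<close> and a value of \<open>- D\<^sup>2F(x)(v\<^sup>2) / d\<^sup>m\<^sup>-\<^sup>2\<close> at that distance is
bounded above, since \<open>F\<close> has compact support, and its values are small for small \<open>d\<close> by \<open>(W)\<close> and
\<open>(CW)\<close>.  A barrier for a modulus above \<open>Q\<close> therefore restores convexity.
\<close>

lemma convex_extension_compact:
  fixes C :: "(real ^ 'n::finite) set"
  assumes C: "compact C" "C \<noteq> {}" and m: "m \<ge> 3"
    and P: "\<And>y. y \<in> C \<Longrightarrow> poly_lt (Suc m) (P y)" and W: "cond_W m P C" and CW: "cond_CW m P C"
    and barrier: "\<And>\<omega> R. flat_modulus \<omega> \<Longrightarrow> \<exists>H. convex_barrier (m - 1) C \<omega> R H"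
  shows "\<exists>F. convex_on UNIV F \<and> class_C (m - 1) F \<and>
    (\<forall>y\<in>C. \<forall>us. length us \<le> m - 1 \<longrightarrow> nth_deriv us F y = nth_deriv us (P y) y)"
proof -
  define p where "p = m - 1"
  have mp: "p < m" "m - 2 = p - 1" "2 \<le> p" "2 \<le> m" "1 \<le> m" "m = p - 1 + 2" using m by (auto simp: p_def)
  obtain F R where F: "class_C p F" and FR: "\<And>x. norm x > R \<Longrightarrow> F x = 0"
    and FJ: "\<And>e. e > 0 \<Longrightarrow> \<exists>\<delta>>0. \<forall>y\<in>C. \<forall>x r. norm (x - y) \<le> r \<and> 0 < r \<and> r \<le> \<delta> \<longrightarrow>
       jet_le p (e * r ^ m) r (\<lambda>x. F x - P y x) x"
    using whitney_extension[OF C(1) mp(5) P W] unfolding p_def[symmetric] by metis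
  have F2: "class_C 2 F" using class_C_le[OF F mp(3)] .
  have P2: "class_C k (P y)" if "y \<in> C" for k y using poly_lt_class_C[OF P[OF that]] .
  have jets: "nth_deriv us F y = nth_deriv us (P y) y" if "y \<in> C" "length us \<le> p" for y us
  proof (rule extension_jet_on_C[OF _ mp(1) F P2[OF that(1)] that(2)])
    fix e :: real assume "e > 0"
    from FJ[OF this] obtain \<delta> where \<delta>: "\<delta> > 0" "\<forall>y\<in>C. \<forall>x r. norm (x - y) \<le> r \<and> 0 < r \<and> r \<le> \<delta> \<longrightarrow>
        jet_le p (e * r ^ m) r (\<lambda>x. F x - P y x) x"
      by (elim exE conjE)
    show "\<exists>\<delta>>0. \<forall>r. 0 < r \<and> r \<le> \<delta> \<longrightarrow> jet_le p (e * r ^ m) r (\<lambda>x. F x - P y x) y"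
      using \<delta>(1) bspec[OF \<delta>(2) that(1), rule_format, of y] by (intro exI[of _ \<delta>]) simp
  qed
  have outside: "nth_deriv us F x = 0" if "norm x > R" for us x
  proof -
    have "open {z. R < norm z}" by (intro open_Collect_less continuous_intros)
    then have "nth_deriv us F x = nth_deriv us (\<lambda>x. 0) x"
      using that FR by (intro nth_deriv_local[of "{z. R < norm z}"]) auto
    then show ?thesis by (simp add: nth_deriv_zero)
  qed
  obtain B where B: "\<And>x. x \<in> cball 0 R \<Longrightarrow> jet_le 2 B 1 F x"
    using jet_le_exists_on_compact[OF compact_cball F2, of 0 R] by blast
  have Bd: "- nth_deriv [v, v] F x \<le> \<bar>B\<bar>" if "norm v = 1" for x v
  proof (cases "norm x \<le> R")
    case True
    then show ?thesis using jet_leD[OF B[of x], of "[v, v]"] that by auto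
  qed (use outside[of x "[v, v]"] in auto)
  define defect where "defect x v = - nth_deriv [v, v] F x / infdist x C ^ (p - 1)" for x v
  define Q where "Q = {(infdist x C, defect x v) | x v. norm v = 1 \<and> 0 < infdist x C}"
  have small: "\<exists>\<delta>>0. \<forall>(t, a)\<in>Q. t \<le> \<delta> \<longrightarrow> a \<le> e" if e: "e > 0" for e
  proof -
    obtain \<delta>1 where \<delta>1: "\<delta>1 > 0" "\<And>y x r. y \<in> C \<Longrightarrow> norm (x - y) \<le> r \<Longrightarrow> 0 < r \<Longrightarrow> r \<le> \<delta>1 \<Longrightarrow>
       jet_le p (e / 2 * r ^ m) r (\<lambda>x. F x - P y x) x"
      using FJ[of "e / 2"] e by auto
    obtain \<delta>2 where \<delta>2: "\<delta>2 > 0" "\<And>y x v. y \<in> C \<Longrightarrow> norm v = 1 \<Longrightarrow> 0 < norm (x - y) \<Longrightarrow> norm (x - y) \<le> \<delta>2 \<Longrightarrow>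
       nth_deriv [v, v] (P y) x \<ge> - (e / 2) * norm (x - y) ^ (m - 2)"
      using cond_CW_second_deriv[OF CW P mp(4), of "e / 2"] e by (metis half_gt_zero)
    have "defect x v \<le> e" if v: "norm v = 1" and d: "0 < infdist x C" "infdist x C \<le> min \<delta>1 \<delta>2" for x v
    proof -
      obtain y where y: "y \<in> C" "infdist x C = dist x y"
        using infdist_attains_inf[of C x] C compact_imp_closed by blast
      define r where "r = infdist x C"
      have r: "r = norm (x - y)" "0 < r" "r \<le> \<delta>1" "r \<le> \<delta>2" using y d by (auto simp: r_def dist_norm)
      have "jet_le p (e / 2 * r ^ m) r (\<lambda>x. F x - P y x) x" using r y by (intro \<delta>1) auto
      from jet_leD[OF this, of "[v, v]"] have "\<bar>nth_deriv [v, v] (\<lambda>x. F x - P y x) x\<bar> \<le> e / 2 * r ^ m * (1 / r * (1 / r))"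
        using v mp by simp
      also have "\<dots> = e / 2 * r ^ (p - 1)"
      proof -
        have "r ^ m = r ^ (p - 1) * r\<^sup>2" using power_add[of r "p - 1" 2] by (simp only: flip: mp(6))
        then show ?thesis using r by (simp add: power2_eq_square)
      qed
      finally have "\<bar>nth_deriv [v, v] F x - nth_deriv [v, v] (P y) x\<bar> \<le> e / 2 * r ^ (p - 1)"
        using nth_deriv_diff[of "[v, v]" F "P y"] F2 P2[OF y(1)] by (simp add: numeral_2_eq_2)
      moreover have "nth_deriv [v, v] (P y) x \<ge> - (e / 2) * r ^ (p - 1)"
        using \<delta>2(2)[OF y(1) v, of x] r mp by simp
      moreover have "e * r ^ (p - 1) = e / 2 * r ^ (p - 1) + e / 2 * r ^ (p - 1)" by simp
      ultimately have "- nth_deriv [v, v] F x \<le> e * r ^ (p - 1)" by linarith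
      then show ?thesis
        unfolding defect_def r_def[symmetric] using r(2) by (subst pos_divide_le_eq) auto
    qed
    then show ?thesis using \<delta>1(1) \<delta>2(1) by (intro exI[of _ "min \<delta>1 \<delta>2"]) (auto simp: Q_def)
  qed
  obtain \<delta> where \<delta>: "\<delta> > 0" "\<And>t a. (t, a) \<in> Q \<Longrightarrow> t \<le> \<delta> \<Longrightarrow> a \<le> 1" using small[of 1] by auto
  have Q_le: "a \<le> max 1 (\<bar>B\<bar> / \<delta> ^ (p - 1))" if tQ: "(t, a) \<in> Q" for t a
  proof (cases "t \<le> \<delta>")
    case True
    then show ?thesis using \<delta>(2)[OF tQ] by simp
  next
    case False
    obtain x v where xv: "t = infdist x C" "a = defect x v" "norm v = 1" using tQ by (auto simp: Q_def)
    have "a \<le> \<bar>B\<bar> / t ^ (p - 1)"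
      unfolding xv defect_def using Bd[OF xv(3)] by (intro divide_right_mono zero_le_power infdist_nonneg) auto
    also have "\<dots> \<le> \<bar>B\<bar> / \<delta> ^ (p - 1)"
      using False \<delta>(1) by (intro divide_left_mono power_mono mult_pos_pos zero_less_power) auto
    finally show ?thesis by simp
  qed
  have Q_pos: "0 < t" if "(t, a) \<in> Q" for t a using that by (auto simp: Q_def)
  have "\<exists>\<omega>. flat_modulus \<omega> \<and> (\<forall>(t, a)\<in>Q. a \<le> \<omega> t)"
    by (rule flat_modulus_majorant) (fact Q_pos Q_le small)+
  then obtain \<omega> where \<omega>: "flat_modulus \<omega>" "\<And>t a. (t, a) \<in> Q \<Longrightarrow> a \<le> \<omega> t" by blast
  obtain H where H: "convex_barrier p C \<omega> R H" using barrier[OF \<omega>(1)] by (auto simp: p_def)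
  have Hp: "class_C p H" and H0: "\<And>y us. y \<in> C \<Longrightarrow> length us \<le> p \<Longrightarrow> nth_deriv us H y = 0"
    and HD0: "\<And>x v. norm v = 1 \<Longrightarrow> 0 \<le> nth_deriv [v, v] H x"
    and HD: "\<And>x v. norm v = 1 \<Longrightarrow> norm x \<le> R \<Longrightarrow> infdist x C ^ (p - 1) * \<omega> (infdist x C) \<le> nth_deriv [v, v] H x"
    using H unfolding convex_barrier_def by (blast intro: jet_le_0_nth_deriv)+
  define G where "G x = F x + H x" for x
  have G: "class_C p G" unfolding G_def[abs_def] by (intro class_C_add F Hp)
  have DG: "nth_deriv us G x = nth_deriv us F x + nth_deriv us H x" if "length us \<le> p" for us x
    unfolding G_def[abs_def] using nth_deriv_add[OF class_C_le[OF F that] class_C_le[OF Hp that]] by simp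
  have "nth_deriv [v, v] G x \<ge> 0" if v: "norm v = 1" for x v
  proof -
    have D: "nth_deriv [v, v] G x = nth_deriv [v, v] F x + nth_deriv [v, v] H x" using mp by (intro DG) simp
    consider "norm x > R" | "x \<in> C" | "norm x \<le> R" "x \<notin> C" by linarith
    then show ?thesis
    proof cases
      case 1
      then show ?thesis using D HD0[OF v] outside by simp
    next
      case 2
      then show ?thesis using D HD0[OF v, of x] jets[of x "[v, v]"] mp cond_CW_nonneg[OF CW P m 2 v] by simp
    next
      case 3
      have d: "0 < infdist x C"
        using 3(2) C compact_imp_closed in_closed_iff_infdist_zero[of C x] infdist_nonneg[of x C] by fastforce
      then have "defect x v \<le> \<omega> (infdist x C)" using v by (intro \<omega>(2)) (auto simp: Q_def)
      then have "- nth_deriv [v, v] F x \<le> infdist x C ^ (p - 1) * \<omega> (infdist x C)"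
        unfolding defect_def using d by (subst (asm) pos_divide_le_eq) (auto simp: mult.commute)
      then show ?thesis using D HD[OF v 3(1)] by linarith
    qed
  qed
  then have "convex_on UNIV G"
    using class_C_le[OF G mp(3)] by (intro convex_on_UNIV_second_deriv)
  moreover have "nth_deriv us G y = nth_deriv us (P y) y" if "y \<in> C" "length us \<le> p" for y us
    using DG[OF that(2)] jets[OF that] H0[OF that] by simp
  ultimately show ?thesis using G unfolding p_def by blast
qed

section \<open>The whole space\<close>

text \<open>
Whitney's condition says that the derivative of order \<open>length us < m\<close> of \<open>P z\<close> at \<open>z\<close> and that of
\<open>P y\<close> at \<open>z\<close> differ by \<open>o(norm (z - y))\<close>; so the coefficients of the field are differentiable with the
expected derivatives.
\<close>

lemma whitney_field_on_UNIV:
  assumes m: "m \<ge> 1" and P: "\<And>y. poly_lt (Suc m) (P y)" and W: "cond_W m P UNIV"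
    and us: "length us \<le> m - 1"
  shows "nth_deriv us (\<lambda>y. P y y) = (\<lambda>y. nth_deriv us (P y) y)"
    and "nth_deriv us (\<lambda>y. P y y) differentiable (at y)"
proof -
  define a where "a us y = nth_deriv us (P y) y" for us y
  have D: "(a us has_derivative (\<lambda>u. a (u # us) y)) (at y)" if us: "length us < m" for us y
  proof -
    let ?f = "nth_deriv us (P y)"
    let ?q = "m - length us"
    have "class_C 1 ?f"
      using class_C_nth_deriv[OF poly_lt_class_C[OF P], of us 1 "length us + 1" y] by simp
    then have "?f differentiable (at y)" by (simp add: class_C_Suc)
    from has_derivative_dd[OF this]
    have f: "(?f has_derivative (\<lambda>u. a (u # us) y)) (at y)" by (simp add: a_def nth_deriv_Cons)
    define w where "w = (\<Prod>u\<leftarrow>us. norm u)"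
    have w0: "w \<ge> 0" using prod_list_norm_nonneg[of 1 us] by (simp add: w_def)
    have "((\<lambda>z. a us z - ?f z) has_derivative (\<lambda>u. 0)) (at y)"
      unfolding has_derivative_at_alt
    proof (intro conjI allI impI)
      show "bounded_linear (\<lambda>u. 0)" by (rule bounded_linear_zero)
      fix e :: real assume e: "e > 0"
      have "e / (w + 1) > 0" using e w0 by simp
      from cond_W_jet[OF W compact_cball subset_UNIV P this, of y 1]
      obtain \<delta> where \<delta>0: "\<delta> > 0" "\<forall>y'\<in>cball y 1. \<forall>z\<in>cball y 1. \<forall>b. 0 < b \<and> b \<le> \<delta> \<and> norm (y' - z) \<le> b \<longrightarrow>
           jet_le m (e / (w + 1) * b ^ m) b (\<lambda>x. P y' x - P z x) z" by (elim exE conjE)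
      have "y \<in> cball y 1" by simp
      note \<delta> = \<delta>0(1) bspec[OF bspec[OF \<delta>0(2) this], rule_format]
      show "\<exists>d>0. \<forall>z. norm (z - y) < d \<longrightarrow> norm (a us z - ?f z - (a us y - ?f y) - 0) \<le> e * norm (z - y)"
      proof (intro exI[of _ "min \<delta> 1"] conjI allI impI)
        show "min \<delta> 1 > 0" using \<delta> by simp
        fix z assume z: "norm (z - y) < min \<delta> 1"
        show "norm (a us z - ?f z - (a us y - ?f y) - 0) \<le> e * norm (z - y)"
        proof (cases "z = y")
          case False
          define b where "b = norm (z - y)"
          have b: "0 < b" "b \<le> \<delta>" "b \<le> 1" "norm (y - z) \<le> b" "z \<in> cball y 1"
            using False z by (auto simp: b_def norm_minus_commute dist_norm)
          have c: "class_C (length us) (P w)" for w using poly_lt_class_C[OF P] .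
          have "\<bar>nth_deriv us (\<lambda>x. P y x - P z x) z\<bar> \<le> e / (w + 1) * b ^ m * (w / b ^ length us)"
            using jet_leD[OF \<delta>(2)[OF b(5), of b], of us] us b
            by (simp add: w_def prod_list_norm_divide[of b])
          also have "\<dots> = (e * (w / (w + 1))) * b ^ ?q"
            using us b by (simp add: power_diff)
          also have "\<dots> \<le> (e * 1) * b ^ 1"
            using b us e w0 by (intro mult_mono mult_left_mono power_decreasing) (auto simp: divide_simps)
          finally have "\<bar>?f z - a us z\<bar> \<le> e * b"
            using nth_deriv_diff[OF c c, of y z] by (simp add: a_def)
          then show ?thesis by (simp add: a_def b_def abs_minus_commute)
        qed (simp add: a_def)
      qed
    qed
    from has_derivative_add[OF this f] show ?thesis by simp
  qed
  have eq: "nth_deriv us (\<lambda>y. P y y) = a us" if "length us \<le> m" for us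
    using that
  proof (induction us)
    case Nil
    then show ?case by (auto simp: a_def)
  next
    case (Cons u us)
    then have "nth_deriv (u # us) (\<lambda>y. P y y) = dd u (a us)" by (simp add: nth_deriv_Cons)
    also have "\<dots> = a (u # us)" using Cons.prems by (intro ext dd_eq[OF D]) simp
    finally show ?case .
  qed
  show "nth_deriv us (\<lambda>y. P y y) = (\<lambda>y. nth_deriv us (P y) y)"
    using eq[of us] us by (auto simp: a_def)
  show "nth_deriv us (\<lambda>y. P y y) differentiable (at y)"
  proof -
    have "length us < m" using us m by simp
    then show ?thesis using eq[of us] D[of us y] by (auto simp: differentiable_def)
  qed
qed

lemma convex_extension_UNIV:
  assumes m: "m \<ge> 3" and P: "\<And>y. poly_lt (Suc m) (P y)" and W: "cond_W m P UNIV" and CW: "cond_CW m P UNIV"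
  shows "\<exists>F. convex_on UNIV F \<and> class_C (m - 1) F \<and>
    (\<forall>y. \<forall>us. length us \<le> m - 1 \<longrightarrow> nth_deriv us F y = nth_deriv us (P y) y)"
proof -
  let ?F = "\<lambda>y. P y y"
  have m1: "1 \<le> m" using m by simp
  note d = whitney_field_on_UNIV[OF m1 P W]
  have c: "class_C (m - 1) ?F"
    unfolding class_C_def using d(2)
    by (auto intro!: continuous_at_imp_continuous_on differentiable_imp_continuous_within)
  have "nth_deriv [v, v] ?F x \<ge> 0" if "norm v = 1" for x v
    using d(1)[of "[v, v]"] m cond_CW_nonneg[OF CW P m UNIV_I that] by simp
  moreover have "class_C 2 ?F" using class_C_le[OF c] m by simp
  ultimately have "convex_on UNIV ?F" by (intro convex_on_UNIV_second_deriv)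
  then show ?thesis using c d(1) by (intro exI[of _ ?F]) auto
qed

section \<open>Convex extension from intersections of ovaloids\<close>

lemma bounded_sublevel_strongly_convex:
  assumes f: "class_C 2 f" and M: "M > 0" "\<And>x v. norm v = 1 \<Longrightarrow> nth_deriv [v, v] f x \<ge> M"
  shows "bounded {x. f x \<le> c}"
proof -
  obtain A where "jet_le 2 A 1 f 0" using jet_le_exists_on_compact[of "{0}" 2 f] f by auto
  then have A: "\<bar>dd h f 0\<bar> \<le> A * norm h" for h using jet_leD[of 2 A 1 f 0 "[h]"] by (simp add: nth_deriv_Cons)
  have "norm x \<le> 1 + 2 * (\<bar>c - f 0\<bar> + A) / M" if "f x \<le> c" for x
  proof (cases "norm x \<le> 1")
    case False
    have A0: "0 \<le> A" using jet_leD[OF \<open>jet_le 2 A 1 f 0\<close>, of "[]"] by simp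
    have "f 0 + dd x f 0 + M / 2 * (norm x)\<^sup>2 \<le> c"
      using strongly_convex_lower_bound[OF f M(2), of 0 x] that by simp
    then have "M / 2 * (norm x)\<^sup>2 \<le> \<bar>c - f 0\<bar> + A * norm x" using A[of x] by linarith
    also have "\<dots> \<le> (\<bar>c - f 0\<bar> + A) * norm x"
      using False mult_left_mono[of 1 "norm x" "\<bar>c - f 0\<bar>"] by (simp add: algebra_simps)
    finally have "(M / 2 * norm x) * norm x \<le> (\<bar>c - f 0\<bar> + A) * norm x" by (simp add: power2_eq_square)
    then have "M / 2 * norm x \<le> \<bar>c - f 0\<bar> + A" using False by (subst (asm) mult_le_cancel_right) auto
    then show ?thesis using M(1) by (simp add: field_simps)
  next
    case True
    have A0: "0 \<le> A" using jet_leD[OF \<open>jet_le 2 A 1 f 0\<close>, of "[]"] by simp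
    then have "0 \<le> 2 * (\<bar>c - f 0\<bar> + A) / M" using M(1) by simp
    then show ?thesis using True by linarith
  qed
  then show ?thesis by (auto simp: bounded_iff)
qed

lemma strongly_convex_midpoint:
  assumes f: "class_C 2 f" and M: "M > 0" "\<And>x v. norm v = 1 \<Longrightarrow> nth_deriv [v, v] f x \<ge> M"
    and ab: "a \<noteq> b" "f a \<le> c" "f b \<le> c"
  shows "f ((1 / 2) *\<^sub>R (a + b)) < c"
proof -
  define z where "z = (1 / 2) *\<^sub>R (a + b)"
  define h where "h = (1 / 2) *\<^sub>R (b - a)"
  have zh: "z + h = b" "z + (-1) *\<^sub>R h = a"
    unfolding z_def h_def by (auto simp: algebra_simps simp flip: scaleR_left_distrib)
  have "dd ((-1) *\<^sub>R h) f z = - dd h f z"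
    using dd_scale_arg[of f z "-1" h] class_C_differentiable[OF f] by simp
  moreover have "0 < M / 2 * (norm h)\<^sup>2" using ab(1) M(1) by (simp add: h_def)
  ultimately have "f z < c"
    using strongly_convex_lower_bound[OF f M(2), of z h] strongly_convex_lower_bound[OF f M(2), of z "(-1) *\<^sub>R h"] ab
    unfolding zh by simp
  then show ?thesis by (simp add: z_def)
qed

text \<open>
If \<open>C\<close> has two different points, then by strict convexity their midpoint satisfies all constraints
strictly, so it is a Slater point; otherwise \<open>C\<close> is a singleton.
\<close>

lemma FIO_barrier:
  fixes C :: "(real ^ 'n::finite) set"
  assumes FIO: "FIO p C" and C: "C \<noteq> {}" "C \<noteq> UNIV" and p: "p \<ge> 2"
  shows "compact C \<and> (\<forall>\<omega> R. flat_modulus \<omega> \<longrightarrow> (\<exists>H. convex_barrier p C \<omega> R H))"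
proof -
  obtain \<A> where \<A>: "finite \<A>" "\<And>A. A \<in> \<A> \<Longrightarrow> ovaloid p A" "C = \<Inter>\<A>" using FIO by (auto simp: FIO_def)
  have ne: "\<A> \<noteq> {}" using \<A>(3) C(2) by auto
  have "\<forall>A\<in>\<A>. \<exists>M \<psi>. M > 0 \<and> class_C p \<psi> \<and> (\<forall>x v. norm v = 1 \<longrightarrow> nth_deriv [v, v] \<psi> x \<ge> M) \<and> A = \<psi> -` {..1}"
    using \<A>(2) by (auto simp: ovaloid_def)
  then obtain M \<psi> where M: "\<And>A. A \<in> \<A> \<Longrightarrow> M A > 0" and \<psi>: "\<And>A. A \<in> \<A> \<Longrightarrow> class_C p (\<psi> A)"
    and D: "\<And>A x v. A \<in> \<A> \<Longrightarrow> norm v = 1 \<Longrightarrow> nth_deriv [v, v] (\<psi> A) x \<ge> M A"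
    and eq: "\<And>A. A \<in> \<A> \<Longrightarrow> A = \<psi> A -` {..1}"
    by metis
  have \<psi>2: "class_C 2 (\<psi> A)" if "A \<in> \<A>" for A using class_C_le[OF \<psi>[OF that] p] .
  have Ceq: "C = {x. \<forall>A\<in>\<A>. \<psi> A x \<le> 1}" unfolding \<A>(3) using eq by (auto; blast)
  have "compact A" if A: "A \<in> \<A>" for A
  proof -
    have A': "A = {x. \<psi> A x \<le> 1}" using eq[OF A] by auto
    have "closed {x. \<psi> A x \<le> 1}"
      using class_C_continuous[OF \<psi>[OF A]] by (intro closed_Collect_le continuous_intros) auto
    moreover have "bounded {x. \<psi> A x \<le> 1}"
      by (rule bounded_sublevel_strongly_convex[OF \<psi>2[OF A] M[OF A] D[OF A]])
    ultimately show ?thesis using A' compact_eq_bounded_closed by metis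
  qed
  then have "compact C" unfolding \<A>(3) using ne by (intro compact_Inter) auto
  moreover have "\<exists>H. convex_barrier p C \<omega> R H" if \<omega>: "flat_modulus \<omega>" for \<omega> R
  proof (cases "\<exists>c. C = {c}")
    case True
    then show ?thesis using convex_barrier_singleton[OF p \<omega>] by blast
  next
    case False
    then obtain a b where ab: "a \<in> C" "b \<in> C" "a \<noteq> b" using C(1) by blast
    have mid: "\<psi> A ((1 / 2) *\<^sub>R (a + b)) < 1" if A: "A \<in> \<A>" for A
      using ab Ceq A by (intro strongly_convex_midpoint[OF \<psi>2[OF A] M[OF A] D[OF A]]) auto
    show ?thesis
      by (rule convex_barrier_ovaloids[OF \<A>(1) ne p \<omega> M \<psi> D Ceq mid])
  qed
  ultimately show ?thesis by blast
qed

theorem theorem1p10: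
  fixes C :: "(real ^ 'n::finite) set"
    and f :: "real ^ 'n \<Rightarrow> real"
    and P :: "real ^ 'n \<Rightarrow> real ^ 'n \<Rightarrow> real"
    and m :: nat
  assumes "convex C"
    and "m \<ge> 3"
    and "\<And>y. y \<in> C \<Longrightarrow> polynomial_deg_le m (P y)"
    and "\<And>y. y \<in> C \<Longrightarrow> P y y = f y"
    and "cond_W m P C"
    and "cond_CW m P C"
    and "FIO (m - 1) C"
  shows "\<exists>F :: real ^ 'n \<Rightarrow> real.
           convex_on UNIV F \<and> class_C (m - 1) F \<and>
           (\<forall>y\<in>C. F y = f y) \<and>
           (\<forall>y\<in>C. taylor_poly (m - 1) y F = taylor_poly (m - 1) y (P y))"
proof -
  note W = assms(5) and CW = assms(6)
  have P: "\<And>y. y \<in> C \<Longrightarrow> poly_lt (Suc m) (P y)"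
    using assms(3) by (rule poly_lt_polynomial_deg_le)
  have "\<exists>F. convex_on UNIV F \<and> class_C (m - 1) F \<and>
    (\<forall>y\<in>C. \<forall>us. length us \<le> m - 1 \<longrightarrow> nth_deriv us F y = nth_deriv us (P y) y)"
  proof (cases "C = {} \<or> C = UNIV")
    case True
    then show ?thesis
    proof
      assume "C = {}"
      then show ?thesis by (intro exI[of _ "\<lambda>x. 0"]) (auto simp: class_C_const convex_on_const)
    next
      assume "C = UNIV"
      then show ?thesis using convex_extension_UNIV[OF assms(2), of P] P W CW by simp
    qed
  next
    case False
    then have "compact C \<and> (\<forall>\<omega> R. flat_modulus \<omega> \<longrightarrow> (\<exists>H. convex_barrier (m - 1) C \<omega> R H))"
      using assms(2) by (intro FIO_barrier[OF assms(7)]) auto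
    then show ?thesis using False by (intro convex_extension_compact[OF _ _ assms(2) P W CW]) auto
  qed
  then obtain F where F: "convex_on UNIV F" "class_C (m - 1) F"
    "\<And>y us. y \<in> C \<Longrightarrow> length us \<le> m - 1 \<Longrightarrow> nth_deriv us F y = nth_deriv us (P y) y" by blast
  have "F y = f y" if "y \<in> C" for y using F(3)[OF that, of "[]"] assms(4)[OF that] by simp
  moreover have "taylor_poly (m - 1) y F = taylor_poly (m - 1) y (P y)" if "y \<in> C" for y
    by (rule ext) (simp add: taylor_poly_def F(3)[OF that])
  ultimately show ?thesis using F by blast
qed

end
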